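(* Let $T>0$, $d\in\mathbb{N}$, and let $\pi$ be a Lévy density that is strictly positive on $(0,\infty)$ and identically zero elsewhere. Let $g(x)=\int_x^\infty\pi(s)\,ds$ for $x>0$, $g(0)=\int_0^\infty \pi(s)\,ds\in(0,\infty]$, and let $g^{-1}:(0,g(0))\to(0,\infty)$ be the inverse of the strictly decreasing function $g$. Let $\{U_i\}_{i\ge1}$ be i.i.d. uniform random variables on $[0,1]$, independent of $\{\Gamma_i\}_{i\ge1}$, where $\Gamma_i=E_1+\dots+E_i$ for an i.i.d. sequence $\{E_i\}_{i\ge 1}$ of exponential random variables with mean $1$. Define, for $r>0$ and $v\in[0,1]$, $$H(r,v)=f\big(g^{-1}(r/T)\,\mathbb{I}(0<r/T<g(0)),\,Tv\big)$$ (the first argument of $f$ being $0$ when $r/T\ge g(0)$), where $f:\mathbb{R}\times[0,T]\to\mathbb{R}^d$ has $k$-th component $$f_k(x,t)=\frac{\sqrt{2T}\,x}{\varpi}\,\frac{\cos\left(\frac{\varpi}{T}\left(k-\frac12\right)t\right)}{k-\frac12},\qquad k\in\{1,\dots,d\},$$ and $\varpi=3.14159\ldots$ denotes the circle constant. For a process $X$ let $Z^{(d)}=(Z_1,\dots,Z_d)^{\mathbf{T}}$ with $$Z_k=\int_0^TX_t\sqrt{\tfrac2T}\,\sin\!\left(\tfrac{\varpi}{T}\left(k-\tfrac12\right)t\right)dt .$$ (i) If $X\in\mathcal{KB}$ with generating triple $(a,0,\pi)_{h\equiv0}$, then $Z^{(d)}$ has the shot-noise representation $$Z^{(d)}\overset{d}{=}\mathbf{a}+\sum_{i\ge1}H(\Gamma_i,U_i),$$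 where the series converges almost surely and $\mathbf{a}\in\mathbb{R}^d$ has entries $$a_k=a\,\frac{(-1)^{k+1}\sqrt2\,T^{3/2}}{\varpi^2\left(k-\frac12\right)^2},\qquad k\in\{1,\dots,d\}.$$ (ii) If $X\in\mathcal{K}$ with generating triple $(0,0,\pi)_{h\equiv1}$, then $Z^{(d)}$ has the shot-noise representation $$Z^{(d)}\overset{d}{=}\lim_{n\to\infty}\left(\sum_{i=1}^nH(\Gamma_i,U_i)-C(n)\right),$$ where the limit exists almost surely and $C:(0,\infty)\to\mathbb{R}^d$ has components $$C_k(s)=\int_0^s\int_0^1P_k(H(r,v))\,dv\,dr,\qquad k\in\{1,\dots,d\},$$ with $P_k$ the projection onto the $k$-th coordinate.
   Context: A one-dimensional Lévy process $X$ satisfies $\mathbb{E}[e^{izX_t}]=e^{-t\Psi_X(z)}$, $z\in\mathbb{R}$, with $$\Psi_X(z)=\tfrac12\sigma^2z^2-iaz-\int_{\mathbb{R}\setminus\{0\}}\left(e^{izx}-1-izx\,h(x)\right)\nu(dx),$$ where $\nu$ (the Lévy measure) satisfies $\int\min(1,x^2)\,\nu(dx)<\infty$ and $h$ is a cut-off function; $(a,\sigma^2,\nu)_{h\equiv c}$ denotes the generating triple with respect to the constant cut-off $h\equiv c$. When $\nu(dx)=\pi(x)\,dx$, the function $\pi$ is called the Lévy density and the triple is written $(a,\sigma^2,\pi)_{h\equiv c}$. $\mathcal{K}$ is the set of one-dimensional Lévy processes with $\mathbb{E}[X_t]=0$ and $\mathbb{E}[X_t^2]<\infty$ for every $t\ge0$;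 each has a triple of the form $(0,\sigma^2,\nu)_{h\equiv1}$. $\mathcal{KB}$ is the subset of those $X\in\mathcal{K}$ whose Lévy measure satisfies $\int_{|x|\le1}|x|\,\nu(dx)<\infty$; each such $X$ has a triple of the form $(a,\sigma^2,\nu)_{h\equiv0}$ with $a=-\int_{\mathbb{R}\setminus\{0\}}x\,\nu(dx)$. $\mathbb{I}$ denotes the indicator and $\overset{d}{=}$ equality in distribution. The $Z_k$ are the stochastic coefficients of the Karhunen–Loève expansion of $X$ on $[0,T]$. *)

theory Defs
  imports "HOL-Probability.Probability"
begin

text \<open>
  A process is a function \<open>X :: real \<Rightarrow> 'a \<Rightarrow> real\<close>, of which only the times \<open>t \<ge> 0\<close> are ever
  used. Vectors in \<open>R^d\<close> are functions on \<open>{1..d}\<close>, with the product sigma-algebra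
  \<open>PiM {1..d} (\<lambda>_. borel)\<close>; hence limits in \<open>R^d\<close> are taken coordinate by coordinate.
\<close>

definition cadlag :: "(real \<Rightarrow> real) \<Rightarrow> bool" where
  "cadlag w \<longleftrightarrow>
     (\<forall>t\<ge>0. (w \<longlongrightarrow> w t) (at_right t)) \<and>
     (\<forall>t>0. \<exists>l. (w \<longlongrightarrow> l) (at_left t))"

text \<open>
  Continuity in probability is not listed because it follows from the remaining conditions.
\<close>

definition levy_process :: "'a measure \<Rightarrow> (real \<Rightarrow> 'a \<Rightarrow> real) \<Rightarrow> bool" where
  "levy_process M X \<longleftrightarrow>
     prob_space M \<and>
     (\<forall>t\<ge>0. X t \<in> borel_measurable M) \<and>
     (AE \<omega> in M. X 0 \<omega> = 0) \<and>
     (\<forall>n (t :: nat \<Rightarrow> real). 0 \<le> t 0 \<and> (\<forall>i<n. t i \<le> t (Suc i)) \<longrightarrow>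
        prob_space.indep_vars M (\<lambda>_. borel) (\<lambda>i \<omega>. X (t (Suc i)) \<omega> - X (t i) \<omega>) {..<n}) \<and>
     (\<forall>s\<ge>0. \<forall>t\<ge>0.
        distr M borel (\<lambda>\<omega>. X (s + t) \<omega> - X s \<omega>) = distr M borel (\<lambda>\<omega>. X t \<omega> - X 0 \<omega>)) \<and>
     (AE \<omega> in M. cadlag (\<lambda>t. X t \<omega>))"

definition levy_measure :: "real measure \<Rightarrow> bool" where
  "levy_measure \<nu> \<longleftrightarrow>
     sets \<nu> = sets borel \<and> emeasure \<nu> {0} = 0 \<and>
     (\<integral>\<^sup>+ x. ennreal (min 1 (x\<^sup>2)) \<partial>\<nu>) < \<infinity>"

definition density_measure :: "(real \<Rightarrow> real) \<Rightarrow> real measure" where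
  "density_measure \<pi> = density lborel (\<lambda>x. ennreal (\<pi> x))"

definition levy_density :: "(real \<Rightarrow> real) \<Rightarrow> bool" where
  "levy_density \<pi> \<longleftrightarrow>
     \<pi> \<in> borel_measurable borel \<and> (\<forall>x. 0 \<le> \<pi> x) \<and> levy_measure (density_measure \<pi>)"

definition levy_exponent ::
  "real \<Rightarrow> real \<Rightarrow> real measure \<Rightarrow> (real \<Rightarrow> real) \<Rightarrow> real \<Rightarrow> complex" where
  "levy_exponent a \<sigma>2 \<nu> h z =
     of_real (\<sigma>2 * z\<^sup>2 / 2) - \<i> * of_real (a * z)
     - (CLINT x|\<nu>. exp (\<i> * of_real (z * x)) - 1 - \<i> * of_real (z * x * h x))"

text \<open>
  \<open>generating_triple M X a \<sigma>2 \<nu> h\<close>: the process \<open>X\<close> has the triple \<open>(a, \<sigma>2, \<nu>)\<close> with respect to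
  the cut-off \<open>h\<close>. Integrability is required because the Bochner integral of a non-integrable
  function is \<open>0\<close>; it expresses that \<open>h\<close> is an admissible cut-off for \<open>\<nu>\<close>.
\<close>

definition generating_triple ::
  "'a measure \<Rightarrow> (real \<Rightarrow> 'a \<Rightarrow> real) \<Rightarrow> real \<Rightarrow> real \<Rightarrow> real measure \<Rightarrow> (real \<Rightarrow> real) \<Rightarrow> bool" where
  "generating_triple M X a \<sigma>2 \<nu> h \<longleftrightarrow>
     0 \<le> \<sigma>2 \<and> levy_measure \<nu> \<and>
     (\<forall>z::real. integrable \<nu>
        (\<lambda>x. exp (\<i> * of_real (z * x)) - 1 - \<i> * of_real (z * x * h x))) \<and>
     (\<forall>t\<ge>0. \<forall>z. char (distr M borel (X t)) z = exp (- of_real t * levy_exponent a \<sigma>2 \<nu> h z))"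

text \<open>
  The cut-off \<open>indicator {-1..1}\<close> is admissible for every Levy measure, so this singles out the
  Levy measure of an arbitrary Levy process.
\<close>

definition is_levy_measure_of ::
  "real measure \<Rightarrow> 'a measure \<Rightarrow> (real \<Rightarrow> 'a \<Rightarrow> real) \<Rightarrow> bool" where
  "is_levy_measure_of \<nu> M X \<longleftrightarrow> (\<exists>a \<sigma>2. generating_triple M X a \<sigma>2 \<nu> (indicator {-1..1}))"

definition class_K :: "'a measure \<Rightarrow> (real \<Rightarrow> 'a \<Rightarrow> real) set" where
  "class_K M = {X. levy_process M X \<and>
     (\<forall>t\<ge>0. integrable M (X t) \<and> (\<integral>\<omega>. X t \<omega> \<partial>M) = 0 \<and> integrable M (\<lambda>\<omega>. (X t \<omega>)\<^sup>2))}"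

definition class_KB :: "'a measure \<Rightarrow> (real \<Rightarrow> 'a \<Rightarrow> real) set" where
  "class_KB M = {X \<in> class_K M. \<exists>\<nu>. is_levy_measure_of \<nu> M X \<and>
     (\<integral>\<^sup>+ x \<in> {-1..1}. ennreal \<bar>x\<bar> \<partial>\<nu>) < \<infinity>}"

definition kl_coeff :: "real \<Rightarrow> (real \<Rightarrow> 'a \<Rightarrow> real) \<Rightarrow> nat \<Rightarrow> 'a \<Rightarrow> real" where
  "kl_coeff T X k \<omega> =
     (LBINT t:{0..T}. X t \<omega> * (sqrt (2 / T) * sin (pi / T * (real k - 1/2) * t)))"

definition levy_tail :: "(real \<Rightarrow> real) \<Rightarrow> real \<Rightarrow> ennreal" where
  "levy_tail \<pi> x = (\<integral>\<^sup>+ s \<in> {x<..}. ennreal (\<pi> s) \<partial>lborel)"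

definition levy_tail_inv :: "(real \<Rightarrow> real) \<Rightarrow> real \<Rightarrow> real" where
  "levy_tail_inv \<pi> y = the_inv_into {0<..} (levy_tail \<pi>) (ennreal y)"

definition kl_f :: "real \<Rightarrow> nat \<Rightarrow> real \<Rightarrow> real \<Rightarrow> real" where
  "kl_f T k x t =
     sqrt (2 * T) * x / pi * (cos (pi / T * (real k - 1/2) * t) / (real k - 1/2))"

text \<open>The \<open>k\<close>-th coordinate of \<open>H(r, v)\<close>.\<close>

definition shot_H :: "real \<Rightarrow> (real \<Rightarrow> real) \<Rightarrow> nat \<Rightarrow> real \<Rightarrow> real \<Rightarrow> real" where
  "shot_H T \<pi> k r v =
     kl_f T k (if 0 < r / T \<and> ennreal (r / T) < levy_tail \<pi> 0 then levy_tail_inv \<pi> (r / T) else 0) (T * v)"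

definition shot_C :: "real \<Rightarrow> (real \<Rightarrow> real) \<Rightarrow> nat \<Rightarrow> real \<Rightarrow> real" where
  "shot_C T \<pi> k s = (LBINT r:{0<..s}. (LBINT v:{0..1}. shot_H T \<pi> k r v))"

definition drift_coeff :: "real \<Rightarrow> real \<Rightarrow> nat \<Rightarrow> real" where
  "drift_coeff T a k =
     a * ((-1) ^ (k + 1) * sqrt 2 * T powr (3/2)) / (pi\<^sup>2 * (real k - 1/2)\<^sup>2)"

definition arrival :: "(nat \<Rightarrow> 'b \<Rightarrow> real) \<Rightarrow> nat \<Rightarrow> 'b \<Rightarrow> real" where
  "arrival E i \<omega> = (\<Sum>j=1..i. E j \<omega>)"

definition eq_in_distr ::
  "'c measure \<Rightarrow> 'a measure \<Rightarrow> ('a \<Rightarrow> 'c) \<Rightarrow> 'b measure \<Rightarrow> ('b \<Rightarrow> 'c) \<Rightarrow> bool" where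
  "eq_in_distr S M Y N W \<longleftrightarrow>
     Y \<in> measurable M S \<and> W \<in> measurable N S \<and> distr M S Y = distr N S W"

text \<open>
  \<open>Z\<^sup>(\<^sup>d\<^sup>)\<close> has the same law as \<open>W\<close>. Paths are cadlag only almost surely, so the pathwise integrals
  are random variables on the completion of \<open>M\<close> but not necessarily on \<open>M\<close> itself.
\<close>

definition kl_coeffs_distr ::
  "nat \<Rightarrow> real \<Rightarrow> 'a measure \<Rightarrow> (real \<Rightarrow> 'a \<Rightarrow> real) \<Rightarrow> 'b measure \<Rightarrow> (nat \<Rightarrow> 'b \<Rightarrow> real) \<Rightarrow> bool" where
  "kl_coeffs_distr d T M X N W \<longleftrightarrow>
     eq_in_distr (PiM {1..d} (\<lambda>_. borel))
       (completion M) (\<lambda>\<omega>. \<lambda>k\<in>{1..d}. kl_coeff T X k \<omega>)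
       N (\<lambda>\<omega>. \<lambda>k\<in>{1..d}. W k \<omega>)"

end

theory Submission
  imports Defs
begin

text \<open>
  The two laws on \<open>R\<^sup>d\<close> are compared through their characteristic functions; these determine a law by
  \<open>joint_char_determines_law\<close>. Fix \<open>\<theta>\<close> and let \<open>W\<close> be the combination with coefficients \<open>\<theta>\<close> of the kernels
  \<open>t \<mapsto> f\<^sub>k(1, t)\<close>. Its derivative is minus the corresponding combination \<open>w\<close> of the sine basis, and \<open>W T = 0\<close>.

  For the process, summation by parts turns right-endpoint Riemann sums of \<open>X w\<close> into sums of \<open>W\<close> times
  increments of \<open>X\<close>. The increments are independent, so the combination of the \<open>Z\<^sub>k\<close> has characteristic
  function \<open>exp (- \<integral> \<Psi> (W t) dt)\<close>, the integral being over \<open>[0, T]\<close> (\<open>char_path_integral\<close>).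

  For the series, let \<open>\<phi> r\<close> be the jump size at arrival time \<open>r\<close>, let \<open>S n\<close> be the partial sum of
  \<open>\<phi> (\<Gamma> j) W (T U j)\<close> and \<open>\<psi> r = E exp (i \<phi> r W (T U))\<close>. Because waiting times are exponential, the variables
  \<open>exp (i S n + \<integral> (1 - \<psi> r) dr)\<close>, with the integral over \<open>(0, \<Gamma> n]\<close>, all have mean one. They are bounded, and
  \<open>\<Gamma> n\<close> tends to infinity, so the identity survives in the limit and yields the characteristic function of the
  (compensated) series (\<open>char_of_compensated_limit\<close>). Since \<open>\<phi>\<close> inverts the tail of the Levy measure, it carries
  Lebesgue measure on the arrival times to \<open>T\<close> times the Levy measure (\<open>distr_jump\<close>), and a uniform mark is
  a uniform jump time; the exponent is therefore the one found for the process (\<open>kl_coeffs_law\<close>).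

  Almost sure convergence uses that \<open>\<phi>\<close> is decreasing and that eventually \<open>\<Gamma> n > n / 2\<close>. In the first part
  \<open>\<phi>\<close> is integrable at infinity and the series is dominated by the values \<open>\<phi> (n / 2)\<close>. In the second part
  \<open>\<phi>\<close> is square integrable at infinity, and \<open>S n\<close> minus the compensator up to time \<open>\<Gamma> n\<close> is, apart from
  finitely many early terms, a martingale with summable variances. The statement compensates up to the deterministic time \<open>n\<close>; the
  error is of order \<open>\<phi> (n / 2) |\<Gamma> n - n|\<close>, which tends to \<open>0\<close> by Kronecker's lemma applied to the convergent series
  of the \<open>\<phi> (n / 2) (E n - 1)\<close> (\<open>AE_compensator_deviation\<close>).
\<close>

section \<open>Characteristic functions of several variables\<close>

text \<open>After normalisation both sides are laws of real variables under a changed probability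
  measure, and the uniqueness theorem for characteristic functions on the line applies. The weight
  is what later lets one coordinate be treated while the others stay in Fourier form.\<close>

lemma weighted_law_unique:
  fixes Y :: "'a \<Rightarrow> real" and Y' :: "'b \<Rightarrow> real" and w :: "'a \<Rightarrow> real" and w' :: "'b \<Rightarrow> real"
  assumes "prob_space M" "prob_space N"
    and [measurable]: "Y \<in> borel_measurable M" "Y' \<in> borel_measurable N"
      "w \<in> borel_measurable M" "w' \<in> borel_measurable N"
    and w: "\<And>x. 0 \<le> w x" "\<And>x. w x \<le> B" and w': "\<And>x. 0 \<le> w' x" "\<And>x. w' x \<le> B"
    and eq: "\<And>t. (CLINT x|M. of_real (w x) * iexp (t * Y x)) = (CLINT x|N. of_real (w' x) * iexp (t * Y' x))"
    and A[measurable]: "A \<in> sets borel"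
  shows "(\<integral>x. w x * indicator A (Y x) \<partial>M) = (\<integral>x. w' x * indicator A (Y' x) \<partial>N)"
proof -
  interpret M: prob_space M by fact
  interpret N: prob_space N by fact
  have iw: "integrable M w" by (rule M.integrable_const_bound[of _ B]) (use w in auto)
  have iw': "integrable N w'" by (rule N.integrable_const_bound[of _ B]) (use w' in auto)
  have iA: "integrable M (\<lambda>x. w x * indicator A (Y x))"
    by (rule M.integrable_const_bound[of _ B]) (use w in \<open>auto split: split_indicator intro: order_trans\<close>)
  have iA': "integrable N (\<lambda>x. w' x * indicator A (Y' x))"
    by (rule N.integrable_const_bound[of _ B]) (use w' in \<open>auto split: split_indicator intro: order_trans\<close>)
  define m where "m = (\<integral>x. w x \<partial>M)"
  have m': "m = (\<integral>x. w' x \<partial>N)"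
    using eq[of 0] by (simp add: m_def)
  have m0: "m \<ge> 0" unfolding m_def using w by (intro integral_nonneg_AE) auto
  show ?thesis
  proof (cases "m = 0")
    case True
    have "(\<integral>x. w x * indicator A (Y x) \<partial>M) \<le> m"
      unfolding m_def by (intro integral_mono iA iw) (use w in \<open>auto split: split_indicator\<close>)
    moreover have "(\<integral>x. w x * indicator A (Y x) \<partial>M) \<ge> 0"
      using w by (intro integral_nonneg_AE) auto
    moreover have "(\<integral>x. w' x * indicator A (Y' x) \<partial>N) \<le> m"
      unfolding m' by (intro integral_mono iA' iw') (use w' in \<open>auto split: split_indicator\<close>)
    moreover have "(\<integral>x. w' x * indicator A (Y' x) \<partial>N) \<ge> 0"
      using w' by (intro integral_nonneg_AE) auto
    ultimately show ?thesis using True by linarith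
  next
    case False
    with m0 have m: "m > 0" by simp
    define D where "D = distr (density M (\<lambda>x. ennreal (w x / m))) borel Y"
    define D' where "D' = distr (density N (\<lambda>x. ennreal (w' x / m))) borel Y'"
    have mass: "(\<integral>\<^sup>+x. ennreal (w x / m) \<partial>M) = 1"
      by (subst nn_integral_eq_integral) (use m w iw in \<open>auto simp: m_def[symmetric]\<close>)
    have mass': "(\<integral>\<^sup>+x. ennreal (w' x / m) \<partial>N) = 1"
      by (subst nn_integral_eq_integral) (use m w' iw' in \<open>auto simp: m'[symmetric]\<close>)
    have p: "prob_space (density M (\<lambda>x. ennreal (w x / m)))"
      by (rule prob_spaceI) (simp add: emeasure_density mass)
    have p': "prob_space (density N (\<lambda>x. ennreal (w' x / m)))"
      by (rule prob_spaceI) (simp add: emeasure_density mass')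
    interpret D: real_distribution D
      unfolding D_def by (rule prob_space.real_distribution_distr[OF p]) simp
    interpret D': real_distribution D'
      unfolding D'_def by (rule prob_space.real_distribution_distr[OF p']) simp
    have "char D t = char D' t" for t
    proof -
      have "char D t = (CLINT x|M. (w x / m) *\<^sub>R iexp (t * Y x))"
        unfolding char_def D_def
        by (subst integral_distr, simp, simp, subst integral_density) (use m w in auto)
      also have "\<dots> = (CLINT x|M. (1 / m) *\<^sub>R (of_real (w x) * iexp (t * Y x)))"
        by (intro Bochner_Integration.integral_cong) (auto simp: scaleR_conv_of_real)
      also have "\<dots> = (CLINT x|N. (1 / m) *\<^sub>R (of_real (w' x) * iexp (t * Y' x)))"
        using eq[of t] by simp
      also have "\<dots> = (CLINT x|N. (w' x / m) *\<^sub>R iexp (t * Y' x))"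
        by (intro Bochner_Integration.integral_cong) (auto simp: scaleR_conv_of_real)
      also have "\<dots> = char D' t"
        unfolding char_def D'_def
        by (subst integral_distr, simp, simp, subst integral_density) (use m w' in auto)
      finally show ?thesis .
    qed
    then have "D = D'"
      by (intro Levy_uniqueness D.real_distribution_axioms D'.real_distribution_axioms) auto
    then have "(\<integral>x. indicator A x \<partial>D) = (\<integral>x. indicator A x \<partial>D' :: real)" by simp
    moreover have "(\<integral>x. indicator A x \<partial>D) = (\<integral>x. w x * indicator A (Y x) \<partial>M) / m"
      unfolding D_def
      by (subst integral_distr, simp, simp, subst integral_density) (use m w in auto)
    moreover have "(\<integral>x. indicator A x \<partial>D') = (\<integral>x. w' x * indicator A (Y' x) \<partial>N) / m"
      unfolding D'_def
      by (subst integral_distr, simp, simp, subst integral_density) (use m w' in auto)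
    ultimately show ?thesis using m by simp
  qed
qed

text \<open>Coordinates are converted one at a time from exponentials to indicators. To convert the
  coordinate \<open>j\<close>, the oscillating factor \<open>exp (i \<alpha>)\<close> of the coordinates that are still in Fourier form
  is written as a combination of the nonnegative weights \<open>1 + cos \<alpha>\<close>, \<open>1 + sin \<alpha>\<close> and \<open>1\<close>; with each
  of these as weight the one-dimensional statement above applies, since the product of such a weight
  with an exponential is again a combination of exponentials.\<close>

lemma joint_char_eq_mixed:
  fixes Y :: "'i \<Rightarrow> 'a \<Rightarrow> real" and Y' :: "'i \<Rightarrow> 'b \<Rightarrow> real"
  assumes M: "prob_space M" and N: "prob_space N"
    and meas: "\<And>k. k \<in> I \<Longrightarrow> Y k \<in> borel_measurable M" "\<And>k. k \<in> I \<Longrightarrow> Y' k \<in> borel_measurable N"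
    and eq: "\<And>\<theta>. (CLINT x|M. iexp (\<Sum>k\<in>I. \<theta> k * Y k x)) = (CLINT x|N. iexp (\<Sum>k\<in>I. \<theta> k * Y' k x))"
    and I: "finite I" and J: "J \<subseteq> I" and B: "\<And>k. k \<in> I \<Longrightarrow> B k \<in> sets borel"
  shows "(CLINT x|M. iexp (\<Sum>k\<in>I - J. \<theta> k * Y k x) * of_real (\<Prod>k\<in>J. indicator (B k) (Y k x))) =
    (CLINT x|N. iexp (\<Sum>k\<in>I - J. \<theta> k * Y' k x) * of_real (\<Prod>k\<in>J. indicator (B k) (Y' k x)))"
proof -
  interpret M: prob_space M by fact
  interpret N: prob_space N by fact
  have "finite J" using I J finite_subset by blast
  then show ?thesis using J
  proof (induction J arbitrary: \<theta> rule: finite_induct)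
    case empty
    then show ?case using eq[of \<theta>] by simp
  next
    case (insert j J)
    have jI: "j \<in> I" and JI: "J \<subseteq> I" using insert.prems by auto
    have [measurable]: "Y j \<in> borel_measurable M" "Y' j \<in> borel_measurable N" using jI meas by auto
    have Bj[measurable]: "B j \<in> sets borel" using jI B by auto
    have inI: "k \<in> I - insert j J \<Longrightarrow> k \<in> I" "k \<in> J \<Longrightarrow> k \<in> I" for k using JI by auto
    define \<alpha> where "\<alpha> x = (\<Sum>k\<in>I - insert j J. \<theta> k * Y k x)" for x
    define \<alpha>' where "\<alpha>' x = (\<Sum>k\<in>I - insert j J. \<theta> k * Y' k x)" for x
    define p :: "'a \<Rightarrow> real" where "p x = (\<Prod>k\<in>J. indicator (B k) (Y k x))" for x
    define p' :: "'b \<Rightarrow> real" where "p' x = (\<Prod>k\<in>J. indicator (B k) (Y' k x))" for x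
    have pb: "0 \<le> p x" "p x \<le> 1" for x
      unfolding p_def by (auto intro!: prod_nonneg prod_le_1)
    have pb': "0 \<le> p' x" "p' x \<le> 1" for x
      unfolding p'_def by (auto intro!: prod_nonneg prod_le_1)
    have [measurable]: "\<alpha> \<in> borel_measurable M" "\<alpha>' \<in> borel_measurable N"
      unfolding \<alpha>_def \<alpha>'_def by (auto intro!: borel_measurable_sum borel_measurable_times meas)
    have ind: "(\<lambda>x. indicator (B k) (Y k x) :: real) \<in> borel_measurable M"
      "(\<lambda>x. indicator (B k) (Y' k x) :: real) \<in> borel_measurable N" if "k \<in> J" for k
    proof -
      have [measurable]: "Y k \<in> borel_measurable M" "Y' k \<in> borel_measurable N" "B k \<in> sets borel"
        using meas[OF inI(2)[OF that]] B[OF inI(2)[OF that]] by auto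
      show "(\<lambda>x. indicator (B k) (Y k x) :: real) \<in> borel_measurable M"
        "(\<lambda>x. indicator (B k) (Y' k x) :: real) \<in> borel_measurable N" by measurable
    qed
    have [measurable]: "p \<in> borel_measurable M" "p' \<in> borel_measurable N"
      unfolding p_def p'_def by (intro borel_measurable_prod ind; assumption)+
    have split: "(\<Sum>k\<in>I - J. (if k = j then t else s * \<theta> k) * Y k x) = t * Y j x + s * \<alpha> x"
      "(\<Sum>k\<in>I - J. (if k = j then t else s * \<theta> k) * Y' k y) = t * Y' j y + s * \<alpha>' y" for t s x y
    proof -
      have e: "I - J = insert j (I - insert j J)" using jI insert.hyps by auto
      show "(\<Sum>k\<in>I - J. (if k = j then t else s * \<theta> k) * Y k x) = t * Y j x + s * \<alpha> x"
        "(\<Sum>k\<in>I - J. (if k = j then t else s * \<theta> k) * Y' k y) = t * Y' j y + s * \<alpha>' y"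
        unfolding e \<alpha>_def \<alpha>'_def sum_distrib_left using I
        by (auto simp: algebra_simps intro!: sum.cong)
    qed
    have IH: "(CLINT x|M. iexp (t * Y j x + s * \<alpha> x) * of_real (p x)) =
        (CLINT x|N. iexp (t * Y' j x + s * \<alpha>' x) * of_real (p' x))" for t s
      using insert.IH[OF JI, of "\<lambda>k. if k = j then t else s * \<theta> k"]
      unfolding split p_def p'_def by simp
    have int: "integrable M (\<lambda>x. iexp (t * Y j x + s * \<alpha> x) * of_real (p x))" for t s
      by (rule M.integrable_const_bound[of _ 1]) (use pb in \<open>auto simp: norm_mult\<close>)
    have int': "integrable N (\<lambda>x. iexp (t * Y' j x + s * \<alpha>' x) * of_real (p' x))" for t s
      by (rule N.integrable_const_bound[of _ 1]) (use pb' in \<open>auto simp: norm_mult\<close>)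
    \<comment> \<open>A weighted exponential in the coordinate \<open>j\<close> is a combination of exponentials with \<open>\<alpha>\<close>-frequency \<open>0\<close>, \<open>1\<close>, \<open>-1\<close>,
      to which the induction hypothesis applies.\<close>
    have trig: "of_real (p x * (1 + cos (\<alpha> x))) * iexp (t * Y j x) =
        iexp (t * Y j x + 0 * \<alpha> x) * of_real (p x) +
        (1/2) * (iexp (t * Y j x + 1 * \<alpha> x) * of_real (p x)) + (1/2) * (iexp (t * Y j x + (-1) * \<alpha> x) * of_real (p x))"
      "of_real (p x * (1 + sin (\<alpha> x))) * iexp (t * Y j x) =
        iexp (t * Y j x + 0 * \<alpha> x) * of_real (p x) +
        (-\<i>/2) * (iexp (t * Y j x + 1 * \<alpha> x) * of_real (p x)) + (\<i>/2) * (iexp (t * Y j x + (-1) * \<alpha> x) * of_real (p x))"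
      for p :: "'c \<Rightarrow> real" and Y :: "'i \<Rightarrow> 'c \<Rightarrow> real" and \<alpha> x t
      by (simp_all add: complex_eq_iff Re_exp Im_exp cos_add sin_add cos_diff sin_diff field_simps)
    have lin: "(\<integral>x. f x + a * g x + b * h x \<partial>P) = integral\<^sup>L P f + a * integral\<^sup>L P g + b * integral\<^sup>L P h"
      if "integrable P f" "integrable P g" "integrable P h"
      for f g h :: "'c \<Rightarrow> complex" and a b and P :: "'c measure"
      using that by simp
    have wb: "0 \<le> a * (1 + c)" "a * (1 + c) \<le> 2" if "0 \<le> a" "a \<le> 1" "-1 \<le> c" "c \<le> 1" for a c :: real
      using that mult_mono[of a 1 "1 + c" 2] by auto
    have c: "(\<integral>x. (p x * (1 + cos (\<alpha> x))) * indicator (B j) (Y j x) \<partial>M) =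
      (\<integral>x. (p' x * (1 + cos (\<alpha>' x))) * indicator (B j) (Y' j x) \<partial>N)"
    proof (rule weighted_law_unique[OF M N, where B=2])
      fix t
      show "(CLINT x|M. of_real (p x * (1 + cos (\<alpha> x))) * iexp (t * Y j x)) =
        (CLINT x|N. of_real (p' x * (1 + cos (\<alpha>' x))) * iexp (t * Y' j x))"
        unfolding trig lin[OF int[of t 0] int[of t 1] int[of t "-1"]]
          lin[OF int'[of t 0] int'[of t 1] int'[of t "-1"]] IH ..
    qed (use pb pb' in \<open>auto intro!: wb simp del: zero_le_mult_iff\<close>)
    have s: "(\<integral>x. (p x * (1 + sin (\<alpha> x))) * indicator (B j) (Y j x) \<partial>M) =
      (\<integral>x. (p' x * (1 + sin (\<alpha>' x))) * indicator (B j) (Y' j x) \<partial>N)"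
    proof (rule weighted_law_unique[OF M N, where B=2])
      fix t
      show "(CLINT x|M. of_real (p x * (1 + sin (\<alpha> x))) * iexp (t * Y j x)) =
        (CLINT x|N. of_real (p' x * (1 + sin (\<alpha>' x))) * iexp (t * Y' j x))"
        unfolding trig lin[OF int[of t 0] int[of t 1] int[of t "-1"]]
          lin[OF int'[of t 0] int'[of t 1] int'[of t "-1"]] IH ..
    qed (use pb pb' in \<open>auto intro!: wb simp del: zero_le_mult_iff\<close>)
    have one: "(\<integral>x. p x * indicator (B j) (Y j x) \<partial>M) = (\<integral>x. p' x * indicator (B j) (Y' j x) \<partial>N)"
    proof (rule weighted_law_unique[OF M N, where B=1])
      fix t
      show "(CLINT x|M. of_real (p x) * iexp (t * Y j x)) = (CLINT x|N. of_real (p' x) * iexp (t * Y' j x))"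
        using IH[of t 0] by (simp add: mult.commute)
    qed (use pb pb' in auto)
    have pr: "(\<Prod>k\<in>insert j J. indicator (B k) (Y k x)) = p x * (indicator (B j) (Y j x) :: real)"
      "(\<Prod>k\<in>insert j J. indicator (B k) (Y' k y)) = p' y * (indicator (B j) (Y' j y) :: real)" for x y
      using insert.hyps by (auto simp: p_def p'_def)
    have expand: "iexp a * complex_of_real (q * i) =
      complex_of_real ((q * (1 + cos a)) * i) + \<i> * complex_of_real ((q * (1 + sin a)) * i) - (1 + \<i>) * complex_of_real (q * i)"
      for a q i by (auto simp: complex_eq_iff Re_exp Im_exp algebra_simps)
    have ib: "integrable M (\<lambda>x. complex_of_real (p x * f (\<alpha> x) * indicator (B j) (Y j x)))"
      if f: "f = (\<lambda>x. 1 + cos x) \<or> f = (\<lambda>x. 1 + sin x) \<or> f = (\<lambda>x. 1)" for f :: "real \<Rightarrow> real"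
    proof (rule M.integrable_const_bound[of _ 2])
      have "f z = 1 + cos z \<or> f z = 1 + sin z \<or> f z = 1" for z using f by auto
      then have "\<bar>f z\<bar> \<le> 2" for z
        using cos_le_one[of z] cos_ge_minus_one[of z] sin_le_one[of z] sin_ge_minus_one[of z]
        unfolding abs_le_iff by (smt (verit))
      then have "p x * \<bar>f (\<alpha> x)\<bar> \<le> 1 * 2" for x using pb[of x] by (intro mult_mono) auto
      then show "AE x in M. norm (complex_of_real (p x * f (\<alpha> x) * indicator (B j) (Y j x))) \<le> 2"
        using pb by (auto simp: abs_mult norm_mult split: split_indicator)
    qed (use f in auto)
    have ib': "integrable N (\<lambda>x. complex_of_real (p' x * f (\<alpha>' x) * indicator (B j) (Y' j x)))"
      if f: "f = (\<lambda>x. 1 + cos x) \<or> f = (\<lambda>x. 1 + sin x) \<or> f = (\<lambda>x. 1)" for f :: "real \<Rightarrow> real"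
    proof (rule N.integrable_const_bound[of _ 2])
      have "f z = 1 + cos z \<or> f z = 1 + sin z \<or> f z = 1" for z using f by auto
      then have "\<bar>f z\<bar> \<le> 2" for z
        using cos_le_one[of z] cos_ge_minus_one[of z] sin_le_one[of z] sin_ge_minus_one[of z]
        unfolding abs_le_iff by (smt (verit))
      then have "p' x * \<bar>f (\<alpha>' x)\<bar> \<le> 1 * 2" for x using pb'[of x] by (intro mult_mono) auto
      then show "AE x in N. norm (complex_of_real (p' x * f (\<alpha>' x) * indicator (B j) (Y' j x))) \<le> 2"
        using pb' by (auto simp: abs_mult norm_mult split: split_indicator)
    qed (use f in auto)
    note i3 = ib[of "\<lambda>x. 1 + cos x"] ib[of "\<lambda>x. 1 + sin x"] ib[of "\<lambda>x. 1"]
    note i3' = ib'[of "\<lambda>x. 1 + cos x"] ib'[of "\<lambda>x. 1 + sin x"] ib'[of "\<lambda>x. 1"]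
    have L: "(CLINT x|M. iexp (\<alpha> x) * of_real (p x * indicator (B j) (Y j x))) =
      of_real (\<integral>x. (p x * (1 + cos (\<alpha> x))) * indicator (B j) (Y j x) \<partial>M) +
      \<i> * of_real (\<integral>x. (p x * (1 + sin (\<alpha> x))) * indicator (B j) (Y j x) \<partial>M) -
      (1 + \<i>) * of_real (\<integral>x. p x * indicator (B j) (Y j x) \<partial>M)"
      unfolding expand integral_of_real[symmetric] using i3
      by (simp del: of_real_mult of_real_add)
    have R: "(CLINT x|N. iexp (\<alpha>' x) * of_real (p' x * indicator (B j) (Y' j x))) =
      of_real (\<integral>x. (p' x * (1 + cos (\<alpha>' x))) * indicator (B j) (Y' j x) \<partial>N) +
      \<i> * of_real (\<integral>x. (p' x * (1 + sin (\<alpha>' x))) * indicator (B j) (Y' j x) \<partial>N) -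
      (1 + \<i>) * of_real (\<integral>x. p' x * indicator (B j) (Y' j x) \<partial>N)"
      unfolding expand integral_of_real[symmetric] using i3'
      by (simp del: of_real_mult of_real_add)
    show ?case
      unfolding pr \<alpha>_def[symmetric] \<alpha>'_def[symmetric] L R c s one ..
  qed
qed

text \<open>Uniqueness theorem for characteristic functions in finitely many variables: once all coordinates
  are indicators, the two laws agree on boxes.\<close>

lemma joint_char_determines_law:
  fixes Y :: "'i \<Rightarrow> 'a \<Rightarrow> real" and Y' :: "'i \<Rightarrow> 'b \<Rightarrow> real"
  assumes M: "prob_space M" and N: "prob_space N" and I: "finite I"
    and meas: "\<And>k. k \<in> I \<Longrightarrow> Y k \<in> borel_measurable M" "\<And>k. k \<in> I \<Longrightarrow> Y' k \<in> borel_measurable N"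
    and eq: "\<And>\<theta>. (CLINT x|M. iexp (\<Sum>k\<in>I. \<theta> k * Y k x)) = (CLINT x|N. iexp (\<Sum>k\<in>I. \<theta> k * Y' k x))"
  shows "distr M (PiM I (\<lambda>_. borel)) (\<lambda>x. \<lambda>k\<in>I. Y k x) = distr N (PiM I (\<lambda>_. borel)) (\<lambda>x. \<lambda>k\<in>I. Y' k x)"
proof -
  interpret M: prob_space M by fact
  interpret N: prob_space N by fact
  have [measurable]: "(\<lambda>x. \<lambda>k\<in>I. Y k x) \<in> measurable M (PiM I (\<lambda>_. borel))"
    "(\<lambda>x. \<lambda>k\<in>I. Y' k x) \<in> measurable N (PiM I (\<lambda>_. borel))"
    using meas by (auto intro!: measurable_restrict)
  interpret D: prob_space "distr M (PiM I (\<lambda>_. borel)) (\<lambda>x. \<lambda>k\<in>I. Y k x)"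
    by (rule M.prob_space_distr) simp
  show ?thesis
  proof (rule measure_eqI_PiM_finite[OF I])
    fix B :: "'i \<Rightarrow> real set" assume B: "\<And>i. i \<in> I \<Longrightarrow> B i \<in> sets borel"
    have box: "Pi\<^sub>E I B \<in> sets (PiM I (\<lambda>_. borel))" using B I by (intro sets_PiM_I_finite) auto
    have prodind: "(\<Prod>k\<in>I. indicator (B k) (Z k x)) = (indicator {x. \<forall>k\<in>I. Z k x \<in> B k} x :: real)"
      for Z :: "'i \<Rightarrow> 'c \<Rightarrow> real" and x
      using I by (auto simp: indicator_def prod_zero_iff)
    have "(\<integral>x. (\<Prod>k\<in>I. indicator (B k) (Y k x)) \<partial>M) = (\<integral>x. (\<Prod>k\<in>I. indicator (B k) (Y' k x)) \<partial>N :: real)"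
      using joint_char_eq_mixed[OF M N meas eq I subset_refl, of B] B
      by (simp del: of_real_prod)
    then have "measure M ({x. \<forall>k\<in>I. Y k x \<in> B k} \<inter> space M) = measure N ({x. \<forall>k\<in>I. Y' k x \<in> B k} \<inter> space N)"
      unfolding prodind by simp
    moreover have "(\<lambda>x. \<lambda>k\<in>I. Y k x) -` Pi\<^sub>E I B \<inter> space M = {x. \<forall>k\<in>I. Y k x \<in> B k} \<inter> space M"
      "(\<lambda>x. \<lambda>k\<in>I. Y' k x) -` Pi\<^sub>E I B \<inter> space N = {x. \<forall>k\<in>I. Y' k x \<in> B k} \<inter> space N"
      by (auto simp: PiE_iff)
    ultimately show "emeasure (distr M (PiM I (\<lambda>_. borel)) (\<lambda>x. \<lambda>k\<in>I. Y k x)) (Pi\<^sub>E I B) =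
        emeasure (distr N (PiM I (\<lambda>_. borel)) (\<lambda>x. \<lambda>k\<in>I. Y' k x)) (Pi\<^sub>E I B)"
      using box by (simp add: emeasure_distr M.emeasure_eq_measure N.emeasure_eq_measure)
  next
    show "range (\<lambda>i::nat. Pi\<^sub>E I (\<lambda>_. UNIV)) \<subseteq> prod_algebra I (\<lambda>_. borel :: real measure)"
      using I by (auto intro!: prod_algebraI_finite)
  qed (auto simp: space_PiM)
qed

section \<open>Integrals of Levy paths against deterministic weights\<close>

text \<open>One-sided limits bound the path on a neighbourhood of each time; compactness of the interval,
  in the form of Bolzano's bisection principle, makes the bound global.\<close>

lemma cadlag_bounded:
  assumes "cadlag w" "0 \<le> T"
  shows "\<exists>B. \<forall>t\<in>{0..T}. \<bar>w t\<bar> \<le> B"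
proof -
  \<comment> \<open>The guard \<open>0 \<le> t\<close> is needed because bisection also looks to the left of \<open>0\<close>, where nothing is known.\<close>
  define P where "P a b \<longleftrightarrow> (\<exists>B. \<forall>t\<in>{a..b}. 0 \<le> t \<longrightarrow> \<bar>w t\<bar> \<le> B)" for a b
  have "P 0 T"
    using assms(2)
  proof (induction rule: Bolzano)
    case (trans a b c)
    then obtain B B' where "\<forall>t\<in>{a..b}. 0 \<le> t \<longrightarrow> \<bar>w t\<bar> \<le> B" "\<forall>t\<in>{b..c}. 0 \<le> t \<longrightarrow> \<bar>w t\<bar> \<le> B'" unfolding P_def by blast
    then have "\<forall>t\<in>{a..c}. 0 \<le> t \<longrightarrow> \<bar>w t\<bar> \<le> max B B'"
      by (auto simp: le_max_iff_disj)
    then show ?case unfolding P_def by blast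
  next
    case (local x)
    have "(w \<longlongrightarrow> w x) (at_right x)" using assms(1) local unfolding cadlag_def by auto
    then have "\<forall>\<^sub>F t in at_right x. \<bar>w t\<bar> < \<bar>w x\<bar> + 1"
      by (intro order_tendstoD(2)[OF tendsto_rabs]) auto
    then obtain r where r: "r > x" "\<And>t. x < t \<Longrightarrow> t < r \<Longrightarrow> \<bar>w t\<bar> < \<bar>w x\<bar> + 1"
      unfolding eventually_at_right_field by auto
    have "\<exists>l<x. \<exists>C. \<forall>t. l < t \<longrightarrow> t < x \<longrightarrow> 0 \<le> t \<longrightarrow> \<bar>w t\<bar> \<le> C"
    proof (cases "x > 0")
      case True
      then obtain L where "(w \<longlongrightarrow> L) (at_left x)" using assms(1) unfolding cadlag_def by auto
      then have "\<forall>\<^sub>F t in at_left x. \<bar>w t\<bar> < \<bar>L\<bar> + 1"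
        by (intro order_tendstoD(2)[OF tendsto_rabs]) auto
      then obtain l where "l < x" "\<And>t. l < t \<Longrightarrow> t < x \<Longrightarrow> \<bar>w t\<bar> < \<bar>L\<bar> + 1"
        unfolding eventually_at_left_field by auto
      then show ?thesis by (intro exI[of _ l] conjI exI[of _ "\<bar>L\<bar> + 1"]) (auto intro: less_imp_le)
    next
      case False
      then show ?thesis by (intro exI[of _ "x - 1"]) auto
    qed
    then obtain l C where l: "l < x" "\<And>t. l < t \<Longrightarrow> t < x \<Longrightarrow> 0 \<le> t \<Longrightarrow> \<bar>w t\<bar> \<le> C" by blast
    show ?case
    proof (intro exI[of _ "min (r - x) (x - l)"] conjI allI impI)
      show "0 < min (r - x) (x - l)" using r l by simp
      fix a b assume ab: "a \<le> x \<and> x \<le> b \<and> b - a < min (r - x) (x - l)"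
      show "P a b"
        unfolding P_def
      proof (intro exI[of _ "max C (\<bar>w x\<bar> + 1)"] ballI impI)
        fix t assume t: "t \<in> {a..b}" "0 \<le> t"
        consider "t < x" | "t = x" | "x < t" by linarith
        then show "\<bar>w t\<bar> \<le> max C (\<bar>w x\<bar> + 1)"
        proof cases
          case 1 then show ?thesis using l(2)[of t] ab t by auto
        next
          case 2 then show ?thesis by auto
        next
          case 3 then show ?thesis using r(2)[of t] ab t by auto
        qed
      qed
    qed
  qed
  then show ?thesis unfolding P_def by auto
qed

text \<open>The smallest grid point \<open>T j / n\<close> that is not below \<open>t\<close>: a right-continuous path is the pointwise limit
  of its values at these points.\<close>

definition grid_above :: "real \<Rightarrow> nat \<Rightarrow> real \<Rightarrow> real" where
  "grid_above T n t = T * real_of_int \<lceil>real n * t / T\<rceil> / real n"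

lemma grid_above_bounds:
  assumes "T > 0" "n > 0"
  shows "t \<le> grid_above T n t" "grid_above T n t \<le> t + T / real n" "t \<le> T \<Longrightarrow> grid_above T n t \<le> T"
proof -
  define c where "c = \<lceil>real n * t / T\<rceil>"
  have g: "grid_above T n t = T * real_of_int c / real n" by (simp add: grid_above_def c_def)
  have "real n * t / T \<le> real_of_int c" unfolding c_def by (rule le_of_int_ceiling)
  then show "t \<le> grid_above T n t" using assms unfolding g by (simp add: field_simps)
  have "real_of_int c \<le> real n * t / T + 1" unfolding c_def by (rule of_int_ceiling_le_add_one)
  then show "grid_above T n t \<le> t + T / real n" using assms unfolding g by (simp add: field_simps)
  assume "t \<le> T"
  then have "real n * t / T \<le> real n" using assms by (simp add: field_simps)
  then have "c \<le> int n" unfolding c_def by (simp add: ceiling_le_iff)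
  then have "real_of_int c \<le> real n" by (metis of_int_le_iff of_int_of_nat_eq)
  then show "grid_above T n t \<le> T" using assms unfolding g by (simp add: field_simps)
qed

lemma grid_above_tendsto:
  assumes "T > 0"
  shows "(\<lambda>n. grid_above T (Suc n) t) \<longlonglongrightarrow> t"
proof (rule tendsto_sandwich)
  show "\<forall>\<^sub>F n in sequentially. t \<le> grid_above T (Suc n) t"
    using grid_above_bounds[OF assms] by auto
  show "\<forall>\<^sub>F n in sequentially. grid_above T (Suc n) t \<le> t + T / real (Suc n)"
    using grid_above_bounds[OF assms] by (intro always_eventually) blast
  have "(\<lambda>n. t + T / real (Suc n)) \<longlonglongrightarrow> t + 0"
    by (intro tendsto_add tendsto_const LIMSEQ_Suc[OF lim_const_over_n])
  then show "(\<lambda>n. t + T / real (Suc n)) \<longlonglongrightarrow> t" by simp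
qed simp

lemma grid_above_step:
  fixes F :: "real \<Rightarrow> 'b::real_vector"
  assumes T: "T > 0" and n: "n > 0"
  shows "indicator {0<..T} t *\<^sub>R F (grid_above T n t) =
    (\<Sum>j<n. indicator {T * real j / real n<..T * real (Suc j) / real n} t *\<^sub>R F (T * real (Suc j) / real n))"
proof -
  define c where "c = \<lceil>real n * t / T\<rceil>"
  have mem: "t \<in> {T * real j / real n<..T * real (Suc j) / real n} \<longleftrightarrow> c = int (Suc j)" for j
  proof -
    have "t \<in> {T * real j / real n<..T * real (Suc j) / real n} \<longleftrightarrow> real j < real n * t / T \<and> real n * t / T \<le> real j + 1"
      using T n by (auto simp: field_simps)
    also have "\<dots> \<longleftrightarrow> c = int (Suc j)" unfolding c_def ceiling_eq_iff by auto
    finally show ?thesis .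
  qed
  show ?thesis
  proof (cases "t \<in> {0<..T}")
    case True
    have "c > 0" using True T n unfolding c_def by (simp add: zero_less_ceiling zero_less_divide_iff)
    moreover have "c \<le> int n" using True T n unfolding c_def by (simp add: ceiling_le_iff field_simps)
    ultimately obtain j where j: "c = int (Suc j)" "j < n"
      by (metis Suc_le_eq gr0_implies_Suc nat_int of_nat_0_less_iff of_nat_le_iff zero_less_imp_eq_int)
    have "(\<Sum>i<n. indicator {T * real i / real n<..T * real (Suc i) / real n} t *\<^sub>R F (T * real (Suc i) / real n)) =
      (\<Sum>i<n. if i = j then F (T * real (Suc i) / real n) else 0)"
      using j mem by (intro sum.cong refl) (simp add: indicator_def)
    also have "\<dots> = F (T * real (Suc j) / real n)" using j by simp
    also have "\<dots> = F (grid_above T n t)" using j unfolding grid_above_def c_def[symmetric] by simp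
    finally show ?thesis using True by simp
  next
    case False
    have "t \<notin> {T * real j / real n<..T * real (Suc j) / real n}" if "j < n" for j
    proof
      assume *: "t \<in> {T * real j / real n<..T * real (Suc j) / real n}"
      have "0 \<le> T * real j / real n" using T by simp
      moreover have "T * real (Suc j) / real n \<le> T * real n / real n"
        using T that by (intro divide_right_mono mult_left_mono) auto
      then have "T * real (Suc j) / real n \<le> T" using n by simp
      ultimately show False using * False by auto
    qed
    then have "(\<Sum>j<n. indicator {T * real j / real n<..T * real (Suc j) / real n} t *\<^sub>R F (T * real (Suc j) / real n)) = 0"
      by (intro sum.neutral ballI) (simp add: indicator_simps(2) del: greaterThanAtMost_iff of_nat_Suc)
    then show ?thesis using False by (simp add: indicator_simps(2) del: of_nat_Suc)
  qed
qed

text \<open>Sampling at the right endpoint of each cell is what right-continuity supports. The same statement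
  serves for real paths and for the complex function \<open>\<Psi> (W t)\<close>.\<close>

lemma grid_integral_tendsto:
  fixes x :: "real \<Rightarrow> 'b::{banach, second_countable_topology}"
  assumes T: "T > 0"
    and rc: "\<And>t. 0 < t \<Longrightarrow> t \<le> T \<Longrightarrow> (x \<longlongrightarrow> x t) (at_right t)"
    and B: "\<And>t. 0 < t \<Longrightarrow> t \<le> T \<Longrightarrow> norm (x t) \<le> B"
    and w: "continuous_on UNIV w"
  shows "set_integrable lborel {0<..T} (\<lambda>t. w t *\<^sub>R x t)"
    and "(\<lambda>m. \<Sum>j<Suc m. (LBINT t:{T * real j / real (Suc m)<..T * real (Suc j) / real (Suc m)}. w t) *\<^sub>R
            x (T * real (Suc j) / real (Suc m))) \<longlonglongrightarrow> (LBINT t:{0<..T}. w t *\<^sub>R x t)"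
proof -
  have [measurable]: "w \<in> borel_measurable borel" using w by (rule borel_measurable_continuous_onI)
  define X where "X m t = indicator {0<..T} t *\<^sub>R x (grid_above T (Suc m) t)" for m t
  have Xm[measurable]: "X m \<in> borel_measurable lborel" for m
    unfolding X_def[abs_def] grid_above_step[OF T zero_less_Suc]
    by (intro borel_measurable_sum borel_measurable_scaleR borel_measurable_indicator borel_measurable_const) auto
  have pw: "(\<lambda>m. X m t) \<longlonglongrightarrow> indicator {0<..T} t *\<^sub>R x t" for t
  proof (cases "t \<in> {0<..T}")
    case True
    have "continuous (at t within {t..}) x"
      using rc True unfolding continuous_within at_within_Ici_at_right by auto
    then have "(x \<circ> (\<lambda>m. grid_above T (Suc m) t)) \<longlonglongrightarrow> x t"
      using grid_above_tendsto[OF T, of t] grid_above_bounds(1)[OF T zero_less_Suc, where t=t]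
      unfolding continuous_within_sequentially by auto
    then show ?thesis using True by (simp add: X_def o_def)
  qed (simp add: X_def)
  have xm[measurable]: "(\<lambda>t. indicator {0<..T} t *\<^sub>R x t) \<in> borel_measurable lborel"
    by (rule borel_measurable_LIMSEQ_metric[OF Xm pw])
  have "compact (w ` {0..T})" by (intro compact_continuous_image continuous_on_subset[OF w]) auto
  then obtain K where K: "\<And>t. t \<in> {0..T} \<Longrightarrow> \<bar>w t\<bar> \<le> K"
    using compact_imp_bounded[of "w ` {0..T}"] unfolding bounded_iff real_norm_def by blast
  have bnd: "norm (w t *\<^sub>R X m t) \<le> indicator {0<..T} t * (K * B)" for m t
  proof (cases "t \<in> {0<..T}")
    case True
    have "\<bar>w t\<bar> \<le> K" "norm (x (grid_above T (Suc m) t)) \<le> B"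
      using True K[of t] B[of "grid_above T (Suc m) t"] grid_above_bounds[OF T zero_less_Suc[of m], of t] by auto
    then have "\<bar>w t\<bar> * norm (x (grid_above T (Suc m) t)) \<le> K * B"
      by (intro mult_mono) (auto intro: order_trans[OF abs_ge_zero])
    then show ?thesis using True by (simp add: X_def)
  qed (simp add: X_def)
  have dom: "integrable lborel (\<lambda>t. indicator {0<..T} t * (K * B) :: real)"
    using T by (intro integrable_mult_left integrable_real_indicator) auto
  have lim: "(\<lambda>m. w t *\<^sub>R X m t) \<longlonglongrightarrow> w t *\<^sub>R (indicator {0<..T} t *\<^sub>R x t)" for t
    by (intro tendsto_intros pw)
  have conv: "integrable lborel (\<lambda>t. w t *\<^sub>R (indicator {0<..T} t *\<^sub>R x t))"
    "(\<lambda>m. \<integral>t. w t *\<^sub>R X m t \<partial>lborel) \<longlonglongrightarrow> (\<integral>t. w t *\<^sub>R (indicator {0<..T} t *\<^sub>R x t) \<partial>lborel)"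
  proof -
    have 1: "(\<lambda>t. w t *\<^sub>R (indicator {0<..T} t *\<^sub>R x t)) \<in> borel_measurable lborel"
      by (intro borel_measurable_scaleR xm) simp
    have 2: "(\<lambda>t. w t *\<^sub>R X m t) \<in> borel_measurable lborel" for m by simp
    have 3: "AE t in lborel. (\<lambda>m. w t *\<^sub>R X m t) \<longlonglongrightarrow> w t *\<^sub>R (indicator {0<..T} t *\<^sub>R x t)"
      using lim by blast
    have 4: "AE t in lborel. norm (w t *\<^sub>R X m t) \<le> indicator {0<..T} t * (K * B)" for m
      using bnd by blast
    show "integrable lborel (\<lambda>t. w t *\<^sub>R (indicator {0<..T} t *\<^sub>R x t))"
      by (rule integrable_dominated_convergence[OF 1 2 dom 3 4])
    show "(\<lambda>m. \<integral>t. w t *\<^sub>R X m t \<partial>lborel) \<longlonglongrightarrow> (\<integral>t. w t *\<^sub>R (indicator {0<..T} t *\<^sub>R x t) \<partial>lborel)"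
      by (rule integral_dominated_convergence[OF 1 2 dom 3 4])
  qed
  show "set_integrable lborel {0<..T} (\<lambda>t. w t *\<^sub>R x t)"
    using conv(1) unfolding set_integrable_def by (simp add: mult.commute)
  have wint: "set_integrable lborel {a<..b} w" for a b
  proof -
    have "set_integrable lborel {a..b} w"
      by (rule borel_integrable_compact[of "{a..b}" w, folded set_integrable_def]) (auto intro: continuous_on_subset[OF w])
    then show ?thesis by (rule set_integrable_subset) auto
  qed
  have "(\<integral>t. w t *\<^sub>R X m t \<partial>lborel) = (\<Sum>j<Suc m. (LBINT t:{T * real j / real (Suc m)<..T * real (Suc j) / real (Suc m)}. w t) *\<^sub>R
            x (T * real (Suc j) / real (Suc m)))" for m
  proof -
    have "(\<integral>t. w t *\<^sub>R X m t \<partial>lborel) = (\<integral>t. (\<Sum>j<Suc m.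
       (indicator {T * real j / real (Suc m)<..T * real (Suc j) / real (Suc m)} t *\<^sub>R w t) *\<^sub>R x (T * real (Suc j) / real (Suc m))) \<partial>lborel)"
      unfolding X_def grid_above_step[OF T zero_less_Suc] scaleR_sum_right
      by (intro Bochner_Integration.integral_cong refl sum.cong) (simp add: mult.commute)
    also have "\<dots> = (\<Sum>j<Suc m. \<integral>t.
       (indicator {T * real j / real (Suc m)<..T * real (Suc j) / real (Suc m)} t *\<^sub>R w t) *\<^sub>R x (T * real (Suc j) / real (Suc m)) \<partial>lborel)"
      by (intro Bochner_Integration.integral_sum integrable_scaleR_left wint[unfolded set_integrable_def])
    also have "\<dots> = (\<Sum>j<Suc m. (LBINT t:{T * real j / real (Suc m)<..T * real (Suc j) / real (Suc m)}. w t) *\<^sub>R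
            x (T * real (Suc j) / real (Suc m)))"
      unfolding set_lebesgue_integral_def
      by (intro sum.cong refl integral_scaleR_left wint[unfolded set_integrable_def])
    finally show ?thesis .
  qed
  then show "(\<lambda>m. \<Sum>j<Suc m. (LBINT t:{T * real j / real (Suc m)<..T * real (Suc j) / real (Suc m)}. w t) *\<^sub>R
            x (T * real (Suc j) / real (Suc m))) \<longlonglongrightarrow> (LBINT t:{0<..T}. w t *\<^sub>R x t)"
    using conv(2) unfolding set_lebesgue_integral_def by (simp add: mult.commute)
qed

lemma set_integral_closed_left_endpoint:
  fixes f :: "real \<Rightarrow> 'b::{banach, second_countable_topology}"
  assumes "set_integrable lborel {a<..b} f" "a \<le> b"
  shows "set_integrable lborel {a..b} f" "(LBINT t:{a..b}. f t) = (LBINT t:{a<..b}. f t)"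
proof -
  have eq: "indicator {a..b} t *\<^sub>R f t = indicator {a<..b} t *\<^sub>R f t + indicator {a} t *\<^sub>R f a" for t
    using assms(2) by (auto simp: indicator_def)
  have i0: "integrable lborel (\<lambda>t. indicator {a} t *\<^sub>R f a)"
    by (intro integrable_scaleR_left integrable_real_indicator) auto
  have z: "(\<integral>t. indicator {a} t *\<^sub>R f a \<partial>lborel) = 0"
    by (subst integral_scaleR_left) (auto intro!: integrable_real_indicator)
  show "set_integrable lborel {a..b} f"
    using assms(1) i0 unfolding set_integrable_def eq by (rule Bochner_Integration.integrable_add)
  show "(LBINT t:{a..b}. f t) = (LBINT t:{a<..b}. f t)"
    using assms(1) i0 z unfolding set_integrable_def set_lebesgue_integral_def eq
    by (subst Bochner_Integration.integral_add) auto
qed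

lemma borel_measurable_completion_AE_eq:
  fixes f g :: "'a \<Rightarrow> 'b::topological_space"
  assumes g: "g \<in> borel_measurable M" and ae: "AE x in M. f x = g x"
  shows "f \<in> borel_measurable (completion M)"
proof (rule measurableI)
  fix A :: "'b set" assume A: "A \<in> sets borel"
  have "AE x in completion M. x \<in> g -` A \<inter> space M \<longleftrightarrow> x \<in> f -` A \<inter> space (completion M)"
    using AE_completion[OF ae] by eventually_elim auto
  then show "f -` A \<inter> space (completion M) \<in> sets (completion M)"
    by (rule completion.in_sets_AE) (use measurable_sets[OF measurable_completion[OF g] A] in auto)
qed auto

lemma sum_increments_by_parts:
  fixes x W :: "nat \<Rightarrow> real"
  shows "(\<Sum>j<n. (W j - W (Suc j)) * x (Suc j)) = (\<Sum>j<n. (x (Suc j) - x j) * W j) + x 0 * W 0 - x n * W n"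
  by (induction n) (auto simp: algebra_simps)

text \<open>Abel summation moves the difference from the primitive \<open>- W\<close> of the weight to the path; the boundary
  terms vanish because \<open>x 0 = 0\<close> and \<open>W T = 0\<close>. What remains is a sum of increments, which are independent
  for a Levy process.\<close>

lemma cadlag_weighted_increments_tendsto:
  assumes x: "cadlag x" "x 0 = 0" and T: "T > 0"
    and w: "continuous_on UNIV w" and W: "\<And>t. (W has_real_derivative - w t) (at t)" "W T = 0"
  shows "set_integrable lborel {0..T} (\<lambda>t. x t * w t)"
    and "(\<lambda>m. \<Sum>j<Suc m. (x (T * real (Suc j) / real (Suc m)) - x (T * real j / real (Suc m))) * W (T * real j / real (Suc m)))
      \<longlonglongrightarrow> (LBINT t:{0..T}. x t * w t)"
proof -
  obtain B where B: "\<And>t. t \<in> {0..T} \<Longrightarrow> \<bar>x t\<bar> \<le> B" using cadlag_bounded[OF x(1) less_imp_le[OF T]] by blast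
  have rc: "(x \<longlongrightarrow> x t) (at_right t)" if "0 < t" for t
    using x(1) that unfolding cadlag_def by auto
  note G = grid_integral_tendsto[of T x B w, OF T rc _ w]
  have si: "set_integrable lborel {0<..T} (\<lambda>t. x t * w t)"
    using G(1) B by (auto simp: mult.commute)
  show "set_integrable lborel {0..T} (\<lambda>t. x t * w t)"
    by (rule set_integral_closed_left_endpoint(1)[OF si less_imp_le[OF T]])
  have FTC: "(LBINT t:{a<..b}. w t) = W a - W b" if "0 \<le> a" "a \<le> b" for a b
  proof -
    have "(LBINT t:{a..b}. w t) = - W b - - W a"
      unfolding set_lebesgue_integral_def using that(2) w W(1)
      by (simp add: mult.commute[of "indicator _ _"] del: diff_minus_eq_add,
          intro integral_FTC_Icc_real)
        (auto intro!: derivative_eq_intros simp: continuous_on_eq_continuous_at)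
    moreover have "set_integrable lborel {a..b} w"
      by (rule borel_integrable_compact[of "{a..b}" w, folded set_integrable_def]) (auto intro: continuous_on_subset[OF w])
    then have "(LBINT t:{a..b}. w t) = (LBINT t:{a<..b}. w t)"
      by (intro set_integral_closed_left_endpoint(2) that(2)) (rule set_integrable_subset, auto)
    ultimately show ?thesis by simp
  qed
  define t where "t m j = T * real j / real (Suc m)" for m j
  have "(\<Sum>j<Suc m. (LBINT s:{t m j<..t m (Suc j)}. w s) *\<^sub>R x (t m (Suc j))) =
      (\<Sum>j<Suc m. (x (t m (Suc j)) - x (t m j)) * W (t m j))" for m
  proof -
    have "(\<Sum>j<Suc m. (LBINT s:{t m j<..t m (Suc j)}. w s) *\<^sub>R x (t m (Suc j))) =
      (\<Sum>j<Suc m. (W (t m j) - W (t m (Suc j))) * x (t m (Suc j)))"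
      using T by (intro sum.cong refl) (subst FTC, auto simp: t_def intro!: divide_right_mono mult_left_mono)
    also have "\<dots> = (\<Sum>j<Suc m. (x (t m (Suc j)) - x (t m j)) * W (t m j)) + x (t m 0) * W (t m 0) - x (t m (Suc m)) * W (t m (Suc m))"
      by (rule sum_increments_by_parts)
    finally show ?thesis using x(2) W(2) T by (simp add: t_def)
  qed
  moreover have "(\<lambda>m. \<Sum>j<Suc m. (LBINT s:{t m j<..t m (Suc j)}. w s) *\<^sub>R x (t m (Suc j))) \<longlonglongrightarrow> (LBINT t:{0<..T}. w t *\<^sub>R x t)"
    unfolding t_def by (rule G(2)) (use B in auto)
  moreover have "(LBINT t:{0<..T}. w t *\<^sub>R x t) = (LBINT t:{0..T}. x t * w t)"
    using set_integral_closed_left_endpoint(2)[OF si less_imp_le[OF T]] by (simp add: mult.commute)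
  ultimately show "(\<lambda>m. \<Sum>j<Suc m. (x (T * real (Suc j) / real (Suc m)) - x (T * real j / real (Suc m))) * W (T * real j / real (Suc m)))
      \<longlonglongrightarrow> (LBINT t:{0..T}. x t * w t)"
    unfolding t_def by simp
qed

text \<open>A Levy process with exponent \<open>\<Psi>\<close> that is integrated against \<open>w\<close> over \<open>[0, T]\<close>; \<open>W t\<close> is the
  integral of \<open>w\<close> over \<open>[t, T]\<close>.\<close>

locale weighted_levy_path =
  fixes M :: "'a measure" and X :: "real \<Rightarrow> 'a \<Rightarrow> real" and \<Psi> :: "real \<Rightarrow> complex" and T :: real
    and w W :: "real \<Rightarrow> real"
  assumes levy: "levy_process M X" and T: "T > 0"
    and char: "\<And>t z. t \<ge> 0 \<Longrightarrow> char (distr M borel (X t)) z = exp (- of_real t * \<Psi> z)"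
    and \<Psi>: "continuous_on UNIV \<Psi>"
    and w: "continuous_on UNIV w" and W: "\<And>t. (W has_real_derivative - w t) (at t)" "W T = 0"
begin

definition approx :: "nat \<Rightarrow> 'a \<Rightarrow> real" where
  "approx m \<omega> = (\<Sum>j<Suc m. (X (T * real (Suc j) / real (Suc m)) \<omega> - X (T * real j / real (Suc m)) \<omega>) * W (T * real j / real (Suc m)))"

sublocale prob_space M using levy unfolding levy_process_def by simp

lemma X_measurable: "t \<ge> 0 \<Longrightarrow> X t \<in> borel_measurable M"
  using levy unfolding levy_process_def by simp

lemma approx_measurable [measurable]: "approx m \<in> borel_measurable M"
  unfolding approx_def[abs_def] using T
  by (intro borel_measurable_sum borel_measurable_times borel_measurable_diff X_measurable borel_measurable_const) auto

lemma AE_path: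
  "AE \<omega> in M. set_integrable lborel {0..T} (\<lambda>t. X t \<omega> * w t) \<and> (\<lambda>m. approx m \<omega>) \<longlonglongrightarrow> (LBINT t:{0..T}. X t \<omega> * w t)"
proof -
  have "AE \<omega> in M. X 0 \<omega> = 0" "AE \<omega> in M. cadlag (\<lambda>t. X t \<omega>)"
    using levy unfolding levy_process_def by auto
  then show ?thesis
  proof eventually_elim
    case (elim \<omega>)
    show ?case
      using cadlag_weighted_increments_tendsto[of "\<lambda>t. X t \<omega>", OF elim(2,1) T w W]
      unfolding approx_def by auto
  qed
qed

lemma path_integral_measurable: "(\<lambda>\<omega>. LBINT t:{0..T}. X t \<omega> * w t) \<in> borel_measurable (completion M)"
proof (rule borel_measurable_completion_AE_eq)
  show "(\<lambda>\<omega>. lim (\<lambda>m. approx m \<omega>)) \<in> borel_measurable M" by measurable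
  show "AE \<omega> in M. (LBINT t:{0..T}. X t \<omega> * w t) = lim (\<lambda>m. approx m \<omega>)"
    using AE_path by eventually_elim (auto intro: limI[symmetric])
qed

lemma char_approx: "(CLINT \<omega>|M. iexp (approx m \<omega>)) = exp (- (\<Sum>j<Suc m. of_real (T / real (Suc m)) * \<Psi> (W (T * real j / real (Suc m)))))"
proof -
  define t where "t j = T * real j / real (Suc m)" for j
  define h where "h = T / real (Suc m)"
  have t0: "t j \<ge> 0" for j using T unfolding t_def by simp
  have tS: "t (Suc j) = t j + h" for j unfolding t_def h_def add_divide_distrib[symmetric] by (simp add: algebra_simps)
  have h: "h > 0" using T unfolding h_def by simp
  define I where "I j \<omega> = X (t (Suc j)) \<omega> - X (t j) \<omega>" for j \<omega>
  have [measurable]: "I j \<in> borel_measurable M" for j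
    unfolding I_def[abs_def] by (intro borel_measurable_diff X_measurable t0)
  have ind: "indep_vars (\<lambda>_. borel) I {..<Suc m}"
  proof -
    have "\<forall>n (t :: nat \<Rightarrow> real). 0 \<le> t 0 \<and> (\<forall>i<n. t i \<le> t (Suc i)) \<longrightarrow>
        indep_vars (\<lambda>_. borel) (\<lambda>i \<omega>. X (t (Suc i)) \<omega> - X (t i) \<omega>) {..<n}"
      using levy unfolding levy_process_def by blast
    moreover have "0 \<le> t 0 \<and> (\<forall>i<Suc m. t i \<le> t (Suc i))" using t0 h unfolding tS by auto
    ultimately show ?thesis
      unfolding I_def[abs_def] by blast
  qed
  have ind': "indep_vars (\<lambda>_. borel) (\<lambda>j \<omega>. iexp (I j \<omega> * W (t j))) {..<Suc m}"
    by (rule indep_vars_compose2[OF ind, where Y="\<lambda>j x. iexp (x * W (t j))"]) auto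
  have one: "(CLINT \<omega>|M. iexp (I j \<omega> * W (t j))) = exp (- of_real h * \<Psi> (W (t j)))" for j
  proof -
    have "(CLINT \<omega>|M. iexp (I j \<omega> * W (t j))) = char (distr M borel (I j)) (W (t j))"
      unfolding char_def by (subst integral_distr) (auto simp: mult.commute)
    also have "distr M borel (I j) = distr M borel (\<lambda>\<omega>. X h \<omega> - X 0 \<omega>)"
      using levy t0[of j] h unfolding levy_process_def I_def[abs_def] tS by auto
    also have "\<dots> = distr M borel (X h)"
    proof (rule distr_cong_AE)
      have "AE \<omega> in M. X 0 \<omega> = 0" using levy unfolding levy_process_def by auto
      then show "AE \<omega> in M. X h \<omega> - X 0 \<omega> = X h \<omega>" by eventually_elim simp
    qed (use h X_measurable in auto)
    finally show ?thesis using char[of h] h by simp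
  qed
  have "(CLINT \<omega>|M. iexp (approx m \<omega>)) = (CLINT \<omega>|M. (\<Prod>j<Suc m. iexp (I j \<omega> * W (t j))))"
    unfolding approx_def I_def t_def[symmetric]
    by (simp add: exp_sum[symmetric] sum_distrib_left del: sum.lessThan_Suc prod.lessThan_Suc)
  also have "\<dots> = (\<Prod>j<Suc m. CLINT \<omega>|M. iexp (I j \<omega> * W (t j)))"
    by (rule indep_vars_lebesgue_integral[OF _ ind']) (auto intro!: integrable_iexp)
  also have "\<dots> = exp (- (\<Sum>j<Suc m. of_real h * \<Psi> (W (t j))))"
    unfolding one by (simp add: exp_sum[symmetric] sum_negf del: sum.lessThan_Suc prod.lessThan_Suc)
  finally show ?thesis unfolding h_def t_def .
qed

lemma riemann_sum_tendsto:
  "(\<lambda>m. \<Sum>j<Suc m. of_real (T / real (Suc m)) * \<Psi> (W (T * real j / real (Suc m)))) \<longlonglongrightarrow> (CLBINT t:{0..T}. \<Psi> (W t))"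
proof -
  have contW: "continuous_on UNIV W" using W(1) DERIV_isCont by (auto simp: continuous_on_eq_continuous_at)
  define y where "y t = \<Psi> (W t)" for t
  have y: "continuous_on UNIV y"
    unfolding y_def by (rule continuous_on_compose2[OF \<Psi> contW]) auto
  have "compact (y ` {0..T})" by (intro compact_continuous_image continuous_on_subset[OF y]) auto
  then obtain B where B: "\<And>t. t \<in> {0..T} \<Longrightarrow> norm (y t) \<le> B"
    using compact_imp_bounded[of "y ` {0..T}"] unfolding bounded_iff by blast
  have rc: "(y \<longlongrightarrow> y t) (at_right t)" for t
    using y by (auto simp: continuous_on_def intro: tendsto_within_subset)
  note G = grid_integral_tendsto[of T y B "\<lambda>_. 1", OF T rc]
  have len: "(LBINT t:{T * real j / real (Suc m)<..T * real (Suc j) / real (Suc m)}. 1) = T / real (Suc m)" for j m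
  proof -
    have "(LBINT t:{a<..b}. 1) = b - a" if "a \<le> b" for a b :: real
      using that unfolding set_lebesgue_integral_def by simp
    moreover have "T * real j / real (Suc m) \<le> T * real (Suc j) / real (Suc m)"
      using T by (intro divide_right_mono mult_left_mono) auto
    moreover have "T * real (Suc j) / real (Suc m) - T * real j / real (Suc m) = T / real (Suc m)"
      unfolding diff_divide_distrib[symmetric] by (simp add: algebra_simps)
    ultimately show ?thesis by presburger
  qed
  have L: "(\<lambda>m. \<Sum>j<Suc m. (T / real (Suc m)) *\<^sub>R y (T * real (Suc j) / real (Suc m))) \<longlonglongrightarrow> (CLBINT t:{0<..T}. y t)"
    using G(2) B unfolding len by auto
  have si: "set_integrable lborel {0<..T} y" using G(1) B by auto
  \<comment> \<open>The two endpoint sums differ by a single vanishing boundary term.\<close>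
  have shift: "(\<Sum>j<Suc m. (T / real (Suc m)) *\<^sub>R y (T * real j / real (Suc m))) =
     (\<Sum>j<Suc m. (T / real (Suc m)) *\<^sub>R y (T * real (Suc j) / real (Suc m))) + (T / real (Suc m)) *\<^sub>R (y 0 - y T)" for m
  proof -
    define g where "g j = y (T * real j / real (Suc m))" for j
    have "(\<Sum>j<n. g j) = (\<Sum>j<n. g (Suc j)) + (g 0 - g n)" for n by (induction n) auto
    from this[of "Suc m"] show ?thesis
      unfolding scaleR_sum_right[symmetric] g_def scaleR_add_right[symmetric] by (simp del: sum.lessThan_Suc)
  qed
  have "(\<lambda>m. (T / real (Suc m)) *\<^sub>R (y 0 - y T)) \<longlonglongrightarrow> 0 *\<^sub>R (y 0 - y T)"
    by (intro tendsto_scaleR tendsto_const LIMSEQ_Suc[OF lim_const_over_n])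
  from tendsto_add[OF L this] show ?thesis
    unfolding shift[symmetric] scaleR_conv_of_real[symmetric] y_def[symmetric] set_integral_closed_left_endpoint(2)[OF si less_imp_le[OF T]]
    by simp
qed

text \<open>For deterministic \<open>w\<close> the integral of \<open>X\<close> against \<open>w\<close> equals the integral of \<open>W\<close> against \<open>dX\<close>, a sum of
  independent infinitesimal increments; their exponents add up.\<close>

theorem char_path_integral:
  "(CLINT \<omega>|completion M. iexp (LBINT t:{0..T}. X t \<omega> * w t)) = exp (- (CLBINT t:{0..T}. \<Psi> (W t)))"
proof (rule LIMSEQ_unique)
  interpret C: prob_space "completion M"
    by (rule prob_spaceI) (simp add: emeasure_space_1)
  have "(\<lambda>m. CLINT \<omega>|completion M. iexp (approx m \<omega>)) \<longlonglongrightarrow> (CLINT \<omega>|completion M. iexp (LBINT t:{0..T}. X t \<omega> * w t))"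
  proof (rule integral_dominated_convergence[where w="\<lambda>_. 1"])
    show "AE \<omega> in completion M. (\<lambda>m. iexp (approx m \<omega>)) \<longlonglongrightarrow> iexp (LBINT t:{0..T}. X t \<omega> * w t)"
      using AE_completion[OF AE_path] by eventually_elim (auto intro!: tendsto_intros)
    have "approx m \<in> borel_measurable (completion M)" for m by (intro measurable_completion) simp
    then show "(\<lambda>\<omega>. iexp (approx m \<omega>)) \<in> borel_measurable (completion M)" for m by measurable
    show "(\<lambda>\<omega>. iexp (LBINT t:{0..T}. X t \<omega> * w t)) \<in> borel_measurable (completion M)"
      using path_integral_measurable by measurable
  qed auto
  moreover have "(CLINT \<omega>|completion M. iexp (approx m \<omega>)) = (CLINT \<omega>|M. iexp (approx m \<omega>))" for m
    by (rule integral_completion) measurable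
  ultimately show "(\<lambda>m. CLINT \<omega>|M. iexp (approx m \<omega>)) \<longlonglongrightarrow> (CLINT \<omega>|completion M. iexp (LBINT t:{0..T}. X t \<omega> * w t))"
    by simp
  show "(\<lambda>m. CLINT \<omega>|M. iexp (approx m \<omega>)) \<longlonglongrightarrow> exp (- (CLBINT t:{0..T}. \<Psi> (W t)))"
    unfolding char_approx by (intro tendsto_intros riemann_sum_tendsto)
qed

end

section \<open>Almost sure convergence of martingales\<close>

lemma integrable_product_of_squares:
  fixes f g :: "'a \<Rightarrow> real"
  assumes [measurable]: "f \<in> borel_measurable M" "g \<in> borel_measurable M"
    and "integrable M (\<lambda>x. (f x)\<^sup>2)" "integrable M (\<lambda>x. (g x)\<^sup>2)"
  shows "integrable M (\<lambda>x. f x * g x)"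
proof (rule Bochner_Integration.integrable_bound[of _ "\<lambda>x. (f x)\<^sup>2 + (g x)\<^sup>2"])
  have "\<bar>a * b\<bar> \<le> a\<^sup>2 + b\<^sup>2" for a b :: real
    using sum_squares_bound[of "\<bar>a\<bar>" "\<bar>b\<bar>"] abs_ge_zero[of "a * b"] unfolding abs_mult power2_abs by linarith
  then show "AE x in M. norm (f x * g x) \<le> norm ((f x)\<^sup>2 + (g x)\<^sup>2)"
    by simp
qed (use assms in auto)

text \<open>Square-integrable martingale differences. Conditional mean zero is expressed by orthogonality to
  all square-integrable variables of the past.\<close>

locale martingale_differences = prob_space +
  fixes F :: "nat \<Rightarrow> 'a measure" and D :: "nat \<Rightarrow> 'a \<Rightarrow> real"
  assumes subalg: "subalgebra M (F n)"
    and F_mono: "sets (F n) \<subseteq> sets (F (Suc n))"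
    and adapted: "D n \<in> borel_measurable (F (Suc n))"
    and square_integrable: "integrable M (\<lambda>x. (D n x)\<^sup>2)"
    and orthogonal: "Z \<in> borel_measurable (F n) \<Longrightarrow> integrable M (\<lambda>x. (Z x)\<^sup>2) \<Longrightarrow> (\<integral>x. Z x * D n x \<partial>M) = 0"
begin

lemma F_le: "m \<le> n \<Longrightarrow> sets (F m) \<subseteq> sets (F n)"
  by (rule lift_Suc_mono_le[of "\<lambda>n. sets (F n)"]) (use F_mono in auto)

lemma measurable_F_le: "f \<in> measurable (F m) K \<Longrightarrow> m \<le> n \<Longrightarrow> f \<in> measurable (F n) K"
  using F_le[of m n] subalg[of m] subalg[of n] unfolding measurable_def subalgebra_def by auto

lemma measurable_F_M: "f \<in> measurable (F n) K \<Longrightarrow> f \<in> measurable M K"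
  using measurable_from_subalg[OF subalg] .

lemma D_measurable [measurable]: "D n \<in> borel_measurable M"
  using adapted measurable_F_M by blast

definition block_sum :: "nat \<Rightarrow> nat \<Rightarrow> 'a \<Rightarrow> real" where
  "block_sum m n x = (\<Sum>i<n. D (m + i) x)"

lemma block_sum_measurable: "block_sum m n \<in> borel_measurable (F (m + n))"
  unfolding block_sum_def[abs_def]
  by (intro borel_measurable_sum measurable_F_le[OF adapted]) auto

lemma block_sum_measurable_M [measurable]: "block_sum m n \<in> borel_measurable M"
  using block_sum_measurable measurable_F_M by blast

text \<open>Kolmogorov's inequality. The sum is stopped when it first leaves \<open>(- \<epsilon>, \<epsilon>)\<close>: the stopped sum \<open>R\<close> still
  has orthogonal increments, hence second moment at most the sum of the variances, and on the event in
  question it has absolute value at least \<open>\<epsilon>\<close>.\<close>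

lemma maximal_inequality:
  assumes \<epsilon>: "\<epsilon> > 0"
  shows "prob {x \<in> space M. \<exists>j\<le>n. \<epsilon> \<le> \<bar>block_sum m j x\<bar>} \<le> (\<Sum>k<n. \<integral>x. (D (m + k) x)\<^sup>2 \<partial>M) / \<epsilon>\<^sup>2"
proof -
  \<comment> \<open>The factor \<open>alive k\<close> depends on the past only and switches off all increments after the first exit.\<close>
  define alive :: "nat \<Rightarrow> 'a \<Rightarrow> real" where "alive k = indicator {x \<in> space M. \<forall>j\<le>k. \<bar>block_sum m j x\<bar> < \<epsilon>}" for k
  define R where "R n x = (\<Sum>k<n. alive k x * D (m + k) x)" for n x
  have alive_meas: "alive k \<in> borel_measurable (F (m + k))" for k
  proof -
    have [measurable]: "block_sum m j \<in> borel_measurable (F (m + k))" if "j \<le> k" for j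
      using measurable_F_le[OF block_sum_measurable] that by simp
    have "{x \<in> space (F (m + k)). \<forall>j\<in>{..k}. \<bar>block_sum m j x\<bar> < \<epsilon>} \<in> sets (F (m + k))"
      by (intro sets.sets_Collect_finite_All') auto
    also have "space (F (m + k)) = space M" using subalg unfolding subalgebra_def by blast
    also have "{x \<in> space M. \<forall>j\<in>{..k}. \<bar>block_sum m j x\<bar> < \<epsilon>} = {x \<in> space M. \<forall>j\<le>k. \<bar>block_sum m j x\<bar> < \<epsilon>}"
      by auto
    finally show ?thesis
      unfolding alive_def by (rule borel_measurable_indicator)
  qed
  have alive01: "0 \<le> alive k x" "alive k x \<le> 1" "(alive k x)\<^sup>2 = alive k x" for k x
    unfolding alive_def by (auto split: split_indicator)
  have R_meas: "R n \<in> borel_measurable (F (m + n))" for n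
    unfolding R_def[abs_def]
    by (intro borel_measurable_sum borel_measurable_times measurable_F_le[OF alive_meas]
        measurable_F_le[OF adapted]) auto
  have [measurable]: "alive k \<in> borel_measurable M" "R k \<in> borel_measurable M" for k
    using alive_meas R_meas measurable_F_M by blast+
  have D2: "integrable M (\<lambda>x. (alive k x * D (m + k) x)\<^sup>2)" for k
    by (rule Bochner_Integration.integrable_bound[OF square_integrable[of "m + k"]])
      (use alive01 in \<open>auto simp: power_mult_distrib intro!: AE_I2 mult_left_le_one_le\<close>)
  have R2: "integrable M (\<lambda>x. (R n x)\<^sup>2) \<and> (\<integral>x. (R n x)\<^sup>2 \<partial>M) \<le> (\<Sum>k<n. \<integral>x. (D (m + k) x)\<^sup>2 \<partial>M)" for n
  proof (induction n)
    case 0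
    then show ?case by (simp add: R_def)
  next
    case (Suc n)
    then have IH: "integrable M (\<lambda>x. (R n x)\<^sup>2)" "(\<integral>x. (R n x)\<^sup>2 \<partial>M) \<le> (\<Sum>k<n. \<integral>x. (D (m + k) x)\<^sup>2 \<partial>M)"
      by auto
    have cross: "integrable M (\<lambda>x. R n x * (alive n x * D (m + n) x))"
      by (intro integrable_product_of_squares IH D2) auto
    have Z2: "integrable M (\<lambda>x. (R n x * alive n x)\<^sup>2)"
      by (rule Bochner_Integration.integrable_bound[OF IH(1)])
        (use alive01 in \<open>auto simp: power_mult_distrib intro!: AE_I2 mult_right_le_one_le\<close>)
    have "(\<integral>x. (R n x * alive n x) * D (m + n) x \<partial>M) = 0"
      by (intro orthogonal Z2 borel_measurable_times R_meas alive_meas)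
    then have zero: "(\<integral>x. R n x * (alive n x * D (m + n) x) \<partial>M) = 0"
      by (simp add: mult.assoc)
    have e: "(R (Suc n) x)\<^sup>2 = (R n x)\<^sup>2 + 2 * (R n x * (alive n x * D (m + n) x)) + (alive n x * D (m + n) x)\<^sup>2" for x
      by (simp add: R_def power2_sum)
    have "(\<integral>x. (R (Suc n) x)\<^sup>2 \<partial>M) = (\<integral>x. (R n x)\<^sup>2 \<partial>M) + (\<integral>x. (alive n x * D (m + n) x)\<^sup>2 \<partial>M)"
      unfolding e using IH(1) cross D2 zero by simp
    also have "(\<integral>x. (alive n x * D (m + n) x)\<^sup>2 \<partial>M) \<le> (\<integral>x. (D (m + n) x)\<^sup>2 \<partial>M)"
      using alive01 by (intro integral_mono D2 square_integrable) (auto simp: power_mult_distrib intro!: mult_left_le_one_le)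
    finally show ?case
      using IH cross D2 unfolding e by auto
  qed
  have stop: "\<epsilon> \<le> \<bar>R n x\<bar>" if x: "x \<in> space M" and ex: "\<exists>j\<le>n. \<epsilon> \<le> \<bar>block_sum m j x\<bar>" for x
  proof -
    define j where "j = (LEAST j. \<epsilon> \<le> \<bar>block_sum m j x\<bar>)"
    have j: "\<epsilon> \<le> \<bar>block_sum m j x\<bar>" "j \<le> n"
      using ex LeastI_ex[of "\<lambda>j. \<epsilon> \<le> \<bar>block_sum m j x\<bar>"] unfolding j_def
      by (auto intro: Least_le order_trans)
    have before: "\<bar>block_sum m i x\<bar> < \<epsilon>" if "i < j" for i
      using not_less_Least[of i "\<lambda>j. \<epsilon> \<le> \<bar>block_sum m j x\<bar>"] that unfolding j_def by auto
    have "R n x = (\<Sum>k<n. if k < j then D (m + k) x else 0)"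
      unfolding R_def
    proof (rule sum.cong[OF refl])
      fix k
      show "alive k x * D (m + k) x = (if k < j then D (m + k) x else 0)"
        using before j(1) x by (force simp: alive_def indicator_def not_less)
    qed
    also have "\<dots> = block_sum m j x"
      unfolding block_sum_def using j(2) by (subst sum.inter_filter[symmetric]) (auto intro!: sum.cong)
    finally show ?thesis using j by simp
  qed
  have "prob {x \<in> space M. \<exists>j\<le>n. \<epsilon> \<le> \<bar>block_sum m j x\<bar>} \<le> prob {x \<in> space M. (R n x)\<^sup>2 \<ge> \<epsilon>\<^sup>2}"
    using stop \<epsilon> by (intro finite_measure_mono) (auto simp: abs_le_square_iff[symmetric])
  also have "\<dots> \<le> (\<integral>x. (R n x)\<^sup>2 \<partial>M) / \<epsilon>\<^sup>2"
    using \<epsilon> R2 by (intro integral_Markov_inequality_measure[where A="{}"]) auto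
  also have "\<dots> \<le> (\<Sum>k<n. \<integral>x. (D (m + k) x)\<^sup>2 \<partial>M) / \<epsilon>\<^sup>2"
    using R2 by (intro divide_right_mono) auto
  finally show ?thesis .
qed

text \<open>By the maximal inequality the oscillation of the partial sums after time \<open>m\<close> is small with a
  probability controlled by the tail of the variance series.\<close>

theorem AE_convergent_sum:
  assumes sm: "summable (\<lambda>n. \<integral>x. (D n x)\<^sup>2 \<partial>M)"
  shows "AE x in M. convergent (\<lambda>n. \<Sum>i<n. D i x)"
proof -
  define v where "v n = (\<integral>x. (D n x)\<^sup>2 \<partial>M)" for n
  have v0: "v n \<ge> 0" for n unfolding v_def by simp
  have sv: "summable v" using sm unfolding v_def .
  have tail: "(\<Sum>k<n. v (m + k)) \<le> suminf v - sum v {..<m}" for m n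
  proof -
    have "sum v {..<m} + (\<Sum>k<n. v (m + k)) = sum v {..<m + n}"
      by (induction n) auto
    also have "\<dots> \<le> suminf v" by (rule sum_le_suminf[OF sv]) (use v0 in auto)
    finally show ?thesis by simp
  qed
  have tail0: "(\<lambda>m. suminf v - sum v {..<m}) \<longlonglongrightarrow> 0"
  proof -
    have "(\<lambda>m. suminf v - sum v {..<m}) \<longlonglongrightarrow> suminf v - suminf v"
      by (intro tendsto_intros summable_LIMSEQ sv)
    then show ?thesis by simp
  qed
  have small: "AE x in M. \<exists>m. \<forall>j. \<bar>block_sum m j x\<bar> < \<epsilon>" if \<epsilon>: "\<epsilon> > 0" for \<epsilon>
  proof -
    define B where "B m = {x \<in> space M. \<exists>j. \<epsilon> \<le> \<bar>block_sum m j x\<bar>}" for m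
    have [measurable]: "B m \<in> sets M" for m unfolding B_def by measurable
    have PB: "prob (B m) \<le> (suminf v - sum v {..<m}) / \<epsilon>\<^sup>2" for m
    proof (rule LIMSEQ_le_const2)
      have "(\<lambda>n. prob {x \<in> space M. \<exists>j\<le>n. \<epsilon> \<le> \<bar>block_sum m j x\<bar>}) \<longlonglongrightarrow>
          prob (\<Union>n. {x \<in> space M. \<exists>j\<le>n. \<epsilon> \<le> \<bar>block_sum m j x\<bar>})"
        by (rule finite_Lim_measure_incseq) (auto simp: incseq_def intro: order_trans)
      moreover have "(\<Union>n. {x \<in> space M. \<exists>j\<le>n. \<epsilon> \<le> \<bar>block_sum m j x\<bar>}) = B m"
        unfolding B_def by auto
      ultimately show "(\<lambda>n. prob {x \<in> space M. \<exists>j\<le>n. \<epsilon> \<le> \<bar>block_sum m j x\<bar>}) \<longlonglongrightarrow> prob (B m)" by simp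
      have "prob {x \<in> space M. \<exists>j\<le>n. \<epsilon> \<le> \<bar>block_sum m j x\<bar>} \<le> (suminf v - sum v {..<m}) / \<epsilon>\<^sup>2" for n
        using maximal_inequality[OF \<epsilon>, of n m] divide_right_mono[OF tail[of m n], of "\<epsilon>\<^sup>2"]
        unfolding v_def by simp
      then show "\<exists>N. \<forall>n\<ge>N. prob {x \<in> space M. \<exists>j\<le>n. \<epsilon> \<le> \<bar>block_sum m j x\<bar>} \<le> (suminf v - sum v {..<m}) / \<epsilon>\<^sup>2"
        by blast
    qed
    have "prob (\<Inter>m. B m) \<le> 0"
    proof (rule LIMSEQ_le_const)
      show "(\<lambda>m. (suminf v - sum v {..<m}) / \<epsilon>\<^sup>2) \<longlonglongrightarrow> 0"
        using tendsto_divide[OF tail0 tendsto_const[of "\<epsilon>\<^sup>2"]] \<epsilon> by simp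
      have "prob (\<Inter>m. B m) \<le> prob (B n)" for n by (intro finite_measure_mono) auto
      then show "\<exists>N. \<forall>n\<ge>N. prob (\<Inter>m. B m) \<le> (suminf v - sum v {..<n}) / \<epsilon>\<^sup>2"
        using PB order_trans by blast
    qed
    then have "prob (\<Inter>m. B m) = 0" by (simp add: measure_le_0_iff)
    then have "(\<Inter>m. B m) \<in> null_sets M"
      by (auto simp: null_sets_def emeasure_eq_measure)
    then have "AE x in M. x \<notin> (\<Inter>m. B m)" by (rule AE_not_in)
    then show ?thesis by (rule AE_mp) (auto simp: B_def not_le intro!: AE_I2)
  qed
  have "AE x in M. \<forall>l. \<exists>m. \<forall>j. \<bar>block_sum m j x\<bar> < inverse (real (Suc l))"
    unfolding AE_all_countable by (intro allI small) simp
  then show ?thesis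
  proof (rule AE_mp, intro AE_I2 impI)
    fix x assume x: "\<forall>l. \<exists>m. \<forall>j. \<bar>block_sum m j x\<bar> < inverse (real (Suc l))"
    have bs: "block_sum m j x = (\<Sum>i<m + j. D i x) - (\<Sum>i<m. D i x)" for m j
      unfolding block_sum_def by (induction j) auto
    show "convergent (\<lambda>n. \<Sum>i<n. D i x)"
      unfolding Cauchy_convergent_iff[symmetric]
    proof (rule metric_CauchyI)
      fix e :: real assume "e > 0"
      then obtain l where l: "inverse (real (Suc l)) < e / 2" using reals_Archimedean[of "e/2"] by auto
      obtain m where m: "\<And>j. \<bar>block_sum m j x\<bar> < inverse (real (Suc l))" using x by blast
      have c: "\<bar>(\<Sum>i<n. D i x) - (\<Sum>i<m. D i x)\<bar> < e / 2" if "n \<ge> m" for n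
        using m[of "n - m"] l that unfolding bs by simp
      show "\<exists>M. \<forall>k\<ge>M. \<forall>n\<ge>M. dist (\<Sum>i<k. D i x) (\<Sum>i<n. D i x) < e"
      proof (intro exI allI impI)
        fix k n assume "m \<le> k" "m \<le> n"
        then show "dist (\<Sum>i<k. D i x) (\<Sum>i<n. D i x) < e"
          using c[of k] c[of n] unfolding dist_real_def by linarith
      qed
    qed
  qed
qed

end

text \<open>With \<open>a = 1 / b\<close> increasing, Abel summation shows that a block of \<open>x\<close> is at most twice the oscillation of
  the convergent series on that block, times the last value of \<open>a\<close>.\<close>

lemma Kronecker_lemma:
  fixes b x :: "nat \<Rightarrow> real"
  assumes b0: "\<And>n. b n > 0" and bdec: "decseq b" and blim: "b \<longlonglongrightarrow> 0"
    and conv: "convergent (\<lambda>n. \<Sum>i<n. b i * x i)"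
  shows "(\<lambda>n. b n * (\<Sum>i<n. x i)) \<longlonglongrightarrow> 0"
proof (rule LIMSEQ_I)
  fix e :: real assume e: "e > 0"
  have "Cauchy (\<lambda>n. \<Sum>i<n. b i * x i)" using conv by (simp add: Cauchy_convergent_iff)
  then obtain m where m: "\<And>p q. p \<ge> m \<Longrightarrow> q \<ge> m \<Longrightarrow> \<bar>(\<Sum>i<p. b i * x i) - (\<Sum>i<q. b i * x i)\<bar> < e / 4"
    using metric_CauchyD[of "\<lambda>n. \<Sum>i<n. b i * x i" "e / 4"] e unfolding dist_real_def by auto
  define P where "P j = (\<Sum>i<m + j. b i * x i) - (\<Sum>i<m. b i * x i)" for j
  define Q where "Q j = (\<Sum>i<m + j. x i) - (\<Sum>i<m. x i)" for j
  define a where "a j = inverse (b (m + j))" for j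
  have P: "\<bar>P j\<bar> \<le> e / 4" for j using m[of "m + j" m] unfolding P_def by simp
  have a: "a j \<le> a (Suc j)" "a j > 0" for j
    using bdec b0 unfolding a_def by (auto intro!: le_imp_inverse_le simp: decseq_Suc_iff)
  have ax: "a j * (P (Suc j) - P j) = x (m + j)" for j
    using b0[of "m + j"] by (simp add: P_def a_def)
  have abel: "\<bar>Q j - a j * P j\<bar> \<le> e / 4 * (a j - a 0)" for j
  proof (induction j)
    case 0
    then show ?case by (simp add: Q_def P_def)
  next
    case (Suc j)
    have "Q (Suc j) - a (Suc j) * P (Suc j) = (Q j - a j * P j) - (a (Suc j) - a j) * P (Suc j)"
      using ax[of j] by (simp add: Q_def algebra_simps)
    moreover have "\<bar>(a (Suc j) - a j) * P (Suc j)\<bar> \<le> (a (Suc j) - a j) * (e / 4)"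
      using a[of j] mult_left_mono[OF P[of "Suc j"], of "a (Suc j) - a j"] by (simp add: abs_mult)
    ultimately have "\<bar>Q (Suc j) - a (Suc j) * P (Suc j)\<bar> \<le> e / 4 * (a j - a 0) + (a (Suc j) - a j) * (e / 4)"
      using Suc by linarith
    then show ?case by (simp add: field_simps)
  qed
  have Q: "b (m + j) * \<bar>Q j\<bar> \<le> e / 2" for j
  proof -
    have "\<bar>a j * P j\<bar> \<le> a j * e / 4" using a[of j] P[of j] by (simp add: abs_mult)
    moreover have "e / 4 * (a j - a 0) \<le> a j * e / 4" using a(2)[of 0] e by simp
    ultimately have "\<bar>Q j\<bar> \<le> a j * e / 2"
      using abel[of j] by linarith
    then have "\<bar>Q j\<bar> \<le> a j * (e / 2)" by simp
    then have "\<bar>Q j\<bar> \<le> (e / 2) / b (m + j)" by (simp add: a_def field_simps)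
    then show ?thesis using b0[of "m + j"] by (simp add: pos_le_divide_eq mult.commute)
  qed
  have "(\<lambda>n. b n * \<bar>\<Sum>i<m. x i\<bar>) \<longlonglongrightarrow> 0"
    using tendsto_mult_right[OF blim, of "\<bar>\<Sum>i<m. x i\<bar>"] by simp
  then obtain n0 where n0: "\<And>n. n \<ge> n0 \<Longrightarrow> \<bar>b n * \<bar>\<Sum>i<m. x i\<bar>\<bar> < e / 2"
    using LIMSEQ_D[of _ 0 "e/2"] e by fastforce
  show "\<exists>no. \<forall>n\<ge>no. norm (b n * (\<Sum>i<n. x i) - 0) < e"
  proof (intro exI allI impI)
    fix n assume n: "max n0 m \<le> n"
    have "\<bar>\<Sum>i<n. x i\<bar> \<le> \<bar>Q (n - m)\<bar> + \<bar>\<Sum>i<m. x i\<bar>" using n unfolding Q_def by simp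
    then have "b n * \<bar>\<Sum>i<n. x i\<bar> \<le> b n * (\<bar>Q (n - m)\<bar> + \<bar>\<Sum>i<m. x i\<bar>)"
      using b0[of n] by (intro mult_left_mono) auto
    also have "\<dots> < e" using Q[of "n - m"] n0[of n] n by (simp add: algebra_simps)
    finally show "norm (b n * (\<Sum>i<n. x i) - 0) < e" using b0[of n] by (simp add: abs_mult)
  qed
qed

section \<open>Exponential waiting times\<close>

text \<open>Two independent families, each consisting of independent variables, form one independent family.\<close>

lemma (in prob_space) indep_vars_Plus:
  fixes U :: "'i \<Rightarrow> 'a \<Rightarrow> 'x" and E :: "'i \<Rightarrow> 'a \<Rightarrow> 'x"
  assumes U: "indep_vars (\<lambda>_. S) U I" and E: "indep_vars (\<lambda>_. S) E K"
    and UE: "indep_var (PiM I (\<lambda>_. S)) (\<lambda>\<omega>. \<lambda>i\<in>I. U i \<omega>) (PiM K (\<lambda>_. S)) (\<lambda>\<omega>. \<lambda>i\<in>K. E i \<omega>)"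
  shows "indep_vars (\<lambda>_. S) (case_sum U E) (I <+> K)"
  unfolding indep_vars_def2 indep_sets_def
proof (intro conjI ballI allI impI)
  note rv = indep_vars_def[THEN iffD1, THEN conjunct1, rule_format]
  show meas: "random_variable S (case_sum U E j)" if "j \<in> I <+> K" for j
    using that rv[OF U] rv[OF E] by auto
  show "{case_sum U E j -` A \<inter> space M |A. A \<in> sets S} \<subseteq> events" if "j \<in> I <+> K" for j
    using meas[OF that] by (auto intro: measurable_sets)
  fix J A
  assume J: "J \<subseteq> I <+> K" "J \<noteq> {}" "finite J"
    and A: "A \<in> (\<Pi> j\<in>J. {case_sum U E j -` A \<inter> space M |A. A \<in> sets S})"
  have "\<forall>j\<in>J. \<exists>B\<in>sets S. A j = case_sum U E j -` B \<inter> space M" using A unfolding Pi_iff by blast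
  then obtain B where B: "\<And>j. j \<in> J \<Longrightarrow> B j \<in> sets S" "\<And>j. j \<in> J \<Longrightarrow> A j = case_sum U E j -` B j \<inter> space M"
    by metis
  define JU where "JU = Inl -` J"
  define JE where "JE = Inr -` J"
  have Jsplit: "J = Inl ` JU \<union> Inr ` JE" "JU \<subseteq> I" "JE \<subseteq> K"
  proof -
    have "j \<in> Inl ` JU \<union> Inr ` JE" if "j \<in> J" for j
      using that by (cases j) (auto simp: JU_def JE_def)
    then show "J = Inl ` JU \<union> Inr ` JE" by (auto simp: JU_def JE_def)
    show "JU \<subseteq> I" "JE \<subseteq> K" using J(1) by (auto simp: JU_def JE_def)
  qed
  have fin: "finite JU" "finite JE"
    using J(3) by (auto simp: JU_def JE_def intro: finite_vimageI)
  define CU where "CU = {\<omega> \<in> space M. \<forall>i\<in>JU. U i \<omega> \<in> B (Inl i)}"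
  define CE where "CE = {\<omega> \<in> space M. \<forall>i\<in>JE. E i \<omega> \<in> B (Inr i)}"
  have BU: "B (Inl i) \<in> sets S" "A (Inl i) = U i -` B (Inl i) \<inter> space M" if "i \<in> JU" for i
    using B[of "Inl i"] that unfolding JU_def by auto
  have BE: "B (Inr i) \<in> sets S" "A (Inr i) = E i -` B (Inr i) \<inter> space M" if "i \<in> JE" for i
    using B[of "Inr i"] that unfolding JE_def by auto
  have PU: "prob CU = (\<Prod>i\<in>JU. prob (A (Inl i)))"
  proof (cases "JU = {}")
    case True
    then show ?thesis by (simp add: CU_def prob_space)
  next
    case False
    have "prob (\<Inter>i\<in>JU. U i -` B (Inl i) \<inter> space M) = (\<Prod>i\<in>JU. prob (U i -` B (Inl i) \<inter> space M))"
      by (rule indep_varsD[OF U]) (use False fin Jsplit BU in auto)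
    moreover have "(\<Inter>i\<in>JU. U i -` B (Inl i) \<inter> space M) = CU" using False by (auto simp: CU_def)
    ultimately show ?thesis using BU by simp
  qed
  have PE: "prob CE = (\<Prod>i\<in>JE. prob (A (Inr i)))"
  proof (cases "JE = {}")
    case True
    then show ?thesis by (simp add: CE_def prob_space)
  next
    case False
    have "prob (\<Inter>i\<in>JE. E i -` B (Inr i) \<inter> space M) = (\<Prod>i\<in>JE. prob (E i -` B (Inr i) \<inter> space M))"
      by (rule indep_varsD[OF E]) (use False fin Jsplit BE in auto)
    moreover have "(\<Inter>i\<in>JE. E i -` B (Inr i) \<inter> space M) = CE" using False by (auto simp: CE_def)
    ultimately show ?thesis using BE by simp
  qed
  define XU where "XU = {x \<in> space (PiM I (\<lambda>_. S)). \<forall>i\<in>JU. x i \<in> B (Inl i)}"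
  define XE where "XE = {x \<in> space (PiM K (\<lambda>_. S)). \<forall>i\<in>JE. x i \<in> B (Inr i)}"
  have XU: "XU \<in> sets (PiM I (\<lambda>_. S))"
    unfolding XU_def using fin BU Jsplit(2)
    by (intro sets.sets_Collect_finite_All sets_Collect_single') auto
  have XE: "XE \<in> sets (PiM K (\<lambda>_. S))"
    unfolding XE_def using fin BE Jsplit(3)
    by (intro sets.sets_Collect_finite_All sets_Collect_single') auto
  have inU: "(\<lambda>i\<in>I. U i \<omega>) \<in> space (PiM I (\<lambda>_. S))" "(\<lambda>i\<in>K. E i \<omega>) \<in> space (PiM K (\<lambda>_. S))" if "\<omega> \<in> space M" for \<omega>
    using that indep_var_rv1[OF UE] indep_var_rv2[OF UE] by (auto dest: measurable_space)
  have pre: "(\<lambda>\<omega>. \<lambda>i\<in>I. U i \<omega>) -` XU \<inter> space M = CU" "(\<lambda>\<omega>. \<lambda>i\<in>K. E i \<omega>) -` XE \<inter> space M = CE"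
    using inU Jsplit(2,3) by (auto simp: XU_def XE_def CU_def CE_def subset_iff)
  have ne: "JU \<noteq> {} \<or> JE \<noteq> {}" using J(2) Jsplit(1) by auto
  have "(\<Inter>j\<in>J. A j) = (\<Inter>i\<in>JU. A (Inl i)) \<inter> (\<Inter>i\<in>JE. A (Inr i))"
    unfolding Jsplit(1) by (simp add: INT_Un)
  also have "\<dots> = (\<Inter>i\<in>JU. U i -` B (Inl i) \<inter> space M) \<inter> (\<Inter>i\<in>JE. E i -` B (Inr i) \<inter> space M)"
    using BU(2) BE(2) by simp
  also have "\<dots> = CU \<inter> CE"
    using ne unfolding CU_def CE_def by auto
  also have "CU \<inter> CE = (\<lambda>\<omega>. (\<lambda>i\<in>I. U i \<omega>, \<lambda>i\<in>K. E i \<omega>)) -` (XU \<times> XE) \<inter> space M"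
    using pre by auto
  also have "prob \<dots> = prob CU * prob CE"
    unfolding indep_varD[OF UE XU XE] pre ..
  also have "\<dots> = (\<Prod>j\<in>J. prob (A j))"
    unfolding PU PE Jsplit(1) using fin
    by (subst prod.union_disjoint) (auto simp: prod.reindex)
  finally show "prob (\<Inter>j\<in>J. A j) = (\<Prod>j\<in>J. prob (A j))" .
qed

definition expo :: "real measure" where
  "expo = density lborel (exponential_density 1)"

definition unif :: "real measure" where
  "unif = uniform_measure lborel {0..1}"

lemma sets_expo [measurable_cong, simp]: "sets expo = sets borel" and space_expo [simp]: "space expo = UNIV"
  by (auto simp: expo_def)

lemma sets_unif [measurable_cong, simp]: "sets unif = sets borel" and space_unif [simp]: "space unif = UNIV"
  by (auto simp: unif_def)

lemma prob_space_expo: "prob_space expo"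
  unfolding expo_def by (rule prob_space_exponential_density) simp

lemma prob_space_unif: "prob_space unif"
  unfolding unif_def by (rule prob_space_uniform_measure) auto

lemma AE_expo_nonneg: "AE e in expo. 0 \<le> e"
  unfolding expo_def by (subst AE_density) (auto simp: exponential_density_def)

text \<open>The exponential law satisfies \<open>E (G - G') = G 0\<close>, because \<open>exp (- e) (G e - G' e)\<close> is the derivative
  of \<open>- exp (- e) G e\<close>. All martingale properties of the arrival times below are instances. The growth
  condition with rate \<open>1/2\<close> covers polynomials and bounded functions alike.\<close>

lemma integral_expo_by_parts:
  fixes G g :: "real \<Rightarrow> 'x::euclidean_space"
  assumes [measurable]: "G \<in> borel_measurable borel" "g \<in> borel_measurable borel"
    and der: "\<And>e. e > 0 \<Longrightarrow> (G has_vector_derivative g e) (at e)"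
    and cont: "\<And>e. e > 0 \<Longrightarrow> isCont g e"
    and G0: "(G \<longlongrightarrow> G0) (at_right 0)"
    and bnd: "\<And>e. e > 0 \<Longrightarrow> norm (G e) \<le> A * exp (e / 2)" "\<And>e. e > 0 \<Longrightarrow> norm (g e) \<le> A * exp (e / 2)"
  shows "integrable expo G" "integrable expo g" "(\<integral>e. G e - g e \<partial>expo) = G0"
proof -
  have exi: "integrable lborel (\<lambda>e. exponential_density (1/2) e)"
    using prob_space.emeasure_space_1[OF prob_space_exponential_density[of "1/2"]]
    by (intro integrableI_nonneg) (auto simp: emeasure_density exponential_density_nonneg)
  have A0: "A \<ge> 0" using bnd(1)[of 1] by (smt (verit) exp_gt_zero mult_neg_pos norm_ge_zero)
  have int: "integrable lborel (\<lambda>e. exponential_density 1 e *\<^sub>R f e)"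
    if [measurable]: "f \<in> borel_measurable borel" and b: "\<And>e. e > 0 \<Longrightarrow> norm (f e) \<le> A * exp (e / 2)" for f :: "real \<Rightarrow> 'x"
  proof (rule Bochner_Integration.integrable_bound)
    show "integrable lborel (\<lambda>e. (2 * A) * exponential_density (1/2) e)" using exi by (rule integrable_mult_right)
    show "AE e in lborel. norm (exponential_density 1 e *\<^sub>R f e) \<le> norm ((2 * A) * exponential_density (1/2) e)"
      using AE_lborel_singleton[of 0]
    proof eventually_elim
      case (elim e)
      show ?case
      proof (cases "e > 0")
        case True
        have "exp (- e) * norm (f e) \<le> exp (- e) * (A * exp (e / 2))" using b[OF True] by simp
        also have "\<dots> = A * exp (- e / 2)" by (simp add: exp_add[symmetric])
        finally show ?thesis using True A0 by (simp add: exponential_density_def)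
      qed (use elim in \<open>auto simp: exponential_density_def\<close>)
    qed
  qed simp
  show iG: "integrable expo G" and ig: "integrable expo g"
    unfolding expo_def using int bnd by (auto simp: integrable_density exponential_density_nonneg)
  define F where "F e = - (exp (- e) *\<^sub>R G e)" for e
  define f where "f e = exp (- e) *\<^sub>R (G e - g e)" for e
  have ind: "indicator {0<..} e *\<^sub>R f e = exponential_density 1 e *\<^sub>R G e - exponential_density 1 e *\<^sub>R g e" if "e \<noteq> 0" for e
    using that by (auto simp: indicator_def exponential_density_def f_def scaleR_diff_right)
  have [measurable]: "f \<in> borel_measurable borel" unfolding f_def by measurable
  have si: "set_integrable lborel {0<..} f"
    unfolding set_integrable_def
  proof (rule Bochner_Integration.integrable_cong_AE_imp)
    show "integrable lborel (\<lambda>e. exponential_density 1 e *\<^sub>R G e - exponential_density 1 e *\<^sub>R g e)"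
      using int bnd by (intro Bochner_Integration.integrable_diff) auto
    show "AE e in lborel. exponential_density 1 e *\<^sub>R G e - exponential_density 1 e *\<^sub>R g e = indicator {0<..} e *\<^sub>R f e"
      using AE_lborel_singleton[of 0] by eventually_elim (simp add: ind)
  qed simp
  have "(\<integral>e. G e - g e \<partial>expo) = (\<integral>e. exponential_density 1 e *\<^sub>R (G e - g e) \<partial>lborel)"
    unfolding expo_def by (subst integral_density) (auto simp: exponential_density_nonneg)
  also have "\<dots> = (LBINT e:{0<..}. f e)"
    unfolding set_lebesgue_integral_def
  proof (rule integral_cong_AE)
    show "AE e in lborel. exponential_density 1 e *\<^sub>R (G e - g e) = indicator {0<..} e *\<^sub>R f e"
      using AE_lborel_singleton[of 0] by eventually_elim (simp add: ind scaleR_diff_right)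
  qed simp_all
  also have "\<dots> = (LBINT e=0..\<infinity>. f e)"
    by (simp add: interval_lebesgue_integral_0_infty)
  also have "\<dots> = 0 - (- G0)"
  proof (rule interval_integral_FTC_integrable[where F=F])
    show "(F has_vector_derivative f x) (at x)" if "0 < ereal x" "ereal x < \<infinity>" for x
      using der[of x] that unfolding F_def f_def
      by (auto intro!: derivative_eq_intros simp: scaleR_diff_right algebra_simps)
    show "isCont f x" if "0 < ereal x" "ereal x < \<infinity>" for x
      unfolding f_def using cont[of x] der[of x] that
      by (auto intro!: continuous_intros dest: has_vector_derivative_continuous)
    show "set_integrable lborel (einterval 0 \<infinity>) f"
      using si interval_lebesgue_integral_0_infty(1)[of lborel f] by (simp add: interval_lebesgue_integrable_def)
    have "((\<lambda>e. - (exp (- e) *\<^sub>R G e)) \<longlongrightarrow> - (exp (- 0) *\<^sub>R G0)) (at_right 0)"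
      by (intro tendsto_intros G0)
    then show "((F \<circ> real_of_ereal) \<longlongrightarrow> - G0) (at_right 0)"
      unfolding zero_ereal_def F_def by (simp add: ereal_tendsto_simps)
    have "((\<lambda>e. exp (- e) *\<^sub>R G e) \<longlongrightarrow> 0) at_top"
    proof (rule Lim_null_comparison)
      show "\<forall>\<^sub>F e in at_top. norm (exp (- e) *\<^sub>R G e) \<le> A * exp (- e / 2)"
        using eventually_gt_at_top[of 0]
      proof eventually_elim
        case (elim e)
        have "exp (- e) * norm (G e) \<le> exp (- e) * (A * exp (e / 2))" using bnd(1)[OF elim] by simp
        also have "\<dots> = A * exp (- e / 2)" by (simp add: exp_add[symmetric])
        finally show ?case by simp
      qed
      have "filterlim (\<lambda>e::real. e / 2) at_top at_top"
        using filterlim_tendsto_pos_mult_at_top[OF tendsto_const[of "1/2::real"] _ filterlim_ident] by simp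
      then have "filterlim (\<lambda>e::real. - e / 2) at_bot at_top"
        by (simp add: filterlim_uminus_at_bot)
      then show "((\<lambda>e. A * exp (- e / 2)) \<longlongrightarrow> 0) at_top"
        by (intro tendsto_mult_right_zero filterlim_compose[OF exp_at_bot])
    qed
    from tendsto_minus[OF this] show "((F \<circ> real_of_ereal) \<longlongrightarrow> 0) (at_left \<infinity>)"
      unfolding F_def by (simp add: ereal_tendsto_simps)
  qed simp
  finally show "(\<integral>e. G e - g e \<partial>expo) = G0" by simp
qed

text \<open>Continuity is assumed away from \<open>0\<close> only: characteristic functions of jumps oscillate there when the jump
  sizes are unbounded. The derivative is therefore obtained by integrating from an interior point.\<close>

lemma indefinite_integral_from_zero:
  fixes f :: "real \<Rightarrow> 'x::euclidean_space"
  assumes [measurable]: "f \<in> borel_measurable borel" and cont: "\<And>r. r > 0 \<Longrightarrow> isCont f r"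
    and int: "\<And>s. set_integrable lborel {0<..s} f"
  defines "I \<equiv> \<lambda>u. LBINT r:{0<..u}. f r"
  shows "u > 0 \<Longrightarrow> (I has_vector_derivative f u) (at u)"
    and "0 \<le> a \<Longrightarrow> a \<le> b \<Longrightarrow> I b - I a = (LBINT r:{a<..b}. f r)"
proof -
  have split: "I b - I a = (LBINT r:{a<..b}. f r)" if "0 \<le> a" "a \<le> b" for a b
  proof -
    have "I b = I a + (LBINT r:{a<..b}. f r)"
      unfolding I_def
      by (subst set_integral_Un[symmetric]) (use that int[of b] in \<open>auto intro: set_integrable_subset simp: ivl_disj_un\<close>)
    then show ?thesis by simp
  qed
  then show "0 \<le> a \<Longrightarrow> a \<le> b \<Longrightarrow> I b - I a = (LBINT r:{a<..b}. f r)" for a b .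
  assume u: "u > 0"
  define c where "c = u / 2"
  have c: "0 < c" "c < u" using u unfolding c_def by auto
  have "((\<lambda>x. LBINT y=c..x. f y) has_vector_derivative f u) (at u within {c..2 * u})"
    using c u by (intro interval_integral_FTC2) (auto intro!: continuous_at_imp_continuous_on cont)
  then have "((\<lambda>x. LBINT y=c..x. f y) has_vector_derivative f u) (at u within {c<..<2 * u})"
    by (rule has_vector_derivative_within_subset) auto
  then have "((\<lambda>x. LBINT y=c..x. f y) has_vector_derivative f u) (at u)"
    by (rule has_vector_derivative_within_open[THEN iffD1, rotated 2]) (use c u in auto)
  then have "((\<lambda>x. I c + (LBINT y=c..x. f y)) has_vector_derivative f u) (at u)"
    by (auto intro!: derivative_eq_intros)
  then show "(I has_vector_derivative f u) (at u)"
  proof (rule has_vector_derivative_transform_within_open)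
    show "open {c<..}" "u \<in> {c<..}" using c by auto
    show "I c + (LBINT y=c..x. f y) = I x" if "x \<in> {c<..}" for x
      using split[of c x] that c by (simp add: interval_integral_Ioc algebra_simps)
  qed
qed

section \<open>Arrival times with uniform marks\<close>

text \<open>Arrival times of a unit-rate Poisson process with independent uniform marks, in the form of the
  sequences that generate them.\<close>

locale marked_arrivals = prob_space N for N :: "'b measure" +
  fixes U E :: "nat \<Rightarrow> 'b \<Rightarrow> real"
  assumes U_indep: "indep_vars (\<lambda>_. borel) U {1..}"
    and U_distr: "\<And>i. i \<ge> 1 \<Longrightarrow> distr N borel (U i) = uniform_measure lborel {0..1}"
    and E_indep: "indep_vars (\<lambda>_. borel) E {1..}"
    and E_distr: "\<And>i. i \<ge> 1 \<Longrightarrow> distributed N lborel (E i) (exponential_density 1)"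
    and U_arrival_indep: "indep_var (PiM {1..} (\<lambda>_. borel)) (\<lambda>\<omega>. \<lambda>i\<in>{1..}. U i \<omega>)
           (PiM {1..} (\<lambda>_. borel)) (\<lambda>\<omega>. \<lambda>i\<in>{1..}. arrival E i \<omega>)"
begin

abbreviation "\<Gamma> \<equiv> arrival E"

lemma arrival_0 [simp]: "\<Gamma> 0 \<omega> = 0" and arrival_Suc: "\<Gamma> (Suc n) \<omega> = \<Gamma> n \<omega> + E (Suc n) \<omega>"
  by (auto simp: arrival_def)

lemma U_measurable: "i \<ge> 1 \<Longrightarrow> U i \<in> borel_measurable N" and E_measurable: "i \<ge> 1 \<Longrightarrow> E i \<in> borel_measurable N"
  using U_indep E_indep by (auto simp: indep_vars_def)

lemma arrival_measurable [measurable]: "\<Gamma> n \<in> borel_measurable N"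
  unfolding arrival_def[abs_def] by (intro borel_measurable_sum E_measurable) auto

text \<open>Waiting times are differences of arrival times, so the marks are independent of them as well.\<close>

lemma UE_indep: "indep_var (PiM {1..} (\<lambda>_. borel)) (\<lambda>\<omega>. \<lambda>i\<in>{1..}. U i \<omega>)
    (PiM {1..} (\<lambda>_. borel)) (\<lambda>\<omega>. \<lambda>i\<in>{1..}. E i \<omega>)"
proof -
  \<comment> \<open>The first arrival time is itself the first waiting time.\<close>
  define f :: "(nat \<Rightarrow> real) \<Rightarrow> nat \<Rightarrow> real" where "f x = (\<lambda>i\<in>{1..}. x i - (if i = 1 then 0 else x (i - 1)))" for x
  have "f \<in> measurable (PiM {1..} (\<lambda>_. borel)) (PiM {1..} (\<lambda>_. borel))"
    unfolding f_def
  proof (rule measurable_restrict)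
    fix i :: nat assume i: "i \<in> {1..}"
    then show "(\<lambda>x. x i - (if i = 1 then 0 else x (i - 1))) \<in> borel_measurable (PiM {1..} (\<lambda>_. borel :: real measure))"
      by (cases "i = 1") (auto intro!: borel_measurable_diff measurable_component_singleton)
  qed
  from indep_var_compose[OF U_arrival_indep measurable_ident this]
  have "indep_var (PiM {1..} (\<lambda>_. borel)) (\<lambda>\<omega>. \<lambda>i\<in>{1..}. U i \<omega>)
    (PiM {1..} (\<lambda>_. borel)) (f \<circ> (\<lambda>\<omega>. \<lambda>i\<in>{1..}. \<Gamma> i \<omega>))" by (simp add: comp_def)
  moreover have "f \<circ> (\<lambda>\<omega>. \<lambda>i\<in>{1..}. \<Gamma> i \<omega>) = (\<lambda>\<omega>. \<lambda>i\<in>{1..}. E i \<omega>)"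
  proof (intro ext)
    fix \<omega> i
    show "(f \<circ> (\<lambda>\<omega>. \<lambda>i\<in>{1..}. \<Gamma> i \<omega>)) \<omega> i = (\<lambda>i\<in>{1..}. E i \<omega>) i"
      by (cases i) (auto simp: f_def arrival_Suc)
  qed
  ultimately show ?thesis by simp
qed

lemma all_indep: "indep_vars (\<lambda>_. borel) (case_sum U E) ({1..} <+> {1..})"
  by (rule indep_vars_Plus[OF U_indep E_indep UE_indep])

definition past :: "nat \<Rightarrow> (nat + nat) set" where
  "past n = {1..n} <+> {1..n}"

definition past_values :: "nat \<Rightarrow> 'b \<Rightarrow> nat + nat \<Rightarrow> real" where
  "past_values n \<omega> = (\<lambda>j\<in>past n. case_sum U E j \<omega>)"

text \<open>The sigma-algebra of the first \<open>n\<close> marks and waiting times.\<close>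

definition F :: "nat \<Rightarrow> 'b measure" where
  "F n = vimage_algebra (space N) (past_values n) (PiM (past n) (\<lambda>_. borel))"

lemma past_values_measurable: "past_values n \<in> measurable N (PiM (past n) (\<lambda>_. borel))"
  unfolding past_values_def[abs_def] past_def
  by (intro measurable_restrict) (auto intro: U_measurable[unfolded One_nat_def] E_measurable[unfolded One_nat_def])

lemma space_F [simp]: "space (F n) = space N"
  by (simp add: F_def)

lemma sets_F: "sets (F n) = {past_values n -` A \<inter> space N |A. A \<in> sets (PiM (past n) (\<lambda>_. borel))}"
  unfolding F_def using past_values_measurable by (intro sets_vimage_algebra2) (auto dest: measurable_space)

lemma subalg_F: "subalgebra N (F n)"
  unfolding subalgebra_def sets_F using measurable_sets[OF past_values_measurable] by auto

lemma past_values_F: "past_values n \<in> measurable (F n) (PiM (past n) (\<lambda>_. borel))"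
  unfolding F_def using past_values_measurable
  by (intro measurable_vimage_algebra1) (auto dest: measurable_space)

lemma past_component: "j \<in> past n \<Longrightarrow> case_sum U E j \<in> borel_measurable (F n)"
  using measurable_compose[OF past_values_F measurable_component_singleton[of j "past n"]]
  by (simp add: past_values_def)

lemma U_F: "1 \<le> i \<Longrightarrow> i \<le> n \<Longrightarrow> U i \<in> borel_measurable (F n)"
  using past_component[of "Inl i" n, unfolded past_def, OF InlI[of i]] by simp

lemma E_F: "1 \<le> i \<Longrightarrow> i \<le> n \<Longrightarrow> E i \<in> borel_measurable (F n)"
  using past_component[of "Inr i" n, unfolded past_def, OF InrI[of i]] by simp

lemma arrival_F: "k \<le> n \<Longrightarrow> \<Gamma> k \<in> borel_measurable (F n)"
  unfolding arrival_def[abs_def] by (intro borel_measurable_sum E_F) auto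

lemma F_mono: "sets (F n) \<subseteq> sets (F (Suc n))"
proof
  fix A assume "A \<in> sets (F n)"
  then obtain B where B: "B \<in> sets (PiM (past n) (\<lambda>_. borel))" "A = past_values n -` B \<inter> space N"
    unfolding sets_F by auto
  have "past_values n \<in> measurable (F (Suc n)) (PiM (past n) (\<lambda>_. borel))"
    unfolding past_values_def[abs_def]
    by (intro measurable_restrict past_component) (auto simp: past_def)
  from measurable_sets[OF this B(1)] show "A \<in> sets (F (Suc n))" using B(2) by simp
qed

abbreviation new_point :: "nat \<Rightarrow> 'b \<Rightarrow> real \<times> real" where
  "new_point n \<omega> \<equiv> (U (Suc n) \<omega>, E (Suc n) \<omega>)"

lemma new_point_measurable [measurable]: "new_point n \<in> measurable N (borel \<Otimes>\<^sub>M borel)"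
  using U_measurable[of "Suc n"] E_measurable[of "Suc n"] by simp

lemma distr_E: "distr N borel (E (Suc n)) = expo"
proof -
  have "distr N borel (E (Suc n)) = distr N lborel (E (Suc n))" by (rule distr_cong) auto
  then show ?thesis using distributed_distr_eq_density[OF E_distr[of "Suc n"]] by (simp add: expo_def)
qed

lemma distr_new_point: "distr N (borel \<Otimes>\<^sub>M borel) (new_point n) = unif \<Otimes>\<^sub>M expo"
proof -
  have "indep_var borel ((\<lambda>x. x (Suc n)) \<circ> (\<lambda>\<omega>. \<lambda>i\<in>{1..}. U i \<omega>)) borel ((\<lambda>x. x (Suc n)) \<circ> (\<lambda>\<omega>. \<lambda>i\<in>{1..}. E i \<omega>))"
    by (rule indep_var_compose[OF UE_indep]) (auto intro!: measurable_component_singleton)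
  then have "indep_var borel (U (Suc n)) borel (E (Suc n))" by (simp add: comp_def)
  moreover have "distr N borel (U (Suc n)) = unif" unfolding unif_def by (rule U_distr) simp
  ultimately show ?thesis using distr_E[of n] by (auto simp: indep_var_distribution_eq)
qed

text \<open>Independence is stated for events because the past and the new point take values in different types.\<close>

lemma new_point_indep:
  assumes A: "A \<in> sets (F n)" and B: "B \<in> sets (borel \<Otimes>\<^sub>M borel)"
  shows "prob (A \<inter> (new_point n -` B \<inter> space N)) = prob A * prob (new_point n -` B \<inter> space N)"
proof -
  define new where "new = {Inl (Suc n), Inr (Suc n) :: nat + nat}"
  have ind: "indep_var (PiM (past n) (\<lambda>_. borel)) (past_values n)
      (PiM new (\<lambda>_. borel)) (\<lambda>\<omega>. \<lambda>j\<in>new. case_sum U E j \<omega>)"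
    unfolding past_values_def[abs_def]
    by (rule indep_var_restrict[OF all_indep]) (auto simp: past_def new_def)
  obtain A' where A': "A' \<in> sets (PiM (past n) (\<lambda>_. borel))" "A = past_values n -` A' \<inter> space N"
    using A unfolding sets_F by auto
  define f :: "(nat + nat \<Rightarrow> real) \<Rightarrow> real \<times> real" where "f x = (x (Inl (Suc n)), x (Inr (Suc n)))" for x
  have f: "f \<in> measurable (PiM new (\<lambda>_. borel)) (borel \<Otimes>\<^sub>M borel)"
    unfolding f_def new_def by (intro measurable_Pair measurable_component_singleton) auto
  define B' where "B' = f -` B \<inter> space (PiM new (\<lambda>_. borel :: real measure))"
  have B': "B' \<in> sets (PiM new (\<lambda>_. borel))" unfolding B'_def by (rule measurable_sets[OF f B])
  have pre: "(\<lambda>\<omega>. \<lambda>j\<in>new. case_sum U E j \<omega>) -` B' \<inter> space N = new_point n -` B \<inter> space N"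
    unfolding B'_def by (auto simp: f_def new_def space_PiM)
  have "(\<lambda>\<omega>. (past_values n \<omega>, \<lambda>j\<in>new. case_sum U E j \<omega>)) -` (A' \<times> B') \<inter> space N = A \<inter> (new_point n -` B \<inter> space N)"
    using pre A'(2) by auto
  with indep_varD[OF ind A'(1) B'] show ?thesis unfolding pre A'(2)[symmetric] by simp
qed

lemma distr_past_new_point:
  "distr N (F n \<Otimes>\<^sub>M (borel \<Otimes>\<^sub>M borel)) (\<lambda>\<omega>. (\<omega>, new_point n \<omega>)) = distr N (F n) (\<lambda>\<omega>. \<omega>) \<Otimes>\<^sub>M (unif \<Otimes>\<^sub>M expo)"
proof -
  have id[measurable]: "(\<lambda>\<omega>. \<omega>) \<in> measurable N (F n)" by (rule measurable_from_subalg[OF subalg_F[of n]]) simp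
  interpret P: prob_space "distr N (F n) (\<lambda>\<omega>. \<omega>)" by (rule prob_space_distr) simp
  interpret U: prob_space unif by (rule prob_space_unif)
  interpret X: prob_space expo by (rule prob_space_expo)
  interpret UX: pair_prob_space unif expo ..
  show ?thesis
  proof (rule pair_measure_eqI[symmetric])
    show "sigma_finite_measure (distr N (F n) (\<lambda>\<omega>. \<omega>))" "sigma_finite_measure (unif \<Otimes>\<^sub>M expo)" by unfold_locales
    show "sets (distr N (F n) (\<lambda>\<omega>. \<omega>) \<Otimes>\<^sub>M (unif \<Otimes>\<^sub>M expo)) = sets (distr N (F n \<Otimes>\<^sub>M (borel \<Otimes>\<^sub>M borel)) (\<lambda>\<omega>. (\<omega>, new_point n \<omega>)))"
      unfolding sets_distr by (intro sets_pair_measure_cong) simp_all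
    fix A B assume "A \<in> sets (distr N (F n) (\<lambda>\<omega>. \<omega>))" "B \<in> sets (unif \<Otimes>\<^sub>M expo)"
    then have A[measurable]: "A \<in> sets (F n)" and B: "B \<in> sets (borel \<Otimes>\<^sub>M borel)"
      by (auto simp: sets_pair_measure_cong[OF sets_unif sets_expo])
    note [measurable] = B
    have AN: "A \<in> sets N" using A subalg_F[of n] unfolding subalgebra_def by blast
    have "emeasure (distr N (F n) (\<lambda>\<omega>. \<omega>)) A = prob A"
      using sets.sets_into_space[OF AN] by (subst emeasure_distr) (auto simp: emeasure_eq_measure Int_absorb2)
    moreover have "emeasure (unif \<Otimes>\<^sub>M expo) B = prob (new_point n -` B \<inter> space N)"
      unfolding distr_new_point[of n, symmetric] by (subst emeasure_distr) (auto simp: emeasure_eq_measure)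
    moreover have "emeasure (distr N (F n \<Otimes>\<^sub>M (borel \<Otimes>\<^sub>M borel)) (\<lambda>\<omega>. (\<omega>, new_point n \<omega>))) (A \<times> B) =
        prob (A \<inter> (new_point n -` B \<inter> space N))"
    proof -
      have "(\<lambda>\<omega>. (\<omega>, new_point n \<omega>)) -` (A \<times> B) \<inter> space N = A \<inter> (new_point n -` B \<inter> space N)" by auto
      then show ?thesis by (subst emeasure_distr) (auto simp: emeasure_eq_measure)
    qed
    ultimately show "emeasure (distr N (F n) (\<lambda>\<omega>. \<omega>)) A * emeasure (unif \<Otimes>\<^sub>M expo) B =
        emeasure (distr N (F n \<Otimes>\<^sub>M (borel \<Otimes>\<^sub>M borel)) (\<lambda>\<omega>. (\<omega>, new_point n \<omega>))) (A \<times> B)"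
      by (simp add: new_point_indep[OF A B] ennreal_mult)
  qed
qed

text \<open>Conditioning on the past: the next mark and waiting time may be integrated out with the past frozen.\<close>

lemma one_step:
  fixes G :: "'b \<times> (real \<times> real) \<Rightarrow> 'x::{banach, second_countable_topology}"
  assumes G[measurable]: "G \<in> borel_measurable (F n \<Otimes>\<^sub>M (borel \<Otimes>\<^sub>M borel))"
    and int: "integrable N (\<lambda>\<omega>. G (\<omega>, new_point n \<omega>))"
  shows "(\<integral>\<omega>. G (\<omega>, new_point n \<omega>) \<partial>N) = (\<integral>\<omega>. (\<integral>e. (\<integral>u. G (\<omega>, (u, e)) \<partial>unif) \<partial>expo) \<partial>N)"
proof -
  have id[measurable]: "(\<lambda>\<omega>. \<omega>) \<in> measurable N (F n)" by (rule measurable_from_subalg[OF subalg_F[of n]]) simp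
  let ?P = "distr N (F n) (\<lambda>\<omega>. \<omega>)"
  interpret P: prob_space ?P by (rule prob_space_distr) simp
  interpret U: prob_space unif by (rule prob_space_unif)
  interpret X: prob_space expo by (rule prob_space_expo)
  interpret UX: pair_prob_space unif expo ..
  interpret PUX: pair_sigma_finite ?P "unif \<Otimes>\<^sub>M expo" ..
  have G'[measurable]: "G \<in> borel_measurable (?P \<Otimes>\<^sub>M (unif \<Otimes>\<^sub>M expo))"
  proof -
    have "sets (?P \<Otimes>\<^sub>M (unif \<Otimes>\<^sub>M expo)) = sets (F n \<Otimes>\<^sub>M (borel \<Otimes>\<^sub>M borel))"
      by (intro sets_pair_measure_cong) simp_all
    then show ?thesis using G by (subst measurable_cong_sets) auto
  qed
  have iG: "integrable (?P \<Otimes>\<^sub>M (unif \<Otimes>\<^sub>M expo)) G"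
    unfolding distr_past_new_point[symmetric] by (subst integrable_distr_eq) (use int in auto)
  have inner: "AE \<omega> in ?P. (\<integral>v. G (\<omega>, v) \<partial>(unif \<Otimes>\<^sub>M expo)) = (\<integral>e. (\<integral>u. G (\<omega>, (u, e)) \<partial>unif) \<partial>expo)"
    using PUX.AE_integrable_fst'[OF iG]
  proof eventually_elim
    case (elim \<omega>)
    then have "integrable (unif \<Otimes>\<^sub>M expo) (case_prod (\<lambda>u e. G (\<omega>, (u, e))))" by (simp add: case_prod_unfold)
    from UX.integral_snd[OF this] show ?case by (simp add: case_prod_unfold)
  qed
  have m1: "(\<lambda>\<omega>. \<integral>v. G (\<omega>, v) \<partial>(unif \<Otimes>\<^sub>M expo)) \<in> borel_measurable ?P"
    by measurable
  have m2: "(\<lambda>\<omega>. \<integral>e. (\<integral>u. G (\<omega>, (u, e)) \<partial>unif) \<partial>expo) \<in> borel_measurable (F n)"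
    by measurable
  have "(\<integral>\<omega>. G (\<omega>, new_point n \<omega>) \<partial>N) = (\<integral>z. G z \<partial>(?P \<Otimes>\<^sub>M (unif \<Otimes>\<^sub>M expo)))"
    unfolding distr_past_new_point[symmetric] by (subst integral_distr) auto
  also have "\<dots> = (\<integral>\<omega>. (\<integral>v. G (\<omega>, v) \<partial>(unif \<Otimes>\<^sub>M expo)) \<partial>?P)"
    by (rule PUX.integral_fst'[OF iG, symmetric])
  also have "\<dots> = (\<integral>\<omega>. (\<integral>e. (\<integral>u. G (\<omega>, (u, e)) \<partial>unif) \<partial>expo) \<partial>?P)"
    by (rule integral_cong_AE[OF m1 _ inner]) (use m2 in simp)
  also have "\<dots> = (\<integral>\<omega>. (\<integral>e. (\<integral>u. G (\<omega>, (u, e)) \<partial>unif) \<partial>expo) \<partial>N)"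
    by (rule integral_distr[OF id m2])
  finally show ?thesis .
qed

lemma AE_E_nonneg: "AE \<omega> in N. \<forall>n. 0 \<le> E (Suc n) \<omega>"
  unfolding AE_all_countable
proof
  fix n
  have "AE e in distr N borel (E (Suc n)). 0 \<le> e" unfolding distr_E by (rule AE_expo_nonneg)
  then show "AE \<omega> in N. 0 \<le> E (Suc n) \<omega>" by (subst (asm) AE_distr_iff) (auto intro: E_measurable[unfolded One_nat_def])
qed

lemma AE_arrival: "AE \<omega> in N. \<forall>n. 0 \<le> \<Gamma> n \<omega> \<and> \<Gamma> n \<omega> \<le> \<Gamma> (Suc n) \<omega>"
  using AE_E_nonneg
proof eventually_elim
  case (elim \<omega>)
  have "0 \<le> \<Gamma> n \<omega>" for n by (induction n) (use elim in \<open>auto simp: arrival_Suc intro: add_nonneg_nonneg\<close>)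
  then show ?case using elim by (simp add: arrival_Suc)
qed

lemma expectation_exp_arrival:
  "integrable N (\<lambda>\<omega>. exp (- \<Gamma> n \<omega>))" "(\<integral>\<omega>. exp (- \<Gamma> n \<omega>) \<partial>N) = (1/2) ^ n"
proof -
  show int: "integrable N (\<lambda>\<omega>. exp (- \<Gamma> n \<omega>))" for n
  proof (rule integrable_const_bound[of _ 1])
    show "AE \<omega> in N. norm (exp (- \<Gamma> n \<omega>)) \<le> 1" using AE_arrival by eventually_elim auto
  qed simp
  interpret U: prob_space unif by (rule prob_space_unif)
  have half: "(\<integral>e. exp (- e) \<partial>expo) = 1 / 2"
  proof -
    \<comment> \<open>\<open>G e = exp (- e) / 2\<close> solves \<open>G - G' = exp (- e)\<close>.\<close>
    have "(\<integral>e. exp (- e) / 2 - (- exp (- e) / 2) \<partial>expo) = exp (- 0) / 2"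
    proof (rule integral_expo_by_parts(3)[where A=1])
      have le: "\<bar>exp (- e) / 2\<bar> \<le> 1 * exp (e / 2)" if "e > 0" for e :: real
      proof -
        have "exp (- e) \<le> exp (e / 2)" using that by simp
        then show ?thesis using exp_gt_zero[of "- e"] by linarith
      qed
      show "norm (exp (- e) / 2) \<le> 1 * exp (e / 2)" "norm (- exp (- e) / 2) \<le> 1 * exp (e / 2)" if "e > 0" for e :: real
        using le[OF that] by simp_all
      show "((\<lambda>e. exp (- e) / 2) \<longlongrightarrow> exp (- 0) / 2) (at_right (0::real))" by (intro tendsto_intros) simp
      show "((\<lambda>e. exp (- e) / 2) has_vector_derivative - exp (- e) / 2) (at e)" for e :: real
        unfolding has_real_derivative_iff_has_vector_derivative[symmetric]
        by (auto intro!: derivative_eq_intros)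
      show "isCont (\<lambda>e. - exp (- e) / 2) e" for e :: real by (intro continuous_intros) simp
    qed simp_all
    then show ?thesis by simp
  qed
  show "(\<integral>\<omega>. exp (- \<Gamma> n \<omega>) \<partial>N) = (1/2) ^ n"
  proof (induction n)
    case 0
    then show ?case by (simp add: prob_space)
  next
    case (Suc n)
    have [measurable]: "\<Gamma> n \<in> borel_measurable (F n)" by (rule arrival_F) simp
    have "(\<integral>\<omega>. exp (- \<Gamma> (Suc n) \<omega>) \<partial>N) = (\<integral>\<omega>. (\<integral>e. (\<integral>u. exp (- \<Gamma> n \<omega> - e) \<partial>unif) \<partial>expo) \<partial>N)"
      using one_step[of "\<lambda>(\<omega>, u, e). exp (- \<Gamma> n \<omega> - e)" n] int[of "Suc n"]
      by (simp add: arrival_Suc)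
    also have "\<dots> = (\<integral>\<omega>. exp (- \<Gamma> n \<omega>) * (1 / 2) \<partial>N)"
    proof (rule Bochner_Integration.integral_cong[OF refl])
      fix \<omega>
      have "exp (- \<Gamma> n \<omega> - e) = exp (- \<Gamma> n \<omega>) * exp (- e)" for e
        using exp_add[of "- \<Gamma> n \<omega>" "- e"] by simp
      then show "(\<integral>e. (\<integral>u. exp (- \<Gamma> n \<omega> - e) \<partial>unif) \<partial>expo) = exp (- \<Gamma> n \<omega>) * (1 / 2)"
        using U.prob_space half by simp
    qed
    finally show ?case using Suc by simp
  qed
qed

lemma summable_exp_half: "summable (\<lambda>n. exp (real n / 2) * (1/2) ^ n)"
proof -
  have "exp (1/2 :: real) < 2"
    using exp_bound[of "1/2::real"] by (simp add: power2_eq_square)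
  then have "summable (\<lambda>n. (exp (1/2) / 2 :: real) ^ n)" by (intro summable_geometric) simp
  moreover have "(exp (1/2) / 2 :: real) ^ n = exp (real n / 2) * (1/2) ^ n" for n
    by (simp add: power_divide exp_of_nat_mult[symmetric] field_simps)
  ultimately show ?thesis by simp
qed

text \<open>Since \<open>exp (1/2) < 2\<close>, the expectations of \<open>exp (n/2 - \<Gamma> n)\<close> are summable, so these variables tend
  to \<open>0\<close> almost surely; when such a variable is below \<open>1\<close>, the claimed inequality holds.\<close>

lemma AE_arrival_gt_half: "AE \<omega> in N. \<forall>\<^sub>F n in sequentially. real n / 2 < \<Gamma> n \<omega>"
proof -
  have "(\<integral>\<^sup>+\<omega>. (\<Sum>n. ennreal (exp (real n / 2) * exp (- \<Gamma> n \<omega>))) \<partial>N) = (\<Sum>n. ennreal (exp (real n / 2) * (1/2) ^ n))"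
    using expectation_exp_arrival
    by (subst nn_integral_suminf) (auto simp: nn_integral_eq_integral)
  also have "\<dots> < \<infinity>"
    using summable_exp_half by (subst suminf_ennreal2) auto
  finally have "AE \<omega> in N. (\<Sum>n. ennreal (exp (real n / 2) * exp (- \<Gamma> n \<omega>))) \<noteq> \<infinity>"
    by (intro nn_integral_PInf_AE) auto
  then show ?thesis
  proof eventually_elim
    case (elim \<omega>)
    then have "summable (\<lambda>n. exp (real n / 2) * exp (- \<Gamma> n \<omega>))"
      by (intro summable_suminf_not_top) auto
    then have "(\<lambda>n. exp (real n / 2) * exp (- \<Gamma> n \<omega>)) \<longlonglongrightarrow> 0" by (rule summable_LIMSEQ_zero)
    then have "\<forall>\<^sub>F n in sequentially. exp (real n / 2) * exp (- \<Gamma> n \<omega>) < 1" by (rule order_tendstoD) simp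
    then show ?case by eventually_elim (simp add: exp_add[symmetric])
  qed
qed

lemma AE_arrival_at_top: "AE \<omega> in N. filterlim (\<lambda>n. \<Gamma> n \<omega>) at_top sequentially"
  using AE_arrival_gt_half
proof eventually_elim
  case (elim \<omega>)
  have "filterlim (\<lambda>n. (1/2) * real n) at_top sequentially"
    by (rule filterlim_tendsto_pos_mult_at_top[OF tendsto_const _ filterlim_real_sequentially]) simp
  then show ?case
    by (rule filterlim_at_top_mono) (use elim in \<open>auto elim: eventually_mono\<close>)
qed

end

section \<open>The characteristic function of a compensated shot noise\<close>

lemma set_integral_Ioc_bounds:
  fixes f :: "real \<Rightarrow> real"
  assumes int: "set_integrable lborel {a<..b} f" and ab: "a \<le> b"
  shows "(\<And>r. a < r \<Longrightarrow> r \<le> b \<Longrightarrow> f r \<le> K) \<Longrightarrow> (LBINT r:{a<..b}. f r) \<le> K * (b - a)"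
    and "(\<And>r. a < r \<Longrightarrow> r \<le> b \<Longrightarrow> K \<le> f r) \<Longrightarrow> K * (b - a) \<le> (LBINT r:{a<..b}. f r)"
proof -
  have c: "set_integrable lborel {a<..b} (\<lambda>_. K)"
    unfolding set_integrable_def using ab by (intro integrable_scaleR_left integrable_real_indicator) auto
  have v: "(LBINT r:{a<..b}. K) = K * (b - a)"
    unfolding set_lebesgue_integral_def using ab by simp
  show "(\<And>r. a < r \<Longrightarrow> r \<le> b \<Longrightarrow> f r \<le> K) \<Longrightarrow> (LBINT r:{a<..b}. f r) \<le> K * (b - a)"
    unfolding v[symmetric] by (intro set_integral_mono int c) auto
  show "(\<And>r. a < r \<Longrightarrow> r \<le> b \<Longrightarrow> K \<le> f r) \<Longrightarrow> K * (b - a) \<le> (LBINT r:{a<..b}. f r)"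
    unfolding v[symmetric] by (intro set_integral_mono int c) auto
qed

lemma norm_set_integral_Ioc_le:
  fixes f :: "real \<Rightarrow> 'x::{banach, second_countable_topology}"
  assumes int: "set_integrable lborel {a<..b} f" and ab: "a \<le> b" and K: "\<And>r. a < r \<Longrightarrow> r \<le> b \<Longrightarrow> norm (f r) \<le> K"
  shows "norm (LBINT r:{a<..b}. f r) \<le> K * (b - a)"
proof -
  have "norm (LBINT r:{a<..b}. f r) \<le> (LBINT r:{a<..b}. norm (f r))"
    by (rule set_integral_norm_bound[OF int])
  also have "\<dots> \<le> K * (b - a)"
    by (rule set_integral_Ioc_bounds(1)[OF set_integrable_norm[OF int] ab K])
  finally show ?thesis .
qed

lemma set_integral_Ioc_tendsto:
  fixes f :: "real \<Rightarrow> 'x::{banach, second_countable_topology}"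
  assumes int: "set_integrable lborel {0<..} f" and x: "filterlim x at_top sequentially"
  shows "(\<lambda>n. LBINT r:{0<..x n}. f r) \<longlonglongrightarrow> (LBINT r:{0<..}. f r)"
proof -
  have m: "(\<lambda>r. indicator {0<..} r *\<^sub>R f r) \<in> borel_measurable lborel"
    using int unfolding set_integrable_def by auto
  have e: "indicator {0<..s} r *\<^sub>R f r = indicator {..s} r *\<^sub>R (indicator {0<..} r *\<^sub>R f r)" for s r
    by (auto simp: indicator_def)
  show ?thesis
    unfolding set_lebesgue_integral_def e
  proof (rule integral_dominated_convergence[where w="\<lambda>r. norm (indicator {0<..} r *\<^sub>R f r)"])
    show "(\<lambda>r. indicator {..x n} r *\<^sub>R (indicator {0<..} r *\<^sub>R f r)) \<in> borel_measurable lborel" for n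
      by (intro borel_measurable_scaleR m borel_measurable_indicator) simp
    show "AE r in lborel. (\<lambda>n. indicator {..x n} r *\<^sub>R (indicator {0<..} r *\<^sub>R f r)) \<longlonglongrightarrow> indicator {0<..} r *\<^sub>R f r"
    proof (intro AE_I2 tendsto_eventually)
      fix r
      have "\<forall>\<^sub>F n in sequentially. r \<le> x n" using x by (simp add: filterlim_at_top)
      then show "\<forall>\<^sub>F n in sequentially. indicator {..x n} r *\<^sub>R (indicator {0<..} r *\<^sub>R f r) = indicator {0<..} r *\<^sub>R f r"
        by eventually_elim simp
    qed
    show "integrable lborel (\<lambda>r. norm (indicator {0<..} r *\<^sub>R f r))"
      using int unfolding set_integrable_def by (rule integrable_norm)
    show "AE r in lborel. norm (indicator {..x n} r *\<^sub>R (indicator {0<..} r *\<^sub>R f r)) \<le> norm (indicator {0<..} r *\<^sub>R f r)" for n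
      by (intro AE_I2) (auto simp: indicator_def)
  qed (rule m)
qed

lemma borel_measurable_indefinite_integral:
  fixes f :: "real \<Rightarrow> 'x::{banach, second_countable_topology}"
  assumes [measurable]: "f \<in> borel_measurable borel"
  shows "(\<lambda>u. LBINT r:{0<..u}. f r) \<in> borel_measurable borel"
proof -
  have e: "indicator {0<..u} r = (if 0 < r \<and> r \<le> u then 1 else 0 :: real)" for u r :: real
    by (auto simp: indicator_def)
  show ?thesis unfolding set_lebesgue_integral_def e by measurable
qed

context marked_arrivals
begin

text \<open>A Campbell formula obtained from a martingale. With \<open>\<psi> r = E exp (i \<phi> r q(U))\<close> and \<open>S n\<close> the
  partial sums, the variables \<open>L n = exp (i S n + \<Lambda> (\<Gamma> n))\<close>, where \<open>\<Lambda>\<close> is the integral of \<open>1 - \<psi>\<close>, form a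
  martingale with mean one: integrating out the next mark produces \<open>\<psi> exp \<Lambda>\<close>, and this is \<open>G - G'\<close>
  for \<open>G = exp \<Lambda>\<close>. The integral \<open>\<Lambda>\<close> differs by a purely imaginary term from a convergent one, so
  \<open>L\<close> is bounded and the mean passes to the limit.\<close>

theorem char_of_compensated_limit:
  fixes \<phi> q :: "real \<Rightarrow> real" and b :: real
  assumes \<phi>[measurable]: "\<phi> \<in> borel_measurable borel" and \<phi>_cont: "\<And>r. r > 0 \<Longrightarrow> isCont \<phi> r"
    and q[measurable]: "q \<in> borel_measurable borel"
    and int1: "set_integrable lborel {0<..} (\<lambda>r. (CLINT u|unif. iexp (\<phi> r * q u)) - 1 - \<i> * of_real (b * \<phi> r))"
    and int2: "\<And>s. set_integrable lborel {0<..s} (\<lambda>r. b * \<phi> r)"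
    and lim: "AE \<omega> in N. (\<lambda>n. (\<Sum>j<n. \<phi> (\<Gamma> (Suc j) \<omega>) * q (U (Suc j) \<omega>)) - (LBINT r:{0<..\<Gamma> n \<omega>}. b * \<phi> r)) \<longlonglongrightarrow> Y \<omega>"
    and Y[measurable]: "Y \<in> borel_measurable N"
  shows "(CLINT \<omega>|N. iexp (Y \<omega>)) = exp (CLBINT r:{0<..}. (CLINT u|unif. iexp (\<phi> r * q u)) - 1 - \<i> * of_real (b * \<phi> r))"
proof -
  interpret U: prob_space unif by (rule prob_space_unif)
  interpret X: prob_space expo by (rule prob_space_expo)
  define \<psi> where "\<psi> r = (CLINT u|unif. iexp (\<phi> r * q u))" for r
  interpret Q: real_distribution "distr unif borel q" by (rule U.real_distribution_distr) simp
  have \<psi>_char: "\<psi> r = char (distr unif borel q) (\<phi> r)" for r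
    unfolding \<psi>_def char_def by (subst integral_distr) auto
  have \<psi>_le: "norm (\<psi> r) \<le> 1" for r unfolding \<psi>_char by (rule Q.cmod_char_le_1)
  have [measurable]: "\<psi> \<in> borel_measurable borel" unfolding \<psi>_char[abs_def] by measurable
  have \<psi>_cont: "isCont \<psi> r" if "r > 0" for r
    unfolding \<psi>_char[abs_def] by (rule isCont_o2[OF \<phi>_cont[OF that] Q.isCont_char])
  define f where "f r = 1 - \<psi> r" for r
  define k where "k r = \<psi> r - 1 - \<i> * of_real (b * \<phi> r)" for r
  have fK: "norm (f r) \<le> 2" for r
    using norm_triangle_ineq4[of 1 "\<psi> r"] \<psi>_le[of r] unfolding f_def by simp
  have [measurable]: "f \<in> borel_measurable borel" unfolding f_def by measurable
  have f_cont: "isCont f r" if "r > 0" for r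
    unfolding f_def[abs_def] using \<psi>_cont[OF that] by (intro continuous_intros)
  have f_int: "set_integrable lborel {0<..s} f" for s
    unfolding set_integrable_def
  proof (rule Bochner_Integration.integrable_bound[of _ "\<lambda>r. 2 * indicator {0<..s} r :: real"])
    have "emeasure lborel {0<..s} < \<infinity>" by (cases "0 \<le> s") auto
    then show "integrable lborel (\<lambda>r. 2 * indicator {0<..s} r :: real)"
      by (intro integrable_mult_right integrable_real_indicator) auto
  qed (use fK in \<open>auto split: split_indicator\<close>)
  define \<Lambda> where "\<Lambda> u = (CLBINT r:{0<..u}. f r)" for u
  define R where "R u = (CLBINT r:{0<..u}. k r)" for u
  have [measurable]: "\<Lambda> \<in> borel_measurable borel"
    unfolding \<Lambda>_def by (rule borel_measurable_indefinite_integral) simp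
  have k_int: "set_integrable lborel {0<..} k" using int1 unfolding k_def \<psi>_def .
  have k_int': "set_integrable lborel {0<..u} k" for u by (rule set_integrable_subset[OF k_int]) auto
  \<comment> \<open>The possibly divergent part of \<open>\<Lambda>\<close> is imaginary, so it does not affect the modulus of \<open>exp \<Lambda>\<close>.\<close>
  have \<Lambda>R: "\<Lambda> u = - R u - \<i> * of_real (LBINT r:{0<..u}. b * \<phi> r)" for u
  proof -
    have "R u + \<Lambda> u = (CLBINT r:{0<..u}. k r + f r)"
      unfolding R_def \<Lambda>_def by (rule set_integral_add(2)[symmetric, OF k_int' f_int])
    also have "\<dots> = (CLBINT r:{0<..u}. (- \<i>) * of_real (b * \<phi> r))" by (simp add: k_def f_def)
    also have "\<dots> = - \<i> * of_real (LBINT r:{0<..u}. b * \<phi> r)"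
      unfolding set_integral_mult_right set_integral_complex_of_real ..
    finally show ?thesis by (simp add: algebra_simps eq_neg_iff_add_eq_0)
  qed
  define \<kappa> where "\<kappa> = (LBINT r:{0<..}. norm (k r))"
  have R_le: "norm (R u) \<le> \<kappa>" for u
  proof -
    have "norm (R u) \<le> (LBINT r:{0<..u}. norm (k r))" unfolding R_def by (rule set_integral_norm_bound[OF k_int'])
    also have "\<dots> \<le> \<kappa>"
      using set_integrable_norm[OF k_int] set_integrable_norm[OF k_int']
      unfolding \<kappa>_def set_lebesgue_integral_def set_integrable_def
      by (intro integral_mono) (auto split: split_indicator)
    finally show ?thesis .
  qed
  have exp_le: "norm (exp (\<Lambda> u)) \<le> exp \<kappa>" for u
    using R_le[of u] abs_Re_le_cmod[of "R u"] unfolding \<Lambda>R by simp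
  define S where "S n \<omega> = (\<Sum>j<n. \<phi> (\<Gamma> (Suc j) \<omega>) * q (U (Suc j) \<omega>))" for n \<omega>
  define L where "L n \<omega> = iexp (S n \<omega>) * exp (\<Lambda> (\<Gamma> n \<omega>))" for n \<omega>
  have S_F: "S n \<in> borel_measurable (F n)" for n
    unfolding S_def[abs_def]
    by (intro borel_measurable_sum borel_measurable_times measurable_compose[OF arrival_F \<phi>] measurable_compose[OF U_F q]) auto
  have L_F: "L n \<in> borel_measurable (F n)" for n
  proof -
    have [measurable]: "S n \<in> borel_measurable (F n)" "\<Gamma> n \<in> borel_measurable (F n)"
      using S_F arrival_F by auto
    show ?thesis unfolding L_def[abs_def] by measurable
  qed
  then have L_N[measurable]: "L n \<in> borel_measurable N" for n
    using measurable_from_subalg[OF subalg_F] by blast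
  have L_le: "norm (L n \<omega>) \<le> exp \<kappa>" for n \<omega>
    unfolding L_def using exp_le by (simp add: norm_mult)
  have L_int: "integrable N (L n)" for n
    by (rule integrable_const_bound[of _ "exp \<kappa>"]) (use L_le in auto)
  \<comment> \<open>The one-step identity: \<open>\<psi> = 1 - \<Lambda>'\<close>, so the integrand is \<open>exp \<Lambda>\<close> minus its own derivative.\<close>
  have key: "(\<integral>e. \<psi> (r + e) * exp (\<Lambda> (r + e)) \<partial>expo) = exp (\<Lambda> r)" if r: "r \<ge> 0" for r
  proof -
    have "(\<integral>e. exp (\<Lambda> (r + e)) - f (r + e) * exp (\<Lambda> (r + e)) \<partial>expo) = exp (\<Lambda> r)"
    proof (rule integral_expo_by_parts(3)[where A="2 * exp \<kappa>"])
      fix e :: real assume e: "e > 0"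
      have dL: "(\<Lambda> has_vector_derivative f x) (at x)" if "x > 0" for x
        unfolding \<Lambda>_def[abs_def]
        by (rule indefinite_integral_from_zero(1)) (use that f_int f_cont in auto)
      have dL': "((\<lambda>e. \<Lambda> (r + e)) has_vector_derivative f (r + e)) (at e)"
      proof -
        have "((\<lambda>e. r + e) has_vector_derivative 1) (at e)"
          unfolding has_real_derivative_iff_has_vector_derivative[symmetric] by (auto intro!: derivative_eq_intros)
        then show ?thesis
          using vector_diff_chain_at[of "\<lambda>e. r + e" 1 e \<Lambda> "f (r + e)"] dL[of "r + e"] r e by (simp add: o_def)
      qed
      then show "((\<lambda>e. exp (\<Lambda> (r + e))) has_vector_derivative f (r + e) * exp (\<Lambda> (r + e))) (at e)"
        using field_vector_diff_chain_at[OF dL' DERIV_exp] by (simp add: o_def mult.commute)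
      have fc: "isCont f (r + e)" using r e by (intro f_cont) simp
      have "isCont (\<lambda>e. f (r + e)) e" by (rule isCont_o2[where f="\<lambda>e. r + e"]) (use fc in \<open>auto intro!: continuous_intros\<close>)
      moreover have "isCont (\<lambda>e. \<Lambda> (r + e)) e" using dL' by (rule has_vector_derivative_continuous)
      ultimately show "isCont (\<lambda>e. f (r + e) * exp (\<Lambda> (r + e))) e" by (intro continuous_intros)
      have e1: "1 \<le> exp (e / 2)" using e by simp
      have "norm (exp (\<Lambda> (r + e))) \<le> exp \<kappa>" by (rule exp_le)
      also have "\<dots> \<le> 2 * exp \<kappa> * exp (e / 2)"
      proof -
        have "1 \<le> 2 * exp (e / 2)" using e1 by linarith
        then show ?thesis by simp
      qed
      finally show "norm (exp (\<Lambda> (r + e))) \<le> 2 * exp \<kappa> * exp (e / 2)" .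
      have "norm (f (r + e) * exp (\<Lambda> (r + e))) \<le> 2 * exp \<kappa>"
        unfolding norm_mult by (intro mult_mono fK exp_le) auto
      also have "\<dots> \<le> 2 * exp \<kappa> * exp (e / 2)"
        using mult_left_mono[OF e1, of "2 * exp \<kappa>"] by simp
      finally show "norm (f (r + e) * exp (\<Lambda> (r + e))) \<le> 2 * exp \<kappa> * exp (e / 2)" .
    next
      have "((\<lambda>e. \<Lambda> (r + e)) \<longlongrightarrow> \<Lambda> r) (at_right 0)"
      proof (rule LIM_zero_cancel)
        show "((\<lambda>e. \<Lambda> (r + e) - \<Lambda> r) \<longlongrightarrow> 0) (at_right 0)"
        proof (rule Lim_null_comparison)
          show "\<forall>\<^sub>F e in at_right 0. norm (\<Lambda> (r + e) - \<Lambda> r) \<le> 2 * e"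
            using eventually_at_right_less[of 0]
          proof eventually_elim
            case (elim e)
            have "\<Lambda> (r + e) - \<Lambda> r = (CLBINT s:{r<..r + e}. f s)"
              unfolding \<Lambda>_def by (rule indefinite_integral_from_zero(2))
                (use r elim f_int f_cont in auto)
            also have "norm \<dots> \<le> 2 * (r + e - r)"
              by (rule norm_set_integral_Ioc_le) (use elim fK r in \<open>auto intro!: set_integrable_subset[OF f_int[of "r + e"]]\<close>)
            finally show ?case by simp
          qed
          have "((\<lambda>e. 2 * e) \<longlongrightarrow> 2 * 0) (at_right (0::real))" by (intro tendsto_intros)
          then show "((\<lambda>e. 2 * e) \<longlongrightarrow> 0) (at_right (0::real))" by simp
        qed
      qed
      then show "((\<lambda>e. exp (\<Lambda> (r + e))) \<longlongrightarrow> exp (\<Lambda> r)) (at_right 0)" by (rule tendsto_exp)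
    qed simp_all
    then show ?thesis by (simp add: f_def algebra_simps)
  qed
  have EL: "(CLINT \<omega>|N. L n \<omega>) = 1" for n
  proof (induction n)
    case 0
    then show ?case by (simp add: L_def S_def \<Lambda>_def set_lebesgue_integral_def prob_space)
  next
    case (Suc n)
    have [measurable]: "S n \<in> borel_measurable (F n)" "\<Gamma> n \<in> borel_measurable (F n)"
      using S_F arrival_F by auto
    define G where "G = (\<lambda>(\<omega>, u, e). iexp (S n \<omega> + \<phi> (\<Gamma> n \<omega> + e) * q u) * exp (\<Lambda> (\<Gamma> n \<omega> + e)))"
    have LG: "L (Suc n) \<omega> = G (\<omega>, new_point n \<omega>)" for \<omega>
      by (simp add: L_def G_def S_def arrival_Suc)
    have "(CLINT \<omega>|N. L (Suc n) \<omega>) = (CLINT \<omega>|N. (\<integral>e. (\<integral>u. G (\<omega>, (u, e)) \<partial>unif) \<partial>expo))"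
      unfolding LG by (rule one_step) (use L_int[of "Suc n", unfolded LG[abs_def]] in \<open>simp_all add: G_def\<close>)
    also have "\<dots> = (CLINT \<omega>|N. L n \<omega>)"
    proof (rule integral_cong_AE)
      have [measurable]: "G \<in> borel_measurable (F n \<Otimes>\<^sub>M (borel \<Otimes>\<^sub>M borel))" unfolding G_def by measurable
      have "(\<lambda>\<omega>. \<integral>e. (\<integral>u. G (\<omega>, (u, e)) \<partial>unif) \<partial>expo) \<in> borel_measurable (F n)" by measurable
      then show "(\<lambda>\<omega>. \<integral>e. (\<integral>u. G (\<omega>, (u, e)) \<partial>unif) \<partial>expo) \<in> borel_measurable N"
        using measurable_from_subalg[OF subalg_F] by blast
      show "AE \<omega> in N. (\<integral>e. (\<integral>u. G (\<omega>, (u, e)) \<partial>unif) \<partial>expo) = L n \<omega>"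
        using AE_arrival
      proof eventually_elim
        case (elim \<omega>)
        have "(\<integral>u. G (\<omega>, (u, e)) \<partial>unif) = iexp (S n \<omega>) * (\<psi> (\<Gamma> n \<omega> + e) * exp (\<Lambda> (\<Gamma> n \<omega> + e)))" for e
        proof -
          have "(\<integral>u. G (\<omega>, (u, e)) \<partial>unif) =
            (\<integral>u. iexp (S n \<omega>) * exp (\<Lambda> (\<Gamma> n \<omega> + e)) * iexp (\<phi> (\<Gamma> n \<omega> + e) * q u) \<partial>unif)"
            by (intro Bochner_Integration.integral_cong refl) (simp add: G_def distrib_left exp_add)
          also have "\<dots> = iexp (S n \<omega>) * exp (\<Lambda> (\<Gamma> n \<omega> + e)) * \<psi> (\<Gamma> n \<omega> + e)"
            unfolding \<psi>_def by (rule integral_mult_right_zero)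
          finally show ?thesis by (simp add: mult_ac)
        qed
        then have "(\<integral>e. (\<integral>u. G (\<omega>, (u, e)) \<partial>unif) \<partial>expo) = iexp (S n \<omega>) * (\<integral>e. \<psi> (\<Gamma> n \<omega> + e) * exp (\<Lambda> (\<Gamma> n \<omega> + e)) \<partial>expo)"
          by (simp only: integral_mult_right_zero)
        also have "\<dots> = L n \<omega>" using key[of "\<Gamma> n \<omega>"] elim by (simp add: L_def)
        finally show ?case .
      qed
    qed simp
    finally show ?case using Suc by simp
  qed
  define Rinf where "Rinf = (CLBINT r:{0<..}. k r)"
  have "(\<lambda>n. CLINT \<omega>|N. L n \<omega>) \<longlonglongrightarrow> (CLINT \<omega>|N. iexp (Y \<omega>) * exp (- Rinf))"
  proof (rule integral_dominated_convergence[where w="\<lambda>_. exp \<kappa>"])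
    show "AE \<omega> in N. (\<lambda>n. L n \<omega>) \<longlonglongrightarrow> iexp (Y \<omega>) * exp (- Rinf)"
      using lim AE_arrival_at_top
    proof eventually_elim
      case (elim \<omega>)
      have "(\<lambda>n. R (\<Gamma> n \<omega>)) \<longlonglongrightarrow> Rinf"
        unfolding R_def Rinf_def by (rule set_integral_Ioc_tendsto[OF k_int elim(2)])
      moreover have "L n \<omega> = iexp (S n \<omega> - (LBINT r:{0<..\<Gamma> n \<omega>}. b * \<phi> r)) * exp (- R (\<Gamma> n \<omega>))" for n
        unfolding L_def \<Lambda>R by (simp add: exp_add[symmetric] algebra_simps)
      moreover have "(\<lambda>n. S n \<omega> - (LBINT r:{0<..\<Gamma> n \<omega>}. b * \<phi> r)) \<longlonglongrightarrow> Y \<omega>"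
        using elim(1) unfolding S_def .
      ultimately show ?case
        by (simp only:) (intro tendsto_mult tendsto_exp tendsto_of_real tendsto_const tendsto_minus)
    qed
  qed (use L_le in auto)
  then have "(CLINT \<omega>|N. iexp (Y \<omega>) * exp (- Rinf)) = 1" unfolding EL by (simp add: LIMSEQ_const_iff)
  then have "(CLINT \<omega>|N. iexp (Y \<omega>)) * exp (- Rinf) = 1" by simp
  then have "(CLINT \<omega>|N. iexp (Y \<omega>)) = exp Rinf" by (simp add: exp_minus field_simps)
  then show ?thesis unfolding Rinf_def k_def \<psi>_def .
qed

end

section \<open>Convergence of shot noise with decreasing jump sizes\<close>

lemma summable_half_samples:
  fixes h :: "real \<Rightarrow> real"
  assumes int: "set_integrable lborel {0<..} h" and h0: "\<And>r. 0 \<le> h r" and dec: "\<And>r s. 0 \<le> r \<Longrightarrow> r \<le> s \<Longrightarrow> h s \<le> h r"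
  shows "summable (\<lambda>n. h (real n / 2))"
proof -
  have int': "set_integrable lborel {a<..b} h" if "0 \<le> a" for a b
    using int by (rule set_integrable_subset) (use that in auto)
  have le: "(\<Sum>i<n. h (real (Suc i) / 2) * (1/2)) \<le> (LBINT r:{0<..real n / 2}. h r)" for n
  proof (induction n)
    case 0
    then show ?case by (simp add: set_lebesgue_integral_def)
  next
    case (Suc n)
    have a: "h (real (Suc n) / 2) * (real (Suc n) / 2 - real n / 2) \<le> (LBINT r:{real n / 2<..real (Suc n) / 2}. h r)"
      by (rule set_integral_Ioc_bounds(2)[OF int'])
        (auto intro!: dec divide_right_mono intro: order_trans[OF _ less_imp_le])
    have b: "real (Suc n) / 2 - real n / 2 = 1 / 2" by (simp add: field_simps)
    have "(LBINT r:{0<..real (Suc n) / 2}. h r) = (LBINT r:{0<..real n / 2}. h r) + (LBINT r:{real n / 2<..real (Suc n) / 2}. h r)"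
      by (subst set_integral_Un[symmetric]) (auto intro!: int' arg_cong[where f="\<lambda>S. set_lebesgue_integral lborel S h"])
    then show ?case using Suc a unfolding sum.lessThan_Suc b by linarith
  qed
  have "summable (\<lambda>i. h (real (Suc i) / 2) * (1/2))"
  proof (rule summableI_nonneg_bounded)
    show "(\<Sum>i<n. h (real (Suc i) / 2) * (1/2)) \<le> (LBINT r:{0<..}. h r)" for n
    proof (rule order_trans[OF le])
      show "(LBINT r:{0<..real n / 2}. h r) \<le> (LBINT r:{0<..}. h r)"
        using int int'[of 0 "real n / 2"] h0
        unfolding set_lebesgue_integral_def set_integrable_def
        by (intro integral_mono) (auto split: split_indicator)
    qed
  qed (use h0 in simp)
  then have "summable (\<lambda>i. h (real (Suc i) / 2) * (1/2) * 2)" by (rule summable_mult2)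
  then have "summable (\<lambda>i. h (real (Suc i) / 2))" by simp
  then show ?thesis by (subst summable_Suc_iff[symmetric])
qed

lemma expo_moments:
  "integrable expo (\<lambda>e. (1 + e)\<^sup>2)" "(\<integral>e. (1 + e)\<^sup>2 \<partial>expo) = 5" "(\<integral>e. e - 1 \<partial>expo) = 0"
proof -
  \<comment> \<open>The polynomial \<open>G e = e\<^sup>2 + 4 e + 5\<close> solves \<open>G - G' = (1 + e)\<^sup>2\<close>.\<close>
  have q: "exp (e / 2) \<ge> 1 + e / 2 + (e / 2)\<^sup>2 / 2" if "e > 0" for e :: real
    using exp_lower_Taylor_quadratic[of "e / 2"] that by simp
  have le: "e\<^sup>2 + 4 * e + 5 \<le> 10 * exp (e / 2)" "2 * e + 4 \<le> 10 * exp (e / 2)" if "e > 0" for e :: real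
    using q[OF that] that by (simp_all add: power2_eq_square field_simps) (use that in \<open>smt (verit) mult_pos_pos\<close>)+
  note P = integral_expo_by_parts[of "\<lambda>e. e\<^sup>2 + 4 * e + 5" "\<lambda>e. 2 * e + 4" "5" 10]
  have prem: "((\<lambda>e. e\<^sup>2 + 4 * e + 5) has_vector_derivative 2 * e + 4) (at e)" "isCont (\<lambda>e. 2 * e + 4) e" for e :: real
    unfolding has_real_derivative_iff_has_vector_derivative[symmetric]
    by (auto intro!: derivative_eq_intros continuous_intros)
  have "((\<lambda>e::real. e\<^sup>2 + 4 * e + 5) \<longlongrightarrow> 0\<^sup>2 + 4 * 0 + 5) (at_right 0)" by (intro tendsto_intros)
  then have G0: "((\<lambda>e::real. e\<^sup>2 + 4 * e + 5) \<longlongrightarrow> 5) (at_right 0)" by simp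
  have nn: "norm (e\<^sup>2 + 4 * e + 5) \<le> 10 * exp (e / 2)" "norm (2 * e + 4) \<le> 10 * exp (e / 2)" if "e > 0" for e :: real
    using le[OF that] that by auto
  have I: "integrable expo (\<lambda>e. e\<^sup>2 + 4 * e + 5)" "integrable expo (\<lambda>e. 2 * e + 4)"
     "(\<integral>e. (e\<^sup>2 + 4 * e + 5) - (2 * e + 4) \<partial>expo) = 5"
    by (rule P; use prem G0 nn in simp)+
  have e: "(1 + e)\<^sup>2 = (e\<^sup>2 + 4 * e + 5) - (2 * e + 4)" for e :: real by (simp add: power2_eq_square algebra_simps)
  show "integrable expo (\<lambda>e. (1 + e)\<^sup>2)" "(\<integral>e. (1 + e)\<^sup>2 \<partial>expo) = 5"
    unfolding e by (rule Bochner_Integration.integrable_diff[OF I(1,2)] I(3))+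
  show "(\<integral>e. e - 1 \<partial>expo) = 0"
  proof (rule integral_expo_by_parts(3)[where A=10])
    show "norm e \<le> 10 * exp (e / 2)" "norm (1::real) \<le> 10 * exp (e / 2)" if "e > 0" for e :: real
      using le(2)[OF that] that by (auto simp: abs_if)
    show "((\<lambda>e. e) has_vector_derivative 1) (at e)" for e :: real
      unfolding has_real_derivative_iff_has_vector_derivative[symmetric] by (rule DERIV_ident)
    show "((\<lambda>e::real. e) \<longlongrightarrow> 0) (at_right 0)" by (rule tendsto_ident_at)
  qed auto
qed

text \<open>A shot noise with jump sizes \<open>\<phi> (\<Gamma> j)\<close> decreasing in the arrival time and bounded marks \<open>q (U j)\<close>.\<close>

locale decreasing_shot_noise = marked_arrivals N U E for N :: "'b measure" and U E +
  fixes \<phi> q :: "real \<Rightarrow> real" and Q :: real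
  assumes \<phi>_meas[measurable]: "\<phi> \<in> borel_measurable borel"
    and \<phi>_nonneg: "\<And>r. 0 \<le> \<phi> r"
    and \<phi>_dec: "\<And>r s. 0 < r \<Longrightarrow> r \<le> s \<Longrightarrow> \<phi> s \<le> \<phi> r"
    and \<phi>_cont: "\<And>r. r > 0 \<Longrightarrow> isCont \<phi> r"
    and q_meas[measurable]: "q \<in> borel_measurable borel"
    and q_le: "\<And>u. \<bar>q u\<bar> \<le> Q"
begin

text \<open>Jump sizes are frozen before time \<open>1\<close>. This alters only finitely many terms of the series and makes
  them bounded, hence square-integrable.\<close>

definition h :: "real \<Rightarrow> real" where "h r = \<phi> (max r 1)"

definition H :: "real \<Rightarrow> real" where "H u = (LBINT r:{0<..u}. h r)"

definition qbar :: real where "qbar = (\<integral>u. q u \<partial>unif)"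

lemma h_meas [measurable]: "h \<in> borel_measurable borel" unfolding h_def by measurable
lemma h_nonneg: "0 \<le> h r" unfolding h_def by (rule \<phi>_nonneg)
lemma h_dec: "r \<le> s \<Longrightarrow> h s \<le> h r" unfolding h_def by (intro \<phi>_dec) auto
lemma h_le: "h r \<le> \<phi> 1" unfolding h_def by (intro \<phi>_dec) auto
lemma h_eq: "1 \<le> r \<Longrightarrow> h r = \<phi> r" unfolding h_def by (simp add: max_absorb1)

lemma h_cont: "isCont h r"
  unfolding h_def
  by (rule isCont_o2[where f="\<lambda>r. max r 1"]) (auto intro!: \<phi>_cont continuous_intros)

lemma h_int: "set_integrable lborel {a<..b} h"
  unfolding set_integrable_def
proof (rule Bochner_Integration.integrable_bound[of _ "\<lambda>r. \<phi> 1 * indicator {a<..b} r :: real"])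
  have "emeasure lborel {a<..b} < \<infinity>" by (cases "a \<le> b") auto
  then show "integrable lborel (\<lambda>r. \<phi> 1 * indicator {a<..b} r :: real)"
    by (intro integrable_mult_right integrable_real_indicator) auto
qed (use h_le h_nonneg \<phi>_nonneg in \<open>auto split: split_indicator\<close>)

lemma Q_nonneg: "0 \<le> Q" using q_le[of 0] by simp

lemma q_int: "integrable unif q"
proof -
  interpret unif: prob_space unif by (rule prob_space_unif)
  show ?thesis by (rule unif.integrable_const_bound[of _ Q]) (use q_le in auto)
qed

lemma qbar_le: "\<bar>qbar\<bar> \<le> Q"
proof -
  interpret unif: prob_space unif by (rule prob_space_unif)
  have "\<bar>qbar\<bar> \<le> (\<integral>u. \<bar>q u\<bar> \<partial>unif)" unfolding qbar_def using integral_norm_bound[of unif q] by simp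
  also have "\<dots> \<le> (\<integral>u. Q \<partial>unif)" by (intro integral_mono) (use q_int q_le in auto)
  finally show ?thesis using unif.prob_space by simp
qed

lemma H_diff: "0 \<le> a \<Longrightarrow> a \<le> b \<Longrightarrow> H b - H a = (LBINT r:{a<..b}. h r)"
  unfolding H_def by (rule indefinite_integral_from_zero(2)) (auto intro: h_cont h_int)

lemma H_diff_bounds:
  assumes "0 \<le> a" "a \<le> b"
  shows "0 \<le> H b - H a" "H b - H a \<le> h a * (b - a)"
  using set_integral_Ioc_bounds(2)[OF h_int assms(2), of 0] set_integral_Ioc_bounds(1)[OF h_int assms(2), of "h a"]
    h_nonneg h_dec unfolding H_diff[OF assms] by (auto simp: less_imp_le)

lemma H_deriv: "u > 0 \<Longrightarrow> (H has_vector_derivative h u) (at u)"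
  unfolding H_def[abs_def] by (rule indefinite_integral_from_zero(1)) (auto intro: h_cont h_int)

lemma H_meas [measurable]: "H \<in> borel_measurable borel"
  unfolding H_def[abs_def] by (rule borel_measurable_indefinite_integral) simp

lemma H_0 [simp]: "H 0 = 0" unfolding H_def by (simp add: set_lebesgue_integral_def)

lemma compensator_identity:
  assumes r: "r \<ge> 0"
  shows "(\<integral>e. (H (r + e) - H r) - h (r + e) \<partial>expo) = 0"
proof (rule integral_expo_by_parts(3)[where A="2 * \<phi> 1"])
  fix e :: real assume e: "e > 0"
  have "((\<lambda>e. r + e) has_vector_derivative 1) (at e)"
    unfolding has_real_derivative_iff_has_vector_derivative[symmetric] by (auto intro!: derivative_eq_intros)
  then have "((\<lambda>e. H (r + e)) has_vector_derivative h (r + e)) (at e)"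
    using vector_diff_chain_at[of "\<lambda>e. r + e" 1 e H "h (r + e)"] H_deriv[of "r + e"] r e by (simp add: o_def)
  then show "((\<lambda>e. H (r + e) - H r) has_vector_derivative h (r + e)) (at e)"
    by (auto intro!: derivative_eq_intros)
  show "isCont (\<lambda>e. h (r + e)) e" by (rule isCont_o2[where f="\<lambda>e. r + e"]) (auto intro!: continuous_intros h_cont)
  have e1: "1 + e / 2 \<le> exp (e / 2)" by (rule exp_ge_add_one_self)
  have "H (r + e) - H r \<le> h r * e" "0 \<le> H (r + e) - H r" using H_diff_bounds[of r "r + e"] r e by auto
  moreover have "h r * e \<le> \<phi> 1 * (2 * exp (e / 2))"
  proof (intro mult_mono h_le \<phi>_nonneg)
    show "e \<le> 2 * exp (e / 2)" using e1 by linarith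
  qed (use e in simp)
  ultimately show "norm (H (r + e) - H r) \<le> 2 * \<phi> 1 * exp (e / 2)" by simp
  have "h (r + e) \<le> \<phi> 1" by (rule h_le)
  also have "\<phi> 1 * 1 \<le> \<phi> 1 * (2 * exp (e / 2))" by (intro mult_left_mono \<phi>_nonneg) (use e1 e in linarith)
  finally show "norm (h (r + e)) \<le> 2 * \<phi> 1 * exp (e / 2)" using h_nonneg[of "r + e"] by simp
next
  show "((\<lambda>e. H (r + e) - H r) \<longlongrightarrow> 0) (at_right 0)"
  proof (rule Lim_null_comparison)
    show "\<forall>\<^sub>F e in at_right 0. norm (H (r + e) - H r) \<le> h r * e"
      using eventually_at_right_less[of 0]
      by eventually_elim (use H_diff_bounds[of r "r + _"] r in auto)
    have "((\<lambda>e. h r * e) \<longlongrightarrow> h r * 0) (at_right (0::real))" by (intro tendsto_intros)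
    then show "((\<lambda>e. h r * e) \<longlongrightarrow> 0) (at_right (0::real))" by simp
  qed
qed simp_all

text \<open>The increments of the compensated shot noise: the new term minus the mean mark times the integral of
  \<open>h\<close> between the two arrival times.\<close>

definition D :: "nat \<Rightarrow> 'b \<Rightarrow> real" where
  "D n \<omega> = h (\<Gamma> (Suc n) \<omega>) * q (U (Suc n) \<omega>) - qbar * (H (\<Gamma> (Suc n) \<omega>) - H (\<Gamma> n \<omega>))"

lemma AE_D_le: "AE \<omega> in N. \<bar>D n \<omega>\<bar> \<le> Q * (h (\<Gamma> n \<omega>) * (1 + E (Suc n) \<omega>))"
  using AE_arrival
proof eventually_elim
  case (elim \<omega>)
  let ?a = "\<Gamma> n \<omega>" and ?b = "\<Gamma> (Suc n) \<omega>"
  have ab: "0 \<le> ?a" "?a \<le> ?b" using elim by auto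
  have b: "?b - ?a = E (Suc n) \<omega>" by (simp add: arrival_Suc)
  have "\<bar>h ?b * q (U (Suc n) \<omega>)\<bar> \<le> h ?a * Q"
    unfolding abs_mult using h_nonneg[of ?b] h_dec[OF ab(2)] by (intro mult_mono q_le) (auto simp: h_nonneg)
  moreover have "\<bar>qbar * (H ?b - H ?a)\<bar> \<le> Q * (h ?a * (?b - ?a))"
    unfolding abs_mult using H_diff_bounds[OF ab] by (intro mult_mono qbar_le) (auto simp: Q_nonneg)
  ultimately have "\<bar>D n \<omega>\<bar> \<le> h ?a * Q + Q * (h ?a * (?b - ?a))" unfolding D_def by linarith
  then show ?case unfolding b by (simp add: algebra_simps)
qed

lemma E_moments:
  "integrable N (\<lambda>\<omega>. (1 + E (Suc n) \<omega>)\<^sup>2)"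
proof -
  have "integrable (distr N borel (E (Suc n))) (\<lambda>e. (1 + e)\<^sup>2)" unfolding distr_E by (rule expo_moments)
  then show ?thesis by (subst (asm) integrable_distr_eq) (auto intro: E_measurable[unfolded One_nat_def])
qed

lemma E_measurable_Suc [measurable]: "E (Suc n) \<in> borel_measurable N" "U (Suc n) \<in> borel_measurable N"
  by (auto intro: E_measurable[unfolded One_nat_def] U_measurable[unfolded One_nat_def])

lemma D_measurable_N [measurable]: "D n \<in> borel_measurable N"
  unfolding D_def[abs_def] by measurable

lemma hE_integrable: "integrable N (\<lambda>\<omega>. (Q * (h (\<Gamma> n \<omega>) * (1 + E (Suc n) \<omega>)))\<^sup>2)"
proof (rule Bochner_Integration.integrable_bound)
  show "integrable N (\<lambda>\<omega>. (Q * \<phi> 1)\<^sup>2 * (1 + E (Suc n) \<omega>)\<^sup>2)" by (intro integrable_mult_right E_moments)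
  have "(Q * (h r * x))\<^sup>2 \<le> (Q * \<phi> 1)\<^sup>2 * x\<^sup>2" for r x
    unfolding power_mult_distrib mult.assoc
    by (intro mult_left_mono mult_right_mono power_mono h_le h_nonneg) auto
  then show "AE \<omega> in N. norm ((Q * (h (\<Gamma> n \<omega>) * (1 + E (Suc n) \<omega>)))\<^sup>2) \<le> norm ((Q * \<phi> 1)\<^sup>2 * (1 + E (Suc n) \<omega>)\<^sup>2)"
    by (intro AE_I2) simp
qed simp

lemma D_square_integrable: "integrable N (\<lambda>\<omega>. (D n \<omega>)\<^sup>2)"
proof (rule Bochner_Integration.integrable_bound[OF hE_integrable[of n]])
  show "AE \<omega> in N. norm ((D n \<omega>)\<^sup>2) \<le> norm ((Q * (h (\<Gamma> n \<omega>) * (1 + E (Suc n) \<omega>)))\<^sup>2)"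
    using AE_D_le[of n] by eventually_elim (auto simp: abs_le_square_iff[symmetric] intro: order_trans[OF _ abs_ge_self])
qed simp

text \<open>Integrating out the mark replaces it by its mean, and then the exponential waiting time balances the
  new jump against the compensator.\<close>

lemma D_orthogonal:
  assumes Z[measurable]: "Z \<in> borel_measurable (F n)" and Z2: "integrable N (\<lambda>\<omega>. (Z \<omega>)\<^sup>2)"
  shows "(\<integral>\<omega>. Z \<omega> * D n \<omega> \<partial>N) = 0"
proof -
  interpret unif: prob_space unif by (rule prob_space_unif)
  interpret expo: prob_space expo by (rule prob_space_expo)
  have [measurable]: "\<Gamma> n \<in> borel_measurable (F n)" by (rule arrival_F) simp
  have ZN[measurable]: "Z \<in> borel_measurable N" using measurable_from_subalg[OF subalg_F Z] .
  define G where "G = (\<lambda>(\<omega>, u, e). Z \<omega> * (h (\<Gamma> n \<omega> + e) * q u - qbar * (H (\<Gamma> n \<omega> + e) - H (\<Gamma> n \<omega>))))"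
  have [measurable]: "G \<in> borel_measurable (F n \<Otimes>\<^sub>M (borel \<Otimes>\<^sub>M borel))" unfolding G_def by measurable
  have GD: "Z \<omega> * D n \<omega> = G (\<omega>, new_point n \<omega>)" for \<omega> by (simp add: G_def D_def arrival_Suc)
  have "integrable N (\<lambda>\<omega>. Z \<omega> * D n \<omega>)"
    by (intro integrable_product_of_squares Z2 D_square_integrable) auto
  then have "(\<integral>\<omega>. Z \<omega> * D n \<omega> \<partial>N) = (\<integral>\<omega>. (\<integral>e. (\<integral>u. G (\<omega>, (u, e)) \<partial>unif) \<partial>expo) \<partial>N)"
    unfolding GD by (intro one_step) auto
  also have "\<dots> = (\<integral>\<omega>. 0 \<partial>N)"
  proof (rule integral_cong_AE)
    have "(\<lambda>\<omega>. \<integral>e. (\<integral>u. G (\<omega>, (u, e)) \<partial>unif) \<partial>expo) \<in> borel_measurable (F n)" by measurable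
    then show "(\<lambda>\<omega>. \<integral>e. (\<integral>u. G (\<omega>, (u, e)) \<partial>unif) \<partial>expo) \<in> borel_measurable N"
      using measurable_from_subalg[OF subalg_F] by blast
    show "AE \<omega> in N. (\<integral>e. (\<integral>u. G (\<omega>, (u, e)) \<partial>unif) \<partial>expo) = 0"
      using AE_arrival
    proof eventually_elim
      case (elim \<omega>)
      have "(\<integral>u. G (\<omega>, (u, e)) \<partial>unif) = - (Z \<omega> * qbar) * ((H (\<Gamma> n \<omega> + e) - H (\<Gamma> n \<omega>)) - h (\<Gamma> n \<omega> + e))" for e
      proof -
        have "(\<integral>u. G (\<omega>, (u, e)) \<partial>unif) = (\<integral>u. (Z \<omega> * h (\<Gamma> n \<omega> + e)) * q u - Z \<omega> * qbar * (H (\<Gamma> n \<omega> + e) - H (\<Gamma> n \<omega>)) \<partial>unif)"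
          by (intro Bochner_Integration.integral_cong refl) (simp add: G_def algebra_simps)
        also have "\<dots> = (Z \<omega> * h (\<Gamma> n \<omega> + e)) * qbar - Z \<omega> * qbar * (H (\<Gamma> n \<omega> + e) - H (\<Gamma> n \<omega>))"
          using q_int unif.prob_space by (simp add: qbar_def)
        finally show ?thesis by (simp add: algebra_simps)
      qed
      then show ?case using compensator_identity[of "\<Gamma> n \<omega>"] elim by (simp only: integral_mult_right_zero)
    qed
  qed simp
  finally show ?thesis by simp
qed

lemma D_adapted: "D n \<in> borel_measurable (F (Suc n))"
proof -
  have [measurable]: "\<Gamma> (Suc n) \<in> borel_measurable (F (Suc n))" "\<Gamma> n \<in> borel_measurable (F (Suc n))"
    "U (Suc n) \<in> borel_measurable (F (Suc n))"
    by (auto intro: arrival_F U_F)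
  show ?thesis unfolding D_def[abs_def] by measurable
qed

text \<open>Both parts of the increment are of size \<open>h (\<Gamma> n)\<close>; arrival times below \<open>n / 2\<close>, where \<open>h\<close> need not be small,
  are exponentially improbable.\<close>

lemma D_second_moment: "(\<integral>\<omega>. (D n \<omega>)\<^sup>2 \<partial>N) \<le> 5 * Q\<^sup>2 * ((h (real n / 2))\<^sup>2 + (\<phi> 1)\<^sup>2 * (exp (real n / 2) * (1/2) ^ n))"
proof -
  interpret unif: prob_space unif by (rule prob_space_unif)
  have [measurable]: "\<Gamma> n \<in> borel_measurable (F n)" by (rule arrival_F) simp
  have "(\<integral>\<omega>. (D n \<omega>)\<^sup>2 \<partial>N) \<le> (\<integral>\<omega>. (Q * (h (\<Gamma> n \<omega>) * (1 + E (Suc n) \<omega>)))\<^sup>2 \<partial>N)"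
    by (intro integral_mono_AE D_square_integrable hE_integrable, use AE_D_le[of n] in eventually_elim)
      (auto simp: abs_le_square_iff[symmetric] intro: order_trans[OF _ abs_ge_self])
  also have "\<dots> = (\<integral>\<omega>. (\<integral>e. (\<integral>u. (Q * (h (\<Gamma> n \<omega>) * (1 + e)))\<^sup>2 \<partial>unif) \<partial>expo) \<partial>N)"
    using one_step[of "\<lambda>(\<omega>, u, e). (Q * (h (\<Gamma> n \<omega>) * (1 + e)))\<^sup>2" n] hE_integrable[of n] by simp
  also have "\<dots> = (\<integral>\<omega>. 5 * Q\<^sup>2 * (h (\<Gamma> n \<omega>))\<^sup>2 \<partial>N)"
  proof (rule Bochner_Integration.integral_cong[OF refl])
    fix \<omega>
    have "(Q * (h (\<Gamma> n \<omega>) * (1 + e)))\<^sup>2 = (Q\<^sup>2 * (h (\<Gamma> n \<omega>))\<^sup>2) * (1 + e)\<^sup>2" for e by (simp add: power_mult_distrib)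
    then show "(\<integral>e. (\<integral>u. (Q * (h (\<Gamma> n \<omega>) * (1 + e)))\<^sup>2 \<partial>unif) \<partial>expo) = 5 * Q\<^sup>2 * (h (\<Gamma> n \<omega>))\<^sup>2"
      using unif.prob_space expo_moments(2) by simp
  qed
  also have "\<dots> \<le> (\<integral>\<omega>. 5 * Q\<^sup>2 * ((h (real n / 2))\<^sup>2 + (\<phi> 1)\<^sup>2 * (exp (real n / 2) * exp (- \<Gamma> n \<omega>))) \<partial>N)"
  proof (rule integral_mono)
    show "integrable N (\<lambda>\<omega>. 5 * Q\<^sup>2 * (h (\<Gamma> n \<omega>))\<^sup>2)"
    proof (rule integrable_const_bound[of _ "5 * Q\<^sup>2 * (\<phi> 1)\<^sup>2"])
      show "AE \<omega> in N. norm (5 * Q\<^sup>2 * (h (\<Gamma> n \<omega>))\<^sup>2) \<le> 5 * Q\<^sup>2 * (\<phi> 1)\<^sup>2"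
        using h_le h_nonneg by (intro AE_I2) (simp add: mult_left_mono power_mono)
    qed simp
    show "integrable N (\<lambda>\<omega>. 5 * Q\<^sup>2 * ((h (real n / 2))\<^sup>2 + (\<phi> 1)\<^sup>2 * (exp (real n / 2) * exp (- \<Gamma> n \<omega>))))"
      using expectation_exp_arrival(1) by simp
    fix \<omega>
    have "(h (\<Gamma> n \<omega>))\<^sup>2 \<le> (h (real n / 2))\<^sup>2 + (\<phi> 1)\<^sup>2 * (exp (real n / 2) * exp (- \<Gamma> n \<omega>))"
    proof (cases "real n / 2 \<le> \<Gamma> n \<omega>")
      case True
      then have "(h (\<Gamma> n \<omega>))\<^sup>2 \<le> (h (real n / 2))\<^sup>2" by (intro power_mono h_dec h_nonneg)
      then show ?thesis by (rule order_trans) simp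
    next
      case False
      then have "1 \<le> exp (real n / 2) * exp (- \<Gamma> n \<omega>)" by (simp add: exp_add[symmetric])
      then have "(\<phi> 1)\<^sup>2 * 1 \<le> (\<phi> 1)\<^sup>2 * (exp (real n / 2) * exp (- \<Gamma> n \<omega>))" by (intro mult_left_mono) auto
      moreover have "(h (\<Gamma> n \<omega>))\<^sup>2 \<le> (\<phi> 1)\<^sup>2" by (intro power_mono h_le h_nonneg)
      ultimately show ?thesis using zero_le_power2[of "h (real n / 2)"] by linarith
    qed
    then show "5 * Q\<^sup>2 * (h (\<Gamma> n \<omega>))\<^sup>2 \<le> 5 * Q\<^sup>2 * ((h (real n / 2))\<^sup>2 + (\<phi> 1)\<^sup>2 * (exp (real n / 2) * exp (- \<Gamma> n \<omega>)))"
      by (intro mult_left_mono) auto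
  qed
  also have "\<dots> = 5 * Q\<^sup>2 * ((h (real n / 2))\<^sup>2 + (\<phi> 1)\<^sup>2 * (exp (real n / 2) * (1/2) ^ n))"
    using expectation_exp_arrival[of n] by (simp add: prob_space)
  finally show ?thesis .
qed

lemma sum_D: "(\<Sum>i<n. D i \<omega>) = (\<Sum>i<n. h (\<Gamma> (Suc i) \<omega>) * q (U (Suc i) \<omega>)) - qbar * H (\<Gamma> n \<omega>)"
  by (induction n) (simp_all add: D_def algebra_simps)

lemma AE_convergent_sum_D:
  assumes h2: "set_integrable lborel {0<..} (\<lambda>r. (h r)\<^sup>2)"
  shows "AE \<omega> in N. convergent (\<lambda>n. \<Sum>i<n. D i \<omega>)"
proof -
  interpret martingale_differences N F D
    by unfold_locales (rule subalg_F F_mono D_adapted D_square_integrable D_orthogonal; assumption)+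
  show ?thesis
  proof (rule AE_convergent_sum)
    have s: "summable (\<lambda>n. (h (real n / 2))\<^sup>2)"
      by (rule summable_half_samples[OF h2]) (auto intro!: power_mono h_dec h_nonneg)
    show "summable (\<lambda>n. \<integral>\<omega>. (D n \<omega>)\<^sup>2 \<partial>N)"
    proof (rule summable_comparison_test')
      show "summable (\<lambda>n. 5 * Q\<^sup>2 * ((h (real n / 2))\<^sup>2 + (\<phi> 1)\<^sup>2 * (exp (real n / 2) * (1/2) ^ n)))"
        by (intro summable_mult summable_add s summable_exp_half)
      show "norm (\<integral>\<omega>. (D n \<omega>)\<^sup>2 \<partial>N) \<le> 5 * Q\<^sup>2 * ((h (real n / 2))\<^sup>2 + (\<phi> 1)\<^sup>2 * (exp (real n / 2) * (1/2) ^ n))" for n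
        using D_second_moment[of n] by simp
    qed
  qed
qed

text \<open>The weighted sums of the centred waiting times converge by the martingale theorem; Kronecker's lemma
  turns this into a bound on \<open>\<Gamma> n - n\<close>.\<close>

lemma AE_weighted_arrival_deviation:
  fixes b :: "nat \<Rightarrow> real"
  assumes b0: "\<And>n. b n > 0" and bdec: "decseq b" and b2: "summable (\<lambda>n. (b n)\<^sup>2)"
  shows "AE \<omega> in N. (\<lambda>n. b n * (\<Gamma> n \<omega> - real n)) \<longlonglongrightarrow> 0"
proof -
  define D' where "D' n \<omega> = b n * (E (Suc n) \<omega> - 1)" for n \<omega>
  have [measurable]: "D' n \<in> borel_measurable N" for n unfolding D'_def[abs_def] by measurable
  have e1: "integrable N (\<lambda>\<omega>. (E (Suc n) \<omega> - 1)\<^sup>2)" for n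
  proof (rule Bochner_Integration.integrable_bound[OF E_moments[of n]])
    show "AE \<omega> in N. norm ((E (Suc n) \<omega> - 1)\<^sup>2) \<le> norm ((1 + E (Suc n) \<omega>)\<^sup>2)"
      using AE_E_nonneg
    proof eventually_elim
      case (elim \<omega>)
      then have "0 \<le> E (Suc n) \<omega>" by blast
      then have "\<bar>E (Suc n) \<omega> - 1\<bar> \<le> \<bar>1 + E (Suc n) \<omega>\<bar>" by linarith
      then show ?case by (simp add: abs_le_square_iff)
    qed
  qed simp
  have D2: "integrable N (\<lambda>\<omega>. (D' n \<omega>)\<^sup>2)" for n
    unfolding D'_def power_mult_distrib by (intro integrable_mult_right e1)
  have D2v: "(\<integral>\<omega>. (D' n \<omega>)\<^sup>2 \<partial>N) = (b n)\<^sup>2 * (\<integral>e. (e - 1)\<^sup>2 \<partial>expo)" for n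
  proof -
    have "(\<integral>\<omega>. (D' n \<omega>)\<^sup>2 \<partial>N) = (b n)\<^sup>2 * (\<integral>\<omega>. (E (Suc n) \<omega> - 1)\<^sup>2 \<partial>N)"
      unfolding D'_def power_mult_distrib by simp
    also have "(\<integral>\<omega>. (E (Suc n) \<omega> - 1)\<^sup>2 \<partial>N) = (\<integral>e. (e - 1)\<^sup>2 \<partial>expo)"
      unfolding distr_E[of n, symmetric] by (subst integral_distr) auto
    finally show ?thesis .
  qed
  have orth: "(\<integral>\<omega>. Z \<omega> * D' n \<omega> \<partial>N) = 0"
    if Z[measurable]: "Z \<in> borel_measurable (F n)" and Z2: "integrable N (\<lambda>\<omega>. (Z \<omega>)\<^sup>2)" for Z n
  proof -
    interpret unif: prob_space unif by (rule prob_space_unif)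
    have ZN[measurable]: "Z \<in> borel_measurable N" using measurable_from_subalg[OF subalg_F Z] .
    have "integrable N (\<lambda>\<omega>. Z \<omega> * D' n \<omega>)" by (intro integrable_product_of_squares Z2 D2) auto
    then have "(\<integral>\<omega>. Z \<omega> * D' n \<omega> \<partial>N) = (\<integral>\<omega>. (\<integral>e. (\<integral>u. Z \<omega> * (b n * (e - 1)) \<partial>unif) \<partial>expo) \<partial>N)"
      using one_step[of "\<lambda>(\<omega>, u, e). Z \<omega> * (b n * (e - 1))" n] by (simp add: D'_def)
    also have "\<dots> = (\<integral>\<omega>. Z \<omega> * (b n * (\<integral>e. e - 1 \<partial>expo)) \<partial>N)"
      using unif.prob_space by (simp only: integral_mult_right_zero) simp
    also have "\<dots> = 0" unfolding expo_moments(3) by simp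
    finally show ?thesis .
  qed
  have adapt: "D' n \<in> borel_measurable (F (Suc n))" for n
  proof -
    have [measurable]: "E (Suc n) \<in> borel_measurable (F (Suc n))" by (rule E_F) auto
    show ?thesis unfolding D'_def[abs_def] by measurable
  qed
  interpret D': martingale_differences N F D'
    by unfold_locales (rule subalg_F F_mono adapt D2 orth; assumption)+
  have "AE \<omega> in N. convergent (\<lambda>n. \<Sum>i<n. D' i \<omega>)"
    by (rule D'.AE_convergent_sum) (simp add: D2v summable_mult2[OF b2])
  then show ?thesis
  proof eventually_elim
    case (elim \<omega>)
    have "(\<lambda>n. (b n)\<^sup>2) \<longlonglongrightarrow> 0" by (rule summable_LIMSEQ_zero[OF b2])
    then have "b \<longlonglongrightarrow> 0" by simp
    from Kronecker_lemma[OF b0 bdec this elim[unfolded D'_def]]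
    have "(\<lambda>n. b n * (\<Sum>i<n. E (Suc i) \<omega> - 1)) \<longlonglongrightarrow> 0" .
    moreover have "(\<Sum>i<n. E (Suc i) \<omega> - 1) = \<Gamma> n \<omega> - real n" for n
      by (induction n) (simp_all add: arrival_Suc)
    ultimately show ?case by simp
  qed
qed

text \<open>The difference is an integral of \<open>h\<close> between \<open>n\<close> and \<open>\<Gamma> n\<close>, at most \<open>h (n/2) |\<Gamma> n - n|\<close> for large \<open>n\<close>.
  A pointwise bound on \<open>h\<close> together with the law of the iterated logarithm would not suffice; square
  integrability of \<open>h\<close> enters through Kronecker's lemma.\<close>

lemma AE_compensator_deviation:
  assumes h2: "set_integrable lborel {0<..} (\<lambda>r. (h r)\<^sup>2)"
  shows "AE \<omega> in N. (\<lambda>n. H (\<Gamma> n \<omega>) - H (real n)) \<longlonglongrightarrow> 0"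
proof -
  \<comment> \<open>Jump sizes may vanish from some time on; the summand \<open>1 / (n + 1)\<close> keeps the weights positive, as Kronecker's
    lemma requires, and square summable.\<close>
  define b where "b n = h (real n / 2) + inverse (real (Suc n))" for n
  have b0: "b n > 0" for n unfolding b_def by (intro add_nonneg_pos h_nonneg) simp
  have bdec: "decseq b"
    unfolding b_def decseq_def by (auto intro!: add_mono h_dec divide_right_mono le_imp_inverse_le)
  have s1: "summable (\<lambda>n. (h (real n / 2))\<^sup>2)"
    by (rule summable_half_samples[OF h2]) (auto intro!: power_mono h_dec h_nonneg)
  have "summable (\<lambda>n. inverse ((real n)\<^sup>2))" by (rule inverse_power_summable) simp
  then have s2: "summable (\<lambda>n. (inverse (real (Suc n)))\<^sup>2)"
    by (subst (asm) summable_Suc_iff[symmetric]) (simp add: power_inverse)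
  have b2: "summable (\<lambda>n. (b n)\<^sup>2)"
  proof (rule summable_comparison_test')
    show "summable (\<lambda>n. 2 * ((h (real n / 2))\<^sup>2 + (inverse (real (Suc n)))\<^sup>2))" by (intro summable_mult summable_add s1 s2)
    have "(x + y)\<^sup>2 \<le> 2 * (x\<^sup>2 + y\<^sup>2)" for x y :: real
      using sum_squares_bound[of x y] by (simp add: power2_sum)
    then show "norm ((b n)\<^sup>2) \<le> 2 * ((h (real n / 2))\<^sup>2 + (inverse (real (Suc n)))\<^sup>2)" for n
      unfolding b_def by (simp del: of_nat_Suc)
  qed
  show ?thesis
    using AE_weighted_arrival_deviation[OF b0 bdec b2] AE_arrival_gt_half AE_arrival
  proof eventually_elim
    case (elim \<omega>)
    have "(\<lambda>n. \<bar>b n * (\<Gamma> n \<omega> - real n)\<bar>) \<longlonglongrightarrow> 0" using elim(1) by (rule tendsto_rabs_zero)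
    then show ?case
    proof (rule Lim_null_comparison[rotated])
      show "\<forall>\<^sub>F n in sequentially. norm (H (\<Gamma> n \<omega>) - H (real n)) \<le> \<bar>b n * (\<Gamma> n \<omega> - real n)\<bar>"
        using elim(2)
      proof eventually_elim
        fix n assume n: "real n / 2 < \<Gamma> n \<omega>"
        have hb: "h r \<le> b n" if "real n / 2 \<le> r" for r
          using h_dec[OF that] unfolding b_def by (simp add: add_increasing2)
        show "norm (H (\<Gamma> n \<omega>) - H (real n)) \<le> \<bar>b n * (\<Gamma> n \<omega> - real n)\<bar>"
        proof (cases "real n \<le> \<Gamma> n \<omega>")
          case True
          have "H (\<Gamma> n \<omega>) - H (real n) \<le> h (real n) * (\<Gamma> n \<omega> - real n)" "0 \<le> H (\<Gamma> n \<omega>) - H (real n)"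
            using H_diff_bounds[of "real n" "\<Gamma> n \<omega>"] True by auto
          moreover have "h (real n) * (\<Gamma> n \<omega> - real n) \<le> b n * (\<Gamma> n \<omega> - real n)"
            using True by (intro mult_right_mono hb) auto
          ultimately show ?thesis by simp
        next
          case False
          have "H (real n) - H (\<Gamma> n \<omega>) \<le> h (\<Gamma> n \<omega>) * (real n - \<Gamma> n \<omega>)" "0 \<le> H (real n) - H (\<Gamma> n \<omega>)"
            using H_diff_bounds[of "\<Gamma> n \<omega>" "real n"] False elim(3) by auto
          moreover have "h (\<Gamma> n \<omega>) * (real n - \<Gamma> n \<omega>) \<le> b n * (real n - \<Gamma> n \<omega>)"
            using False n by (intro mult_right_mono hb) auto
          moreover have "b n * (real n - \<Gamma> n \<omega>) \<le> \<bar>b n * (\<Gamma> n \<omega> - real n)\<bar>"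
            using abs_ge_minus_self[of "b n * (\<Gamma> n \<omega> - real n)"] by (simp add: algebra_simps)
          ultimately show ?thesis by simp
        qed
      qed
    qed
  qed
qed

lemma AE_early_terms_summable:
  "AE \<omega> in N. summable (\<lambda>i. (\<phi> (\<Gamma> (Suc i) \<omega>) - h (\<Gamma> (Suc i) \<omega>)) * q (U (Suc i) \<omega>))"
  using AE_arrival_at_top
proof eventually_elim
  case (elim \<omega>)
  then have "\<forall>\<^sub>F n in sequentially. 1 \<le> \<Gamma> n \<omega>" by (simp add: filterlim_at_top)
  then have "\<forall>\<^sub>F i in sequentially. 1 \<le> \<Gamma> (Suc i) \<omega>" by (subst eventually_sequentially_Suc)
  then have "\<forall>\<^sub>F i in sequentially. (\<phi> (\<Gamma> (Suc i) \<omega>) - h (\<Gamma> (Suc i) \<omega>)) * q (U (Suc i) \<omega>) = 0"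
    by eventually_elim (simp add: h_eq)
  then show ?case using summable_cong[of _ "\<lambda>_. 0 :: real"] by fastforce
qed

lemma integral_\<phi>_eq:
  assumes int: "\<And>s. set_integrable lborel {0<..s} \<phi>" and u: "1 \<le> u"
  shows "(LBINT r:{0<..u}. \<phi> r) = (LBINT r:{0<..1}. \<phi> r) - H 1 + H u"
proof -
  have "(LBINT r:{0<..u}. \<phi> r) = (LBINT r:{0<..1}. \<phi> r) + (LBINT r:{1<..u}. \<phi> r)"
    using u int[of u]
    by (subst set_integral_Un[symmetric]) (auto intro!: int arg_cong[where f="\<lambda>S. set_lebesgue_integral lborel S \<phi>"] intro: set_integrable_subset)
  also have "(LBINT r:{1<..u}. \<phi> r) = (LBINT r:{1<..u}. h r)"
    by (rule set_lebesgue_integral_cong) (auto simp: h_eq)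
  also have "\<dots> = H u - H 1" using H_diff[of 1 u] u by simp
  finally show ?thesis by simp
qed

text \<open>The martingale is compensated up to the random time \<open>\<Gamma> n\<close>; exchanging it for \<open>n\<close> costs a term that
  tends to \<open>0\<close>, and undoing the truncation changes the partial sums by an eventually constant amount.\<close>

theorem AE_convergent_compensated:
  assumes int: "\<And>s. set_integrable lborel {0<..s} \<phi>" and h2: "set_integrable lborel {0<..} (\<lambda>r. (h r)\<^sup>2)"
  shows "AE \<omega> in N. convergent (\<lambda>n. (\<Sum>i<n. \<phi> (\<Gamma> (Suc i) \<omega>) * q (U (Suc i) \<omega>)) - qbar * (LBINT r:{0<..real n}. \<phi> r)) \<and>
    (\<lambda>n. (LBINT r:{0<..\<Gamma> n \<omega>}. \<phi> r) - (LBINT r:{0<..real n}. \<phi> r)) \<longlonglongrightarrow> 0"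
  using AE_convergent_sum_D[OF h2] AE_compensator_deviation[OF h2] AE_early_terms_summable AE_arrival_at_top
proof eventually_elim
  case (elim \<omega>)
  define c where "c = (LBINT r:{0<..1}. \<phi> r) - H 1"
  have ev1: "\<forall>\<^sub>F n in sequentially. 1 \<le> \<Gamma> n \<omega>" using elim(4) by (simp add: filterlim_at_top)
  have ev2: "\<forall>\<^sub>F n in sequentially. 1 \<le> n" by (rule eventually_ge_at_top)
  have "\<forall>\<^sub>F n in sequentially. H (\<Gamma> n \<omega>) - H (real n) = (LBINT r:{0<..\<Gamma> n \<omega>}. \<phi> r) - (LBINT r:{0<..real n}. \<phi> r)"
    using ev1 ev2
  proof eventually_elim
    case (elim n)
    then show ?case using integral_\<phi>_eq[OF int, of "\<Gamma> n \<omega>"] integral_\<phi>_eq[OF int, of "real n"] by simp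
  qed
  with elim(2) have dev: "(\<lambda>n. (LBINT r:{0<..\<Gamma> n \<omega>}. \<phi> r) - (LBINT r:{0<..real n}. \<phi> r)) \<longlonglongrightarrow> 0"
    by (rule Lim_transform_eventually)
  obtain l1 where l1: "(\<lambda>n. \<Sum>i<n. D i \<omega>) \<longlonglongrightarrow> l1" using elim(1) unfolding convergent_def by auto
  obtain l2 where l2: "(\<lambda>n. \<Sum>i<n. (\<phi> (\<Gamma> (Suc i) \<omega>) - h (\<Gamma> (Suc i) \<omega>)) * q (U (Suc i) \<omega>)) \<longlonglongrightarrow> l2"
    using summable_LIMSEQ[OF elim(3)] by blast
  have "(\<lambda>n. (\<Sum>i<n. D i \<omega>) + (\<Sum>i<n. (\<phi> (\<Gamma> (Suc i) \<omega>) - h (\<Gamma> (Suc i) \<omega>)) * q (U (Suc i) \<omega>))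
      + qbar * (H (\<Gamma> n \<omega>) - H (real n)) - qbar * c) \<longlonglongrightarrow> l1 + l2 + qbar * 0 - qbar * c"
    by (intro tendsto_intros l1 l2 elim(2))
  moreover have "\<forall>\<^sub>F n in sequentially. (\<Sum>i<n. D i \<omega>) + (\<Sum>i<n. (\<phi> (\<Gamma> (Suc i) \<omega>) - h (\<Gamma> (Suc i) \<omega>)) * q (U (Suc i) \<omega>))
      + qbar * (H (\<Gamma> n \<omega>) - H (real n)) - qbar * c =
      (\<Sum>i<n. \<phi> (\<Gamma> (Suc i) \<omega>) * q (U (Suc i) \<omega>)) - qbar * (LBINT r:{0<..real n}. \<phi> r)"
    using ev2
  proof eventually_elim
    case (elim n)
    have "(LBINT r:{0<..real n}. \<phi> r) = c + H (real n)" using integral_\<phi>_eq[OF int, of "real n"] elim by (simp add: c_def)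
    then show ?case by (simp add: sum_D sum_subtractf algebra_simps)
  qed
  ultimately have "(\<lambda>n. (\<Sum>i<n. \<phi> (\<Gamma> (Suc i) \<omega>) * q (U (Suc i) \<omega>)) - qbar * (LBINT r:{0<..real n}. \<phi> r)) \<longlonglongrightarrow> l1 + l2 + qbar * 0 - qbar * c"
    by (rule Lim_transform_eventually)
  then show ?case using dev by (auto simp: convergent_def)
qed

text \<open>Eventually \<open>\<Gamma> n\<close> exceeds \<open>n / 2\<close>, so the terms are dominated by samples of a decreasing integrable function.\<close>

theorem AE_summable:
  assumes h1: "set_integrable lborel {0<..} h"
  shows "AE \<omega> in N. summable (\<lambda>i. \<phi> (\<Gamma> (Suc i) \<omega>) * q (U (Suc i) \<omega>))"
  using AE_arrival_gt_half AE_early_terms_summable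
proof eventually_elim
  case (elim \<omega>)
  have "summable (\<lambda>n. h (real n / 2))" by (rule summable_half_samples[OF h1]) (auto intro: h_dec h_nonneg)
  then have "summable (\<lambda>i. h (real (Suc i) / 2))" by (subst summable_Suc_iff)
  then have s: "summable (\<lambda>i. h (real (Suc i) / 2) * Q)" by (rule summable_mult2)
  have "\<forall>\<^sub>F i in sequentially. real (Suc i) / 2 < \<Gamma> (Suc i) \<omega>"
    using elim(1) by (subst eventually_sequentially_Suc)
  then have "\<forall>\<^sub>F i in sequentially. norm (h (\<Gamma> (Suc i) \<omega>) * q (U (Suc i) \<omega>)) \<le> h (real (Suc i) / 2) * Q"
  proof eventually_elim
    case (elim i)
    have "\<bar>h (\<Gamma> (Suc i) \<omega>)\<bar> * \<bar>q (U (Suc i) \<omega>)\<bar> \<le> h (real (Suc i) / 2) * Q"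
      using h_dec[of "real (Suc i) / 2" "\<Gamma> (Suc i) \<omega>"] elim h_nonneg by (intro mult_mono q_le) auto
    then show ?case by (simp add: abs_mult)
  qed
  then have "summable (\<lambda>i. h (\<Gamma> (Suc i) \<omega>) * q (U (Suc i) \<omega>))" using s by (rule summable_comparison_test_ev)
  from summable_add[OF this elim(2)] show ?case by (simp add: algebra_simps)
qed

end

section \<open>Inversion of the tail of a Levy density\<close>

text \<open>The jump size attached to the arrival time \<open>r\<close>, the first argument of the kernel in \<open>shot_H\<close>.\<close>

definition jump_size :: "real \<Rightarrow> (real \<Rightarrow> real) \<Rightarrow> real \<Rightarrow> real" where
  "jump_size T \<pi> r = (if 0 < r / T \<and> ennreal (r / T) < levy_tail \<pi> 0 then levy_tail_inv \<pi> (r / T) else 0)"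

locale positive_levy_density =
  fixes \<pi> :: "real \<Rightarrow> real"
  assumes levy_density: "levy_density \<pi>"
    and pos: "x > 0 \<Longrightarrow> \<pi> x > 0"
    and zero: "x \<le> 0 \<Longrightarrow> \<pi> x = 0"
begin

abbreviation "\<nu> \<equiv> density_measure \<pi>"

lemma density_measurable [measurable]: "\<pi> \<in> borel_measurable borel"
  using levy_density unfolding levy_density_def by auto

lemma density_nonneg: "0 \<le> \<pi> x"
  using levy_density unfolding levy_density_def by auto

lemma sets_nu [measurable_cong, simp]: "sets \<nu> = sets borel"
  unfolding density_measure_def by simp

lemma space_nu [simp]: "space \<nu> = UNIV"
  unfolding density_measure_def by simp

lemma nu_min: "(\<integral>\<^sup>+ x. ennreal (min 1 (x\<^sup>2)) \<partial>\<nu>) < \<infinity>"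
  using levy_density unfolding levy_density_def levy_measure_def by auto

lemma emeasure_nu: "A \<in> sets borel \<Longrightarrow> emeasure \<nu> A = (\<integral>\<^sup>+ x. ennreal (\<pi> x) * indicator A x \<partial>lborel)"
  unfolding density_measure_def by (simp add: emeasure_density)

lemma levy_tail_eq: "levy_tail \<pi> x = emeasure \<nu> {x<..}"
  by (simp add: emeasure_nu levy_tail_def)

lemma levy_tail_finite: assumes "x > 0" shows "levy_tail \<pi> x < \<infinity>"
proof -
  define c where "c = min 1 (x\<^sup>2)"
  have c: "c > 0" using assms unfolding c_def by simp
  have "ennreal c * emeasure \<nu> {x<..} = (\<integral>\<^sup>+ s. ennreal c * indicator {x<..} s \<partial>\<nu>)"
    by (simp add: nn_integral_cmult)
  also have "\<dots> \<le> (\<integral>\<^sup>+ s. ennreal (min 1 (s\<^sup>2)) \<partial>\<nu>)"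
    using assms unfolding c_def
    by (intro nn_integral_mono) (auto split: split_indicator simp: min_le_iff_disj intro!: ennreal_leI power_mono min.mono)
  finally have "ennreal c * emeasure \<nu> {x<..} < \<infinity>" using nu_min by (rule le_less_trans)
  then show ?thesis using c by (auto simp: levy_tail_eq ennreal_mult_less_top)
qed

lemma levy_tail_mono: "x \<le> y \<Longrightarrow> levy_tail \<pi> y \<le> levy_tail \<pi> x"
  unfolding levy_tail_eq by (intro emeasure_mono) auto

lemma levy_tail_strict: assumes "0 \<le> x" "x < y" shows "levy_tail \<pi> y < levy_tail \<pi> x"
proof -
  have "emeasure \<nu> {x<..y} \<noteq> 0"
  proof
    assume "emeasure \<nu> {x<..y} = 0"
    then have "AE s in lborel. ennreal (\<pi> s) * indicator {x<..y} s = 0"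
      by (subst (asm) emeasure_nu) (auto simp: nn_integral_0_iff_AE)
    then have "AE s in lborel. s \<notin> {x<..y}"
    proof (rule AE_mp, intro AE_I2 impI)
      fix s assume "ennreal (\<pi> s) * indicator {x<..y} s = 0"
      then show "s \<notin> {x<..y}" using pos[of s] assms by (auto simp: indicator_def)
    qed
    then have "emeasure lborel {x<..y} = 0" by (subst (asm) AE_iff_measurable[where N="{x<..y}"]) auto
    then show False using assms by simp
  qed
  moreover have "levy_tail \<pi> x = levy_tail \<pi> y + emeasure \<nu> {x<..y}"
    unfolding levy_tail_eq using assms by (subst plus_emeasure) (auto intro!: arg_cong[where f="emeasure \<nu>"])
  moreover have "levy_tail \<pi> y < \<infinity>" using assms by (intro levy_tail_finite) auto
  ultimately show ?thesis
    by (metis add.right_neutral ennreal_add_left_cancel_less infinity_ennreal_def not_gr_zero order_less_irrefl)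
qed

lemma inj_on_levy_tail: "inj_on (levy_tail \<pi>) {0<..}"
proof (rule inj_onI)
  fix x y assume "x \<in> {0<..}" "y \<in> {0<..}" and e: "levy_tail \<pi> x = levy_tail \<pi> y"
  then show "x = y"
    using levy_tail_strict[of x y] levy_tail_strict[of y x] by (cases x y rule: linorder_cases) auto
qed

text \<open>The tail function is continuous because the Levy measure has no atoms; the solution of the equation
  is the supremum of the points where the tail still exceeds \<open>y\<close>.\<close>

lemma levy_tail_surj:
  assumes y: "y > 0" "ennreal y < levy_tail \<pi> 0"
  shows "\<exists>x>0. levy_tail \<pi> x = ennreal y"
proof -
  \<comment> \<open>Continuity from above and from below of the measure give the two inequalities at \<open>s = Sup S\<close>.\<close>
  define S where "S = {x. 0 < x \<and> ennreal y < levy_tail \<pi> x}"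
  have "levy_tail \<pi> 0 = (SUP n. levy_tail \<pi> (inverse (real (Suc n))))"
  proof -
    have "(\<Union>n. {inverse (real (Suc n))<..}) = {0::real<..}"
    proof (intro equalityI subsetI)
      fix x :: real assume "x \<in> {0<..}"
      then obtain n where "inverse (real (Suc n)) < x" using reals_Archimedean[of x] by auto
      then show "x \<in> (\<Union>n. {inverse (real (Suc n))<..})" by (auto intro!: exI[of _ n])
    next
      fix x :: real assume "x \<in> (\<Union>n. {inverse (real (Suc n))<..})"
      then obtain n where "inverse (real (Suc n)) < x" by auto
      moreover have "inverse (real (Suc n)) > 0" by simp
      ultimately have "0 < x" by linarith
      then show "x \<in> {0<..}" by simp
    qed
    moreover have "(SUP n. emeasure \<nu> {inverse (real (Suc n))<..}) = emeasure \<nu> (\<Union>n. {inverse (real (Suc n))<..})"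
      by (rule SUP_emeasure_incseq) (auto simp: incseq_def field_simps intro: order_le_less_trans[rotated])
    ultimately show ?thesis unfolding levy_tail_eq by simp
  qed
  then obtain n where "ennreal y < levy_tail \<pi> (inverse (real (Suc n)))"
    using y(2) by (auto simp: less_SUP_iff)
  then have ne: "inverse (real (Suc n)) \<in> S" unfolding S_def by simp
  have "(\<lambda>n. emeasure \<nu> {real (Suc n)<..}) \<longlonglongrightarrow> emeasure \<nu> (\<Inter>n. {real (Suc n)<..})"
    using levy_tail_finite[unfolded levy_tail_eq]
    by (intro Lim_emeasure_decseq) (auto simp: decseq_def less_top[symmetric])
  moreover have "(\<Inter>n. {real (Suc n)<..}) = {}"
  proof (intro equalityI subsetI)
    fix x assume x: "x \<in> (\<Inter>n. {real (Suc n)<..})"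
    obtain n where "x \<le> real n" using real_arch_simple by blast
    then show "x \<in> {}" using x by (auto dest!: spec[of _ n])
  qed simp
  ultimately have "(\<lambda>n. emeasure \<nu> {real (Suc n)<..}) \<longlonglongrightarrow> 0" by simp
  then have "eventually (\<lambda>n. emeasure \<nu> {real (Suc n)<..} < ennreal y) sequentially"
    using y(1) by (intro order_tendstoD(2)) auto
  then obtain N where N: "levy_tail \<pi> (real (Suc N)) < ennreal y"
    unfolding levy_tail_eq by (auto simp: eventually_sequentially)
  have bdd: "x \<le> real (Suc N)" if "x \<in> S" for x
  proof (rule ccontr)
    assume "\<not> x \<le> real (Suc N)"
    then have "levy_tail \<pi> x < ennreal y" by (intro le_less_trans[OF levy_tail_mono N]) simp
    then show False using that unfolding S_def by (auto dest: less_trans)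
  qed
  then have bdd': "bdd_above S" by (auto simp: bdd_above_def)
  define s where "s = Sup S"
  have s0: "s > 0"
    using cSup_upper[OF ne bdd'] unfolding s_def by (rule less_le_trans[rotated]) simp
  have below: "ennreal y \<le> levy_tail \<pi> x" if xs: "x < s" for x
  proof -
    obtain z where z: "z \<in> S" "x < z"
      using less_cSupD[of S x] ne xs[unfolded s_def] by (metis empty_iff)
    then have "ennreal y < levy_tail \<pi> z" "levy_tail \<pi> z \<le> levy_tail \<pi> x"
      using levy_tail_mono[of x z] by (auto simp: S_def)
    then show ?thesis by (auto intro: order.strict_implies_order order.strict_trans2)
  qed
  have above: "levy_tail \<pi> x \<le> ennreal y" if "x > s" for x
  proof (rule ccontr)
    assume "\<not> levy_tail \<pi> x \<le> ennreal y"
    then have "x \<in> S" using that s0 by (auto simp: S_def not_le)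
    then show False using cSup_upper[OF _ bdd'] that unfolding s_def by fastforce
  qed
  have "levy_tail \<pi> s \<ge> ennreal y"
  proof -
    have "(\<lambda>n. emeasure \<nu> {s - s / real (n + 2)<..}) \<longlonglongrightarrow> emeasure \<nu> (\<Inter>n. {s - s / real (n + 2)<..})"
    proof (intro Lim_emeasure_decseq)
      show "decseq (\<lambda>n. {s - s / real (n + 2)<..})"
        unfolding decseq_def
      proof (intro allI impI)
        fix m n :: nat assume "m \<le> n"
        then have "s / real (n + 2) \<le> s / real (m + 2)" using s0 by (intro divide_left_mono) auto
        then have "s - s / real (m + 2) \<le> s - s / real (n + 2)" by simp
        then show "{s - s / real (n + 2)<..} \<subseteq> {s - s / real (m + 2)<..}" unfolding greaterThan_subset_iff .
      qed
      have "s - s / real (n + 2) > 0" for n using s0 by (simp add: field_simps add_pos_nonneg)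
      then show "emeasure \<nu> {s - s / real (n + 2)<..} \<noteq> \<infinity>" for n
        using levy_tail_finite[of "s - s / real (n + 2)"] unfolding levy_tail_eq by fastforce
    qed auto
    moreover have "(\<Inter>n. {s - s / real (n + 2)<..}) = {s..}"
    proof (intro equalityI subsetI)
      fix x assume x: "x \<in> (\<Inter>n. {s - s / real (n + 2)<..})"
      have "(\<lambda>n. s - s / real (n + 2)) \<longlonglongrightarrow> s - 0"
        by (intro tendsto_diff tendsto_const real_tendsto_divide_at_top[OF tendsto_const]
            filterlim_compose[OF filterlim_real_sequentially] filterlim_add_const_nat_at_top)
      then have "s \<le> x" using x by (intro LIMSEQ_le_const2[of _ s x]) (auto intro: less_imp_le)
      then show "x \<in> {s..}" by simp
    next
      fix x assume "x \<in> {s..}" then show "x \<in> (\<Inter>n. {s - s / real (n + 2)<..})" using s0 by (auto intro!: less_le_trans[of _ s x])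
    qed
    ultimately have "ennreal y \<le> emeasure \<nu> {s..}"
      using below s0 unfolding levy_tail_eq
      by (intro LIMSEQ_le_const[of "\<lambda>n. emeasure \<nu> {s - s / real (n + 2)<..}"]) auto
    moreover have "emeasure \<nu> {s..} = emeasure \<nu> ({s<..} \<union> {s})" by (rule arg_cong[where f="emeasure \<nu>"]) auto
    moreover have "\<dots> = emeasure \<nu> {s<..}"
    proof (rule emeasure_Un_null_set)
      have "AE x in lborel. x \<noteq> s" by (rule AE_lborel_singleton)
      then have "emeasure \<nu> {s} = 0"
        by (subst emeasure_nu) (auto simp: nn_integral_0_iff_AE elim!: AE_mp intro!: AE_I2)
      then show "{s} \<in> null_sets \<nu>" by (auto simp: null_sets_def)
    qed auto
    ultimately show ?thesis by (simp add: levy_tail_eq)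
  qed
  moreover have "levy_tail \<pi> s \<le> ennreal y"
  proof -
    have "(\<Union>n. {s + inverse (real (Suc n))<..}) = {s<..}"
    proof (intro equalityI subsetI)
      fix x assume "x \<in> {s<..}"
      then obtain n where "inverse (real (Suc n)) < x - s" using reals_Archimedean[of "x - s"] by auto
      then show "x \<in> (\<Union>n. {s + inverse (real (Suc n))<..})" by (auto intro!: exI[of _ n])
    next
      fix x assume "x \<in> (\<Union>n. {s + inverse (real (Suc n))<..})"
      then obtain n where "s + inverse (real (Suc n)) < x" by auto
      moreover have "inverse (real (Suc n)) > 0" by simp
      ultimately have "s < x" by linarith
      then show "x \<in> {s<..}" by simp
    qed
    moreover have "(SUP n. emeasure \<nu> {s + inverse (real (Suc n))<..}) = emeasure \<nu> (\<Union>n. {s + inverse (real (Suc n))<..})"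
      by (rule SUP_emeasure_incseq) (auto simp: incseq_def field_simps intro: order_le_less_trans[rotated])
    ultimately have "levy_tail \<pi> s = (SUP n. levy_tail \<pi> (s + inverse (real (Suc n))))"
      unfolding levy_tail_eq by simp
    also have "\<dots> \<le> ennreal y" by (intro SUP_least above) simp
    finally show ?thesis .
  qed
  ultimately show ?thesis using s0 by auto
qed

lemma levy_tail_inv:
  assumes "y > 0" "ennreal y < levy_tail \<pi> 0"
  shows "levy_tail_inv \<pi> y > 0" "levy_tail \<pi> (levy_tail_inv \<pi> y) = ennreal y"
proof -
  obtain x where "x > 0" "levy_tail \<pi> x = ennreal y" using levy_tail_surj[OF assms] by blast
  then have im: "ennreal y \<in> levy_tail \<pi> ` {0<..}" by force
  show "levy_tail_inv \<pi> y > 0"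
    using the_inv_into_into[OF inj_on_levy_tail im subset_refl] unfolding levy_tail_inv_def by auto
  show "levy_tail \<pi> (levy_tail_inv \<pi> y) = ennreal y"
    using f_the_inv_into_f[OF inj_on_levy_tail im] unfolding levy_tail_inv_def .
qed

end

locale scaled_levy_density = positive_levy_density +
  fixes T :: real
  assumes T: "T > 0"
begin

abbreviation "\<phi> \<equiv> jump_size T \<pi>"

lemma jump_size_cases:
  obtains "0 < r" "\<phi> r > 0" "levy_tail \<pi> (\<phi> r) = ennreal (r / T)"
  | "\<phi> r = 0" "r \<le> 0 \<or> levy_tail \<pi> 0 \<le> ennreal (r / T)"
proof (cases "0 < r / T \<and> ennreal (r / T) < levy_tail \<pi> 0")
  case True
  then show thesis using that(1) levy_tail_inv[of "r / T"] T by (simp add: jump_size_def zero_less_divide_iff)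
next
  case False
  then have "\<phi> r = 0" by (auto simp: jump_size_def)
  moreover have "r \<le> 0 \<or> levy_tail \<pi> 0 \<le> ennreal (r / T)"
    using False T by (auto simp: not_less zero_less_divide_iff)
  ultimately show thesis by (rule that(2))
qed

lemma jump_nonneg: "0 \<le> \<phi> r"
  by (cases r rule: jump_size_cases) auto

lemma jump_nonpos_arg: "r \<le> 0 \<Longrightarrow> \<phi> r = 0"
  using T by (auto simp: jump_size_def zero_less_divide_iff)

text \<open>The Galois property of the generalised inverse. Monotonicity, continuity and the image measure of
  \<open>\<phi>\<close> all follow from it.\<close>

lemma jump_gt_iff:
  assumes "r > 0" "x > 0"
  shows "x < \<phi> r \<longleftrightarrow> ennreal (r / T) < levy_tail \<pi> x"
proof (cases r rule: jump_size_cases)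
  case 1
  then show ?thesis
    using levy_tail_strict[of x "\<phi> r"] levy_tail_mono[of "\<phi> r" x] assms by (metis less_imp_le not_le)
next
  case 2
  then have "levy_tail \<pi> 0 \<le> ennreal (r / T)" using assms by auto
  then have "levy_tail \<pi> x \<le> ennreal (r / T)" using levy_tail_mono[of 0 x] assms by auto
  then show ?thesis using 2 assms by (simp add: not_less[symmetric])
qed

lemma jump_antimono:
  assumes "0 < r" "r \<le> s" shows "\<phi> s \<le> \<phi> r"
proof (rule ccontr)
  assume "\<not> \<phi> s \<le> \<phi> r"
  then obtain x where x: "\<phi> r < x" "x < \<phi> s" using dense[of "\<phi> r" "\<phi> s"] by auto
  then have x0: "x > 0" using jump_nonneg[of r] by simp
  have "ennreal (s / T) < levy_tail \<pi> x" using jump_gt_iff[of s x] x x0 assms by auto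
  moreover have "ennreal (r / T) \<le> ennreal (s / T)" using assms T by (intro ennreal_leI divide_right_mono) auto
  ultimately show False using jump_gt_iff[of r x] x x0 assms by (auto dest: le_less_trans)
qed

lemma jump_isCont:
  assumes r: "r > 0" shows "isCont \<phi> r"
  unfolding continuous_within
proof (rule order_tendstoI)
  fix x assume x: "x < \<phi> r"
  show "\<forall>\<^sub>F s in at r. x < \<phi> s"
  proof (cases "x < 0")
    case True
    then show ?thesis using jump_nonneg by (intro always_eventually) (auto intro: less_le_trans)
  next
    case False
    obtain x' where x': "x < x'" "x' < \<phi> r" using dense[OF x] by auto
    then have "x' > 0" using False by simp
    then have lt: "ennreal (r / T) < levy_tail \<pi> x'" using x' jump_gt_iff r by auto
    have "((\<lambda>s. ennreal (s / T)) \<longlongrightarrow> ennreal (r / T)) (at r)"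
      by (intro tendsto_ennrealI tendsto_intros) (use T in auto)
    then have "\<forall>\<^sub>F s in at r. ennreal (s / T) < levy_tail \<pi> x'" using lt by (rule order_tendstoD)
    moreover have "\<forall>\<^sub>F s in at r. s > 0"
      using r by (intro order_tendstoD(1)[OF tendsto_ident_at])
    ultimately show ?thesis
      by eventually_elim (use jump_gt_iff \<open>x' > 0\<close> x' in \<open>auto intro: less_trans\<close>)
  qed
next
  fix x assume x: "\<phi> r < x"
  obtain x2 where x2: "\<phi> r < x2" "x2 < x" using dense[OF x] by auto
  obtain x1 where x1: "\<phi> r < x1" "x1 < x2" using dense[OF x2(1)] by auto
  have x0: "x1 > 0" using x1 jump_nonneg[of r] by simp
  have "levy_tail \<pi> x1 \<le> ennreal (r / T)" using jump_gt_iff[of r x1] x1 x0 r by auto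
  then have lt: "levy_tail \<pi> x2 < ennreal (r / T)" using levy_tail_strict[of x1 x2] x1 x0 by auto
  have "((\<lambda>s. ennreal (s / T)) \<longlongrightarrow> ennreal (r / T)) (at r)"
    by (intro tendsto_ennrealI tendsto_intros) (use T in auto)
  then have "\<forall>\<^sub>F s in at r. levy_tail \<pi> x2 < ennreal (s / T)" using lt by (rule order_tendstoD)
  moreover have "\<forall>\<^sub>F s in at r. s > 0"
    using r by (intro order_tendstoD(1)[OF tendsto_ident_at])
  ultimately show "\<forall>\<^sub>F s in at r. \<phi> s < x"
  proof eventually_elim
    case (elim s)
    then have "\<not> x2 < \<phi> s"
      using jump_gt_iff[of s x2] x0 x1 by auto
    then show ?case using x2 by simp
  qed
qed

lemma jump_measurable [measurable]: "\<phi> \<in> borel_measurable borel"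
proof -
  have "(\<lambda>r. indicator {0<..} r *\<^sub>R \<phi> r) \<in> borel_measurable borel"
    by (rule borel_measurable_continuous_on_indicator)
      (auto intro!: continuous_at_imp_continuous_on jump_isCont)
  also have "(\<lambda>r. indicator {0<..} r *\<^sub>R \<phi> r) = \<phi>"
    using jump_nonpos_arg by (auto simp: fun_eq_iff indicator_def)
  finally show ?thesis .
qed

lemma emeasure_jump_image:
  assumes [measurable]: "S \<in> sets borel" "A \<in> sets borel"
  shows "emeasure (distr (density lborel (indicator S)) borel \<phi>) A = emeasure lborel {r. r \<in> S \<and> \<phi> r \<in> A}"
proof -
  have [measurable]: "\<phi> -` A \<in> sets borel"
    using measurable_sets[OF jump_measurable assms(2)] by simp
  have "emeasure (distr (density lborel (indicator S)) borel \<phi>) A = emeasure (density lborel (indicator S)) (\<phi> -` A)"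
    by (subst emeasure_distr) auto
  also have "\<dots> = (\<integral>\<^sup>+r. indicator {r. r \<in> S \<and> \<phi> r \<in> A} r \<partial>lborel)"
    by (subst emeasure_density, simp, simp, rule nn_integral_cong, simp split: split_indicator)
  also have "\<dots> = emeasure lborel {r. r \<in> S \<and> \<phi> r \<in> A}"
    by (rule nn_integral_indicator) measurable
  finally show ?thesis .
qed

text \<open>Above a positive level both measures are finite and can be compared on half-lines.\<close>

lemma distr_jump_above:
  assumes e: "e > 0"
  shows "distr (density lborel (indicator {r. 0 < r \<and> e < \<phi> r})) borel \<phi> =
    density lborel (\<lambda>x. ennreal (T * \<pi> x) * indicator {e<..} x)" (is "?L = ?R")
proof (rule measure_eqI_lessThan)
  fix x :: real
  define m where "m = max x e"
  have m: "m > 0" using e unfolding m_def by simp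
  obtain g where g: "levy_tail \<pi> m = ennreal g" "g \<ge> 0"
    using levy_tail_finite[OF m] by (cases "levy_tail \<pi> m") auto
  have "emeasure ?L {x<..} = emeasure lborel {r. r \<in> {r. 0 < r \<and> e < \<phi> r} \<and> \<phi> r \<in> {x<..}}"
    by (rule emeasure_jump_image) measurable
  also have "{r. r \<in> {r. 0 < r \<and> e < \<phi> r} \<and> \<phi> r \<in> {x<..}} = {r. 0 < r \<and> m < \<phi> r}"
    unfolding m_def by auto
  also have "\<dots> = {0<..<T * g}"
    using jump_gt_iff m T g by (auto simp: field_simps ennreal_less_iff)
  finally have L: "emeasure ?L {x<..} = ennreal (T * g)" using T g(2) by simp
  have "emeasure ?R {x<..} = (\<integral>\<^sup>+s. ennreal T * (ennreal (\<pi> s) * indicator {m<..} s) \<partial>lborel)"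
    unfolding m_def using T density_nonneg
    by (subst emeasure_density) (auto intro!: nn_integral_cong simp: ennreal_mult indicator_def)
  also have "\<dots> = ennreal T * levy_tail \<pi> m"
    unfolding levy_tail_def by (subst nn_integral_cmult) auto
  also have "\<dots> = ennreal (T * g)" using g T by (simp add: ennreal_mult)
  finally show "emeasure ?L {x<..} = emeasure ?R {x<..}" using L by simp
  show "emeasure ?L {x<..} < \<infinity>" using L by simp
qed simp_all

text \<open>Inversion of the tail carries Lebesgue measure on the arrival times to \<open>T\<close> times the Levy measure.\<close>

lemma distr_jump:
  "distr (density lborel (indicator {r. 0 < r \<and> 0 < \<phi> r})) borel \<phi> = density lborel (\<lambda>x. ennreal (T * \<pi> x))"
  (is "?L = ?R")
proof (rule measure_eqI)
  fix A assume "A \<in> sets ?L"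
  then have [measurable]: "A \<in> sets borel" by simp
  define e where "e n = inverse (real (Suc n))" for n
  have e: "e n > 0" "decseq e" for n
    unfolding e_def decseq_def by (auto simp: field_simps)
  have e3: "\<exists>n. e n < x" if "x > 0" for x
    using reals_Archimedean[OF that] unfolding e_def .
  have inc: "incseq (\<lambda>n. {r. 0 < r \<and> e n < \<phi> r \<and> \<phi> r \<in> A})" "incseq (\<lambda>n. A \<inter> {e n<..})"
    using e(2) by (auto simp: incseq_def decseq_def intro: le_less_trans)
  have "emeasure ?L A = emeasure lborel {r. 0 < r \<and> 0 < \<phi> r \<and> \<phi> r \<in> A}"
    by (subst emeasure_jump_image) (auto intro!: arg_cong[where f="emeasure lborel"])
  also have "{r. 0 < r \<and> 0 < \<phi> r \<and> \<phi> r \<in> A} = (\<Union>n. {r. 0 < r \<and> e n < \<phi> r \<and> \<phi> r \<in> A})"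
    using e(1) e3 by (auto intro: less_trans)
  also have "emeasure lborel \<dots> = (SUP n. emeasure lborel {r. 0 < r \<and> e n < \<phi> r \<and> \<phi> r \<in> A})"
    by (rule SUP_emeasure_incseq[symmetric]) (use inc in auto)
  also have "\<dots> = (SUP n. emeasure (distr (density lborel (indicator {r. 0 < r \<and> e n < \<phi> r})) borel \<phi>) A)"
    by (intro SUP_cong refl, subst emeasure_jump_image) (auto intro!: arg_cong[where f="emeasure lborel"])
  also have "\<dots> = (SUP n. emeasure ?R (A \<inter> {e n<..}))"
    unfolding distr_jump_above[OF e(1)]
    by (intro SUP_cong refl) (auto simp: emeasure_density intro!: nn_integral_cong split: split_indicator)
  also have "\<dots> = emeasure ?R (\<Union>n. A \<inter> {e n<..})"
    by (rule SUP_emeasure_incseq) (use inc in auto)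
  also have "(\<Union>n. A \<inter> {e n<..}) = A \<inter> {0<..}"
    using e(1) e3 by (auto intro: less_trans)
  also have "emeasure ?R (A \<inter> {0<..}) = emeasure ?R A"
    by (auto simp: emeasure_density zero intro!: nn_integral_cong split: split_indicator)
  finally show "emeasure ?L A = emeasure ?R A" .
qed simp

lemma
  fixes f :: "real \<Rightarrow> 'c::{banach, second_countable_topology}"
  assumes [measurable]: "f \<in> borel_measurable borel" and f0: "f 0 = 0"
  shows integral_jump: "(\<integral>r. indicator {0<..} r *\<^sub>R f (\<phi> r) \<partial>lborel) = T *\<^sub>R (\<integral>x. f x \<partial>\<nu>)" (is ?I)
    and integrable_jump: "integrable lborel (\<lambda>r. indicator {0<..} r *\<^sub>R f (\<phi> r)) \<longleftrightarrow> integrable \<nu> f" (is ?J)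
proof -
  have ind: "indicator {0<..} r *\<^sub>R f (\<phi> r) = indicator {r. 0 < r \<and> 0 < \<phi> r} r *\<^sub>R f (\<phi> r)" for r
    using f0 jump_nonneg[of r] by (auto simp: indicator_def)
  have d: "density lborel (indicator {r. 0 < r \<and> 0 < \<phi> r}) = density lborel (\<lambda>r. ennreal (indicator {r. 0 < r \<and> 0 < \<phi> r} r))"
    by (intro density_cong) (auto split: split_indicator)
  have "(\<integral>r. indicator {0<..} r *\<^sub>R f (\<phi> r) \<partial>lborel) = (\<integral>x. f x \<partial>density lborel (\<lambda>x. ennreal (T * \<pi> x)))"
    unfolding ind distr_jump[symmetric] d
    by (subst integral_distr, simp, simp, subst integral_density) auto
  also have "\<dots> = T *\<^sub>R (\<integral>x. f x \<partial>\<nu>)"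
    unfolding density_measure_def using T density_nonneg
    by (subst (1 2) integral_density) (auto simp: scaleR_scaleR[symmetric] simp del: scaleR_scaleR)
  finally show ?I .
  have "integrable lborel (\<lambda>r. indicator {0<..} r *\<^sub>R f (\<phi> r)) \<longleftrightarrow> integrable (density lborel (\<lambda>x. ennreal (T * \<pi> x))) f"
    unfolding ind distr_jump[symmetric] d
    by (subst integrable_distr_eq, simp, simp, subst integrable_density) auto
  also have "\<dots> \<longleftrightarrow> integrable \<nu> f"
  proof -
    have "integrable lborel (\<lambda>x. T *\<^sub>R g x) \<longleftrightarrow> integrable lborel g" for g :: "real \<Rightarrow> 'c"
      using T integrable_scaleR_right[of "1 / T" lborel "\<lambda>x. T *\<^sub>R g x"] integrable_scaleR_right[of T lborel g] by auto
    then show ?thesis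
      unfolding density_measure_def using T density_nonneg
      by (subst (1 2) integrable_density) (auto simp: scaleR_scaleR[symmetric] simp del: scaleR_scaleR)
  qed
  finally show ?J .
qed

end

section \<open>The Karhunen-Loeve kernels and the Levy exponent\<close>

text \<open>The kernel for a jump of size one as a function of the jump time. It is the integral of the \<open>k\<close>-th
  basis function over \<open>[t, T]\<close>, the form in which the basis function meets the increments of the process.\<close>

definition kl_profile :: "real \<Rightarrow> nat \<Rightarrow> real \<Rightarrow> real" where
  "kl_profile T k t = kl_f T k 1 t"

lemma shot_H_factor: "shot_H T \<pi> k r v = jump_size T \<pi> r * kl_profile T k (T * v)"
  by (simp add: shot_H_def jump_size_def kl_profile_def kl_f_def)

lemma kl_profile_deriv:
  assumes T: "T > 0" and k: "k \<ge> 1"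
  shows "(kl_profile T k has_real_derivative - (sqrt (2 / T) * sin (pi / T * (real k - 1/2) * t))) (at t)"
proof -
  have k0: "real k - 1/2 \<noteq> 0" using k by simp
  have s: "sqrt (2 * T) / T = sqrt (2 / T)"
    using T by (simp add: real_sqrt_mult real_sqrt_divide field_simps)
  have "(kl_profile T k has_real_derivative
      sqrt (2 * T) / pi * (- (sin (pi / T * (real k - 1/2) * t) * (pi / T * (real k - 1/2))) / (real k - 1/2))) (at t)"
    unfolding kl_profile_def kl_f_def using k0 T by (auto intro!: derivative_eq_intros)
  also have "sqrt (2 * T) / pi * (- (sin (pi / T * (real k - 1/2) * t) * (pi / T * (real k - 1/2))) / (real k - 1/2)) =
      - (sqrt (2 * T) / T * sin (pi / T * (real k - 1/2) * t))"
    using k0 T by simp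
  finally show ?thesis unfolding s .
qed

lemma kl_profile_T: assumes "T > 0" "k \<ge> 1" shows "kl_profile T k T = 0"
proof -
  have "pi / T * (real k - 1/2) * T = pi * real (k - 1) + pi / 2" using assms by (simp add: field_simps of_nat_diff)
  then have "cos (pi / T * (real k - 1/2) * T) = 0" by (simp add: cos_add)
  then show ?thesis by (simp add: kl_profile_def kl_f_def)
qed

lemma kl_profile_cont: "continuous_on UNIV (kl_profile T k)"
  unfolding kl_profile_def kl_f_def divide_inverse by (intro continuous_intros)

lemma kl_profile_measurable [measurable]: "kl_profile T k \<in> borel_measurable borel"
  by (rule borel_measurable_continuous_onI[OF kl_profile_cont])

lemma kl_profile_bounded: "\<bar>kl_profile T k t\<bar> \<le> \<bar>sqrt (2 * T) / pi / (real k - 1/2)\<bar>"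
  using mult_left_mono[OF abs_cos_le_one[of "pi / T * (real k - 1/2) * t"], of "\<bar>sqrt (2 * T) / pi / (real k - 1/2)\<bar>"]
  by (simp add: kl_profile_def kl_f_def abs_mult abs_divide)

lemma integral_kl_profile:
  assumes T: "T > 0" and k: "k \<ge> 1"
  shows "a * (LBINT t:{0..T}. kl_profile T k t) = drift_coeff T a k"
proof -
  define m where "m = real k - 1/2"
  have m: "m > 0" using k unfolding m_def by simp
  define G where "G t = sqrt (2 * T) / pi / m * (sin (pi / T * m * t) / (pi / T * m))" for t
  have "(LBINT t:{0..T}. kl_profile T k t) = G T - G 0"
    unfolding set_lebesgue_integral_def real_scaleR_def mult.commute[of "indicator _ _"]
  proof (rule integral_FTC_Icc_real)
    show "(G has_real_derivative kl_profile T k x) (at x)" for x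
      unfolding G_def kl_profile_def kl_f_def m_def[symmetric] using m T
      by (auto intro!: derivative_eq_intros)
    show "isCont (kl_profile T k) x" for x using kl_profile_cont by (simp add: continuous_on_eq_continuous_at)
  qed (use T in simp)
  also have "\<dots> = sqrt (2 * T) * T / (pi\<^sup>2 * m\<^sup>2) * sin (pi * m)"
    using T m by (simp add: G_def power2_eq_square mult_ac)
  also have "sin (pi * m) = (-1) ^ (k + 1)"
  proof -
    have "pi * m = pi * real (k - 1) + pi / 2" using k by (simp add: m_def field_simps of_nat_diff)
    then have "sin (pi * m) = cos (real (k - 1) * pi)" by (simp add: sin_add mult.commute)
    also have "\<dots> = (-1) ^ (k - 1)" by (rule cos_npi)
    also have "\<dots> = (-1) ^ (k + 1)" using k by (cases k) auto
    finally show ?thesis .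
  qed
  also have "sqrt (2 * T) * T = sqrt 2 * T powr (3/2)"
  proof -
    have "T powr (3/2) = T powr (1 + 1/2)" by simp
    also have "\<dots> = T * sqrt T" using T by (subst powr_add) (simp add: powr_half_sqrt)
    finally show ?thesis by (simp add: real_sqrt_mult)
  qed
  finally show ?thesis unfolding drift_coeff_def m_def by (simp add: mult_ac)
qed

lemma integral_unif:
  fixes f :: "real \<Rightarrow> 'x::{banach, second_countable_topology}"
  assumes [measurable]: "f \<in> borel_measurable borel"
  shows "(\<integral>u. f u \<partial>unif) = (LBINT u:{0..1}. f u)"
proof -
  have u: "unif = density lborel (\<lambda>u. ennreal (indicator {0..1} u))"
    unfolding unif_def uniform_measure_def by (intro density_cong) (auto split: split_indicator)
  show ?thesis unfolding u set_lebesgue_integral_def by (subst integral_density) auto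
qed

lemma integral_unif_scaled:
  fixes f :: "real \<Rightarrow> 'x::{banach, second_countable_topology}"
  assumes [measurable]: "f \<in> borel_measurable borel" and T: "T > 0"
  shows "T *\<^sub>R (\<integral>u. f (T * u) \<partial>unif) = (LBINT t:{0..T}. f t)"
proof -
  have ind: "indicator {0..T} (0 + T * u) = (indicator {0..1} u :: real)" for u
    using T by (auto simp: indicator_def zero_le_mult_iff)
  have "(LBINT t:{0..T}. f t) = \<bar>T\<bar> *\<^sub>R (\<integral>u. indicator {0..T} (0 + T * u) *\<^sub>R f (0 + T * u) \<partial>lborel)"
    unfolding set_lebesgue_integral_def using T by (intro lborel_integral_real_affine) simp
  then show ?thesis unfolding ind using T by (simp add: integral_unif set_lebesgue_integral_def)
qed

text \<open>The integrand of the Levy exponent with constant cut-off \<open>c\<close>. Both parts of the theorem run through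
  the same argument with \<open>c = 0\<close> and \<open>c = 1\<close>.\<close>

definition comp_exp :: "real \<Rightarrow> real \<Rightarrow> complex" where
  "comp_exp c y = iexp y - 1 - \<i> * of_real (c * y)"

lemma comp_exp_bounds:
  "norm (comp_exp 0 y) \<le> \<bar>y\<bar>" "norm (comp_exp 0 y) \<le> 2" "norm (comp_exp 1 y) \<le> y\<^sup>2" "norm (comp_exp 1 y) \<le> 2 * \<bar>y\<bar>"
proof -
  show "norm (comp_exp 0 y) \<le> \<bar>y\<bar>" using iexp_approx1[of y 0] by (simp add: comp_exp_def)
  show "norm (comp_exp 0 y) \<le> 2" using norm_triangle_ineq4[of "iexp y" 1] by (simp add: comp_exp_def)
  have "norm (comp_exp 1 y) \<le> y\<^sup>2 / 2" using iexp_approx1[of y 1] by (simp add: comp_exp_def diff_diff_eq power2_eq_square)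
  then show "norm (comp_exp 1 y) \<le> y\<^sup>2" using zero_le_power2[of y] by linarith
  show "norm (comp_exp 1 y) \<le> 2 * \<bar>y\<bar>" using iexp_approx2[of y 1] by (simp add: comp_exp_def diff_diff_eq)
qed

text \<open>The order of magnitude of \<open>comp_exp c x\<close>: linear at \<open>0\<close> and bounded for \<open>c = 0\<close>, quadratic at \<open>0\<close> and
  linear at infinity for \<open>c = 1\<close>.\<close>

definition comp_dom :: "real \<Rightarrow> real \<Rightarrow> real" where
  "comp_dom c x = (if c = 0 then min 1 \<bar>x\<bar> else min \<bar>x\<bar> (x\<^sup>2))"

lemma comp_dom_simps [simp]: "comp_dom c 0 = 0" "0 \<le> comp_dom c x"
  by (auto simp: comp_dom_def)

lemma comp_dom_measurable [measurable]: "comp_dom c \<in> borel_measurable borel"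
  unfolding comp_dom_def[abs_def] by measurable

lemma comp_exp_measurable [measurable]: "comp_exp c \<in> borel_measurable borel"
  unfolding comp_exp_def[abs_def] by measurable

lemma comp_exp_cont: "continuous_on UNIV (comp_exp c)"
  unfolding comp_exp_def[abs_def] by (intro continuous_intros)

lemma comp_exp_dominated:
  assumes c: "c = 0 \<or> c = 1" and z: "\<bar>z\<bar> \<le> K"
  shows "norm (comp_exp c (z * x)) \<le> (K\<^sup>2 + 2 * K + 2) * comp_dom c x"
proof -
  have K: "0 \<le> K" using z by linarith
  define C where "C = K\<^sup>2 + 2 * K + 2"
  have C: "K \<le> C" "2 \<le> C" "2 * K \<le> C" "K\<^sup>2 \<le> C" using K unfolding C_def by simp_all
  have zx: "\<bar>z * x\<bar> \<le> K * \<bar>x\<bar>" "(z * x)\<^sup>2 \<le> K\<^sup>2 * x\<^sup>2"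
    using z by (auto simp: abs_mult power_mult_distrib intro!: mult_right_mono) (metis abs_le_square_iff abs_of_nonneg K)
  show ?thesis
  proof (cases "c = 0")
    case True
    have "norm (comp_exp 0 (z * x)) \<le> C * \<bar>x\<bar>"
      using comp_exp_bounds(1)[of "z * x"] zx(1) mult_right_mono[OF C(1), of "\<bar>x\<bar>"] by simp
    moreover have "norm (comp_exp 0 (z * x)) \<le> C * 1" using comp_exp_bounds(2)[of "z * x"] C by simp
    ultimately show ?thesis using True unfolding C_def[symmetric] comp_dom_def by (simp add: min_def)
  next
    case False
    then have c1: "c = 1" using c by simp
    have "norm (comp_exp 1 (z * x)) \<le> C * \<bar>x\<bar>"
      using comp_exp_bounds(4)[of "z * x"] zx(1) mult_right_mono[OF C(3), of "\<bar>x\<bar>"] by simp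
    moreover have "norm (comp_exp 1 (z * x)) \<le> C * x\<^sup>2"
      using comp_exp_bounds(3)[of "z * x"] zx(2) mult_right_mono[OF C(4), of "x\<^sup>2"] by simp
    ultimately show ?thesis using c1 unfolding C_def[symmetric] comp_dom_def by (simp add: min_def)
  qed
qed

text \<open>Conversely, integrability of the exponent integrand at the single point \<open>z = 1\<close> controls the moments
  of the Levy measure. For small \<open>x\<close> with \<open>c = 0\<close> and for large \<open>x\<close> with \<open>c = 1\<close> this follows since \<open>i x\<close> is the
  difference of the two compensated exponentials.\<close>

lemma comp_dom_le:
  assumes c: "c = 0 \<or> c = 1"
  shows "comp_dom c x \<le> norm (comp_exp c x) + 2 * min 1 (x\<^sup>2)"
proof -
  have d: "\<bar>x\<bar> \<le> norm (comp_exp 0 x) + norm (comp_exp 1 x)"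
  proof -
    have "\<i> * of_real x = comp_exp 0 x - comp_exp 1 x" by (simp add: comp_exp_def)
    then have "norm (\<i> * complex_of_real x) \<le> norm (comp_exp 0 x) + norm (comp_exp 1 x)"
      using norm_triangle_ineq4 by metis
    then show ?thesis by (simp add: norm_mult)
  qed
  have sq: "x\<^sup>2 \<le> 1 \<longleftrightarrow> \<bar>x\<bar> \<le> 1" by (rule abs_square_le_1)
  show ?thesis
  proof (cases "\<bar>x\<bar> \<le> 1")
    case True
    then have x2: "min 1 (x\<^sup>2) = x\<^sup>2" using sq by simp
    have "\<bar>x\<bar> \<le> norm (comp_exp 0 x) + 2 * x\<^sup>2"
      using d comp_exp_bounds(3)[of x] zero_le_power2[of x] by linarith
    moreover have "x\<^sup>2 \<le> norm (comp_exp 1 x) + 2 * x\<^sup>2"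
      using norm_ge_zero[of "comp_exp 1 x"] zero_le_power2[of x] by linarith
    ultimately show ?thesis
      using c unfolding x2 comp_dom_def by (elim disjE) (auto simp: min_le_iff_disj)
  next
    case False
    then have x2: "min 1 (x\<^sup>2) = 1" using sq by simp
    have "\<bar>x\<bar> \<le> norm (comp_exp 1 x) + 2"
      using d comp_exp_bounds(2)[of x] by linarith
    moreover have "1 \<le> norm (comp_exp 0 x) + 2" using norm_ge_zero[of "comp_exp 0 x"] by linarith
    ultimately show ?thesis
      using c unfolding x2 comp_dom_def by (elim disjE) (auto simp: min_le_iff_disj)
  qed
qed

section \<open>The law of the Karhunen-Loeve coefficients\<close>

locale kl_shot_noise = scaled_levy_density \<pi> T + marked_arrivals N U E
  for \<pi> T and N :: "'b measure" and U E
begin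

definition kl_mean :: "nat \<Rightarrow> real" where
  "kl_mean k = (\<integral>u. kl_profile T k (T * u) \<partial>unif)"

definition comp_int :: "real \<Rightarrow> real \<Rightarrow> complex" where
  "comp_int c z = (\<integral>x. comp_exp c (z * x) \<partial>\<nu>)"

lemma comp_exp_integrable:
  assumes c: "c = 0 \<or> c = 1" and dom: "integrable \<nu> (comp_dom c)"
  shows "integrable \<nu> (\<lambda>x. comp_exp c (z * x))"
proof (rule Bochner_Integration.integrable_bound[OF integrable_mult_right[OF dom, of "\<bar>z\<bar>\<^sup>2 + 2 * \<bar>z\<bar> + 2"]])
  show "AE x in \<nu>. norm (comp_exp c (z * x)) \<le> norm ((\<bar>z\<bar>\<^sup>2 + 2 * \<bar>z\<bar> + 2) * comp_dom c x)"
    using comp_exp_dominated[OF c, of z "\<bar>z\<bar>"] by (intro AE_I2 order_trans[OF _ abs_ge_self[folded real_norm_def]]) auto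
qed simp

lemma comp_int_cont:
  assumes c: "c = 0 \<or> c = 1" and dom: "integrable \<nu> (comp_dom c)"
  shows "continuous_on UNIV (comp_int c)"
  unfolding continuous_on_eq_continuous_at[OF open_UNIV]
proof
  fix z :: real
  show "isCont (comp_int c) z"
    unfolding continuous_at_sequentially
  proof (intro allI impI)
    fix s assume s: "s \<longlonglongrightarrow> z"
    then obtain K where K: "\<And>n. \<bar>s n\<bar> \<le> K" using convergent_imp_Bseq[of s] by (auto simp: convergent_def Bseq_def)
    show "(comp_int c \<circ> s) \<longlonglongrightarrow> comp_int c z"
      unfolding comp_int_def o_def
    proof (rule integral_dominated_convergence[where w="\<lambda>x. (K\<^sup>2 + 2 * K + 2) * comp_dom c x"])
      show "integrable \<nu> (\<lambda>x. (K\<^sup>2 + 2 * K + 2) * comp_dom c x)" by (intro integrable_mult_right dom)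
      show "AE x in \<nu>. norm (comp_exp c (s n * x)) \<le> (K\<^sup>2 + 2 * K + 2) * comp_dom c x" for n
        using comp_exp_dominated[OF c K] by simp
      have "isCont (comp_exp c) y" for y using comp_exp_cont by (simp add: continuous_on_eq_continuous_at)
      then show "AE x in \<nu>. (\<lambda>n. comp_exp c (s n * x)) \<longlonglongrightarrow> comp_exp c (z * x)"
        by (intro AE_I2 isCont_tendsto_compose[of _ "comp_exp c"] tendsto_intros s)
    qed simp_all
  qed
qed

text \<open>Change of variables from arrival times to jump sizes, followed by Fubini: the limit in
  \<open>char_of_compensated_limit\<close> is the average of the Levy exponent over the marks.\<close>

lemma jump_integral_comp_exp:
  fixes p :: "real \<Rightarrow> real" and K :: real
  assumes c: "c = 0 \<or> c = 1" and dom: "integrable \<nu> (comp_dom c)"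
    and p[measurable]: "p \<in> borel_measurable borel" and K: "\<And>u. \<bar>p u\<bar> \<le> K"
  shows "set_integrable lborel {0<..} (\<lambda>r. (CLINT u|unif. iexp (\<phi> r * p u)) - 1 - \<i> * of_real (c * (\<integral>u. p u \<partial>unif) * \<phi> r))"
    and "(CLBINT r:{0<..}. (CLINT u|unif. iexp (\<phi> r * p u)) - 1 - \<i> * of_real (c * (\<integral>u. p u \<partial>unif) * \<phi> r)) =
      T *\<^sub>R (CLINT u|unif. comp_int c (p u))"
proof -
  interpret unif: prob_space unif by (rule prob_space_unif)
  define \<kappa> where "\<kappa> x = (CLINT u|unif. comp_exp c (p u * x))" for x
  have [measurable]: "\<kappa> \<in> borel_measurable borel" unfolding \<kappa>_def by measurable
  have ip: "integrable unif p" by (rule unif.integrable_const_bound[of _ K]) (use K in auto)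
  have \<kappa>: "(CLINT u|unif. iexp (x * p u)) - 1 - \<i> * of_real (c * (\<integral>u. p u \<partial>unif) * x) = \<kappa> x" for x
  proof -
    have "integrable unif (\<lambda>u. iexp (x * p u))"
      by (rule unif.integrable_const_bound[of _ 1]) auto
    then have "(CLINT u|unif. iexp (x * p u) - 1 - \<i> * of_real (c * x) * of_real (p u)) =
      (CLINT u|unif. iexp (x * p u)) - 1 - \<i> * of_real (c * x) * of_real (\<integral>u. p u \<partial>unif)"
      using ip unif.prob_space by simp
    then show ?thesis unfolding \<kappa>_def comp_exp_def by (simp add: mult_ac)
  qed
  have \<kappa>0: "\<kappa> 0 = 0" unfolding \<kappa>_def comp_exp_def by simp
  define C where "C = K\<^sup>2 + 2 * K + 2"
  have sf: "sigma_finite_measure \<nu>"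
    unfolding density_measure_def
    by (subst sigma_finite_measure.sigma_finite_iff_density_finite[OF lborel.sigma_finite_measure_axioms]) auto
  interpret P: pair_sigma_finite unif \<nu>
    unfolding pair_sigma_finite_def using sf unif.sigma_finite_measure_axioms by blast
  have Cdom: "integrable \<nu> (\<lambda>x. C * comp_dom c x)" by (intro integrable_mult_right dom)
  have bnd: "norm (comp_exp c (p u * x)) \<le> C * comp_dom c x" for u x
    unfolding C_def by (rule comp_exp_dominated[OF c K])
  have C0: "0 \<le> C * comp_dom c x" for x using order_trans[OF norm_ge_zero bnd] .
  have I: "integrable (unif \<Otimes>\<^sub>M \<nu>) (\<lambda>(u, x). comp_exp c (p u * x))"
  proof (rule Bochner_Integration.integrable_bound)
    show "integrable (unif \<Otimes>\<^sub>M \<nu>) (\<lambda>(u, x). C * comp_dom c x)"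
    proof (rule P.Fubini_integrable)
      show "(\<lambda>(u, x). C * comp_dom c x) \<in> borel_measurable (unif \<Otimes>\<^sub>M \<nu>)" by measurable
      show "integrable unif (\<lambda>u. \<integral>x. norm (case (u, x) of (u, x) \<Rightarrow> C * comp_dom c x) \<partial>\<nu>)" by simp
    qed (use Cdom in simp)
    show "AE z in unif \<Otimes>\<^sub>M \<nu>. norm (case z of (u, x) \<Rightarrow> comp_exp c (p u * x)) \<le> norm (case z of (u, x) \<Rightarrow> C * comp_dom c x)"
      using bnd C0 by (intro AE_I2) (auto simp: abs_of_nonneg)
  qed measurable
  have \<kappa>_int: "integrable \<nu> \<kappa>"
    using P.integrable_snd[OF I] unfolding \<kappa>_def .
  have "(\<integral>x. \<kappa> x \<partial>\<nu>) = (CLINT u|unif. comp_int c (p u))"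
    using P.Fubini_integral[OF I] unfolding \<kappa>_def comp_int_def .
  then show "(CLBINT r:{0<..}. (CLINT u|unif. iexp (\<phi> r * p u)) - 1 - \<i> * of_real (c * (\<integral>u. p u \<partial>unif) * \<phi> r)) =
      T *\<^sub>R (CLINT u|unif. comp_int c (p u))"
    unfolding \<kappa> set_lebesgue_integral_def by (subst integral_jump) (use \<kappa>0 in auto)
  show "set_integrable lborel {0<..} (\<lambda>r. (CLINT u|unif. iexp (\<phi> r * p u)) - 1 - \<i> * of_real (c * (\<integral>u. p u \<partial>unif) * \<phi> r))"
    unfolding \<kappa> set_integrable_def by (subst integrable_jump) (use \<kappa>0 \<kappa>_int in auto)
qed

text \<open>Both characteristic functions at \<open>\<theta>\<close> equal the exponential of the time integral of \<open>- \<Psi> (W t)\<close>, where \<open>W\<close> is the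
  combination of the kernels with coefficients \<open>\<theta>\<close>: a uniform mark is a uniform jump time.\<close>

lemma kl_coeffs_law:
  fixes M :: "'a measure" and X :: "real \<Rightarrow> 'a \<Rightarrow> real" and V :: "nat \<Rightarrow> 'b \<Rightarrow> real"
  assumes c: "c = 0 \<or> c = 1" and dom: "integrable \<nu> (comp_dom c)"
    and X: "levy_process M X"
    and ch: "\<And>t z. t \<ge> 0 \<Longrightarrow> char (distr M borel (X t)) z = exp (- of_real t * (- \<i> * of_real (a * z) - comp_int c z))"
    and int2: "\<And>s. set_integrable lborel {0<..s} (\<lambda>r. c * \<phi> r)"
    and V: "\<And>k. k \<in> {1..d} \<Longrightarrow> V k \<in> borel_measurable N"
    and lim: "\<And>k. k \<in> {1..d} \<Longrightarrow> AE \<omega> in N. (\<lambda>n. (\<Sum>j<n. \<phi> (\<Gamma> (Suc j) \<omega>) * kl_profile T k (T * U (Suc j) \<omega>))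
        - kl_mean k * (LBINT r:{0<..\<Gamma> n \<omega>}. c * \<phi> r)) \<longlonglongrightarrow> V k \<omega>"
  shows "kl_coeffs_distr d T M X N (\<lambda>k \<omega>. drift_coeff T a k + V k \<omega>)"
proof -
  define \<Psi> where "\<Psi> z = - \<i> * of_real (a * z) - comp_int c z" for z
  have \<Psi>_cont: "continuous_on UNIV \<Psi>"
    unfolding \<Psi>_def by (intro continuous_intros comp_int_cont[OF c dom])
  define w where "w k t = sqrt (2 / T) * sin (pi / T * (real k - 1/2) * t)" for k t
  have w_cont: "continuous_on UNIV (w k)" for k unfolding w_def by (intro continuous_intros)
  have w_deriv: "(kl_profile T k has_real_derivative - w k t) (at t)" if "k \<in> {1..d}" for k t
    unfolding w_def using that by (intro kl_profile_deriv T) auto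
  have path: "weighted_levy_path M X \<Psi> T (\<lambda>t. \<Sum>k\<in>{1..d}. \<theta> k * w k t) (\<lambda>t. \<Sum>k\<in>{1..d}. \<theta> k * kl_profile T k t)" for \<theta> :: "nat \<Rightarrow> real"
  proof
    show "char (distr M borel (X t)) z = exp (- of_real t * \<Psi> z)" if "t \<ge> 0" for t z
      unfolding \<Psi>_def by (rule ch[OF that])
    show "continuous_on UNIV (\<lambda>t. \<Sum>k\<in>{1..d}. \<theta> k * w k t)" by (intro continuous_intros w_cont)
    show "((\<lambda>t. \<Sum>k\<in>{1..d}. \<theta> k * kl_profile T k t) has_real_derivative - (\<Sum>k\<in>{1..d}. \<theta> k * w k t)) (at t)" for t
      unfolding sum_negf[symmetric] mult_minus_right[symmetric]
      by (intro DERIV_sum DERIV_cmult w_deriv)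
    show "(\<Sum>k\<in>{1..d}. \<theta> k * kl_profile T k T) = 0" using kl_profile_T[OF T] by (intro sum.neutral) auto
  qed (use X T \<Psi>_cont in auto)
  have path1: "weighted_levy_path M X \<Psi> T (w k) (kl_profile T k)" if "k \<in> {1..d}" for k
  proof
    show "char (distr M borel (X t)) z = exp (- of_real t * \<Psi> z)" if "t \<ge> 0" for t z
      unfolding \<Psi>_def by (rule ch[OF that])
    show "(kl_profile T k has_real_derivative - w k t) (at t)" for t
      using that by (rule w_deriv)
    show "kl_profile T k T = 0" using that by (intro kl_profile_T T) auto
  qed (use X T \<Psi>_cont w_cont in auto)
  have Z: "kl_coeff T X k = (\<lambda>\<omega>. LBINT t:{0..T}. X t \<omega> * w k t)" for k
    by (simp add: fun_eq_iff kl_coeff_def w_def)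
  have Z_meas: "kl_coeff T X k \<in> borel_measurable (completion M)" if "k \<in> {1..d}" for k
    unfolding Z by (rule weighted_levy_path.path_integral_measurable[OF path1[OF that]])
  have "prob_space M" using X unfolding levy_process_def by simp
  then have pM: "prob_space (completion M)"
    by (intro prob_spaceI) (simp add: prob_space.emeasure_space_1)
  interpret unif: prob_space unif by (rule prob_space_unif)
  define B where "B k = \<bar>sqrt (2 * T) / pi / (real k - 1/2)\<bar>" for k :: nat
  have law: "distr (completion M) (PiM {1..d} (\<lambda>_. borel)) (\<lambda>\<omega>. \<lambda>k\<in>{1..d}. kl_coeff T X k \<omega>) =
    distr N (PiM {1..d} (\<lambda>_. borel)) (\<lambda>\<omega>. \<lambda>k\<in>{1..d}. drift_coeff T a k + V k \<omega>)"
  proof (rule joint_char_determines_law[OF pM prob_space_axioms])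
    fix \<theta> :: "nat \<Rightarrow> real"
    interpret W: weighted_levy_path M X \<Psi> T "\<lambda>t. \<Sum>k\<in>{1..d}. \<theta> k * w k t" "\<lambda>t. \<Sum>k\<in>{1..d}. \<theta> k * kl_profile T k t"
      by (rule path)
    define W where "W t = (\<Sum>k\<in>{1..d}. \<theta> k * kl_profile T k t)" for t
    define p where "p u = W (T * u)" for u
    have W_cont: "continuous_on UNIV W" unfolding W_def by (intro continuous_intros kl_profile_cont)
    have [measurable]: "W \<in> borel_measurable borel" by (rule borel_measurable_continuous_onI[OF W_cont])
    have [measurable]: "p \<in> borel_measurable borel" unfolding p_def by measurable
    have p_le: "\<bar>p u\<bar> \<le> (\<Sum>k\<in>{1..d}. \<bar>\<theta> k\<bar> * B k)" for u
      unfolding p_def W_def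
    proof (rule order_trans[OF sum_abs], rule sum_mono)
      fix k
      show "\<bar>\<theta> k * kl_profile T k (T * u)\<bar> \<le> \<bar>\<theta> k\<bar> * B k"
        unfolding abs_mult B_def by (rule mult_left_mono[OF kl_profile_bounded]) simp
    qed
    have ik: "integrable unif (\<lambda>u. kl_profile T k (T * u))" for k
      by (rule unif.integrable_const_bound[of _ "B k"]) (use kl_profile_bounded in \<open>auto simp: B_def\<close>)
    have qbar: "(\<integral>u. p u \<partial>unif) = (\<Sum>k\<in>{1..d}. \<theta> k * kl_mean k)"
      unfolding p_def W_def kl_mean_def using ik by simp
    \<comment> \<open>Almost surely the path is integrable against each sine, so the pathwise integral is linear in the weight.\<close>
    have lin: "AE \<omega> in completion M. (\<Sum>k\<in>{1..d}. \<theta> k * kl_coeff T X k \<omega>) = (LBINT t:{0..T}. X t \<omega> * (\<Sum>k\<in>{1..d}. \<theta> k * w k t))"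
    proof -
      have "AE \<omega> in M. \<forall>k\<in>{1..d}. set_integrable lborel {0..T} (\<lambda>t. X t \<omega> * w k t)"
        using weighted_levy_path.AE_path[OF path1] by (intro AE_finite_allI) (auto elim: AE_mp)
      then show ?thesis
      proof (rule AE_mp[OF AE_completion], intro AE_I2 impI)
        fix \<omega> assume i: "\<forall>k\<in>{1..d}. set_integrable lborel {0..T} (\<lambda>t. X t \<omega> * w k t)"
        have "(LBINT t:{0..T}. X t \<omega> * (\<Sum>k\<in>{1..d}. \<theta> k * w k t)) =
          (\<integral>t. (\<Sum>k\<in>{1..d}. \<theta> k * (indicator {0..T} t *\<^sub>R (X t \<omega> * w k t))) \<partial>lborel)"
          unfolding set_lebesgue_integral_def
          by (intro Bochner_Integration.integral_cong refl) (simp add: sum_distrib_left mult_ac)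
        also have "\<dots> = (\<Sum>k\<in>{1..d}. \<theta> k * (LBINT t:{0..T}. X t \<omega> * w k t))"
          using i unfolding set_integrable_def set_lebesgue_integral_def
          by (subst Bochner_Integration.integral_sum) (auto intro!: integrable_mult_right)
        finally show "(\<Sum>k\<in>{1..d}. \<theta> k * kl_coeff T X k \<omega>) = (LBINT t:{0..T}. X t \<omega> * (\<Sum>k\<in>{1..d}. \<theta> k * w k t))"
          unfolding Z by simp
      qed
    qed
    have "(CLINT \<omega>|completion M. iexp (\<Sum>k\<in>{1..d}. \<theta> k * kl_coeff T X k \<omega>)) =
      (CLINT \<omega>|completion M. iexp (LBINT t:{0..T}. X t \<omega> * (\<Sum>k\<in>{1..d}. \<theta> k * w k t)))"
    proof (rule integral_cong_AE)
      have [measurable]: "(\<lambda>\<omega>. \<Sum>k\<in>{1..d}. \<theta> k * kl_coeff T X k \<omega>) \<in> borel_measurable (completion M)"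
        by (intro borel_measurable_sum borel_measurable_times Z_meas borel_measurable_const)
      note [measurable] = W.path_integral_measurable
      show "(\<lambda>\<omega>. iexp (\<Sum>k\<in>{1..d}. \<theta> k * kl_coeff T X k \<omega>)) \<in> borel_measurable (completion M)" by measurable
      show "(\<lambda>\<omega>. iexp (LBINT t:{0..T}. X t \<omega> * (\<Sum>k\<in>{1..d}. \<theta> k * w k t))) \<in> borel_measurable (completion M)" by measurable
      show "AE \<omega> in completion M. iexp (\<Sum>k\<in>{1..d}. \<theta> k * kl_coeff T X k \<omega>) = iexp (LBINT t:{0..T}. X t \<omega> * (\<Sum>k\<in>{1..d}. \<theta> k * w k t))"
        using lin by eventually_elim simp
    qed
    also have "\<dots> = exp (- (CLBINT t:{0..T}. \<Psi> (W t)))"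
      unfolding W_def by (rule W.char_path_integral)
    also have "- (CLBINT t:{0..T}. \<Psi> (W t)) = \<i> * of_real (a * (LBINT t:{0..T}. W t)) + T *\<^sub>R (CLINT u|unif. comp_int c (p u))"
    proof -
      have comp[measurable]: "comp_int c \<in> borel_measurable borel"
        by (rule borel_measurable_continuous_onI[OF comp_int_cont[OF c dom]])
      have i1: "set_integrable lborel {0..T} (\<lambda>t. of_real (W t) :: complex)"
        by (rule borel_integrable_compact[of "{0..T}", folded set_integrable_def])
          (auto intro!: continuous_intros continuous_on_subset[OF W_cont])
      have i2: "set_integrable lborel {0..T} (\<lambda>t. comp_int c (W t))"
        by (rule borel_integrable_compact[of "{0..T}", folded set_integrable_def])
          (auto intro!: continuous_on_compose2[OF comp_int_cont[OF c dom] continuous_on_subset[OF W_cont]])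
      have "(CLBINT t:{0..T}. \<Psi> (W t)) = (CLBINT t:{0..T}. (- \<i> * of_real a) * of_real (W t) - comp_int c (W t))"
        by (simp add: \<Psi>_def mult.assoc)
      also have "\<dots> = (- \<i> * of_real a) * of_real (LBINT t:{0..T}. W t) - (CLBINT t:{0..T}. comp_int c (W t))"
      proof -
        have "set_integrable lborel {0..T} (\<lambda>t. (- \<i> * of_real a) * of_real (W t))"
          by (rule set_integrable_mult_right) (use i1 in simp)
        from set_integral_diff(2)[OF this i2] show ?thesis
          by (simp only: set_integral_mult_right set_integral_complex_of_real)
      qed
      also have "(CLBINT t:{0..T}. comp_int c (W t)) = T *\<^sub>R (CLINT u|unif. comp_int c (p u))"
        unfolding p_def by (rule integral_unif_scaled[symmetric]) (use T in measurable)
      finally show ?thesis by simp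
    qed
    also have "(LBINT t:{0..T}. W t) = (\<Sum>k\<in>{1..d}. \<theta> k * (LBINT t:{0..T}. kl_profile T k t))"
    proof -
      have "set_integrable lborel {0..T} (kl_profile T k)" for k
        by (rule borel_integrable_compact[of "{0..T}", folded set_integrable_def])
          (auto intro!: continuous_on_subset[OF kl_profile_cont])
      then have i: "integrable lborel (\<lambda>t. \<theta> k * (indicator {0..T} t *\<^sub>R kl_profile T k t))" for k
        unfolding set_integrable_def by (intro integrable_mult_right)
      have "(LBINT t:{0..T}. W t) = (\<integral>t. (\<Sum>k\<in>{1..d}. \<theta> k * (indicator {0..T} t *\<^sub>R kl_profile T k t)) \<partial>lborel)"
        unfolding set_lebesgue_integral_def W_def
        by (intro Bochner_Integration.integral_cong refl) (simp add: sum_distrib_left mult_ac)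
      also have "\<dots> = (\<Sum>k\<in>{1..d}. \<theta> k * (LBINT t:{0..T}. kl_profile T k t))"
        unfolding set_lebesgue_integral_def by (subst Bochner_Integration.integral_sum[OF i]) simp
      finally show ?thesis .
    qed
    also have "a * (\<Sum>k\<in>{1..d}. \<theta> k * (LBINT t:{0..T}. kl_profile T k t)) = (\<Sum>k\<in>{1..d}. \<theta> k * drift_coeff T a k)"
      unfolding sum_distrib_left using integral_kl_profile[OF T, of _ a] by (intro sum.cong refl) (auto simp: mult_ac)
    finally have left: "(CLINT \<omega>|completion M. iexp (\<Sum>k\<in>{1..d}. \<theta> k * kl_coeff T X k \<omega>)) =
      exp (\<i> * of_real (\<Sum>k\<in>{1..d}. \<theta> k * drift_coeff T a k) + T *\<^sub>R (CLINT u|unif. comp_int c (p u)))" .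
    \<comment> \<open>The limits in the coordinates combine to the limit of the scalar series with marks \<open>p (U j)\<close>.\<close>
    define Y where "Y \<omega> = (\<Sum>k\<in>{1..d}. \<theta> k * V k \<omega>)" for \<omega>
    have Y[measurable]: "Y \<in> borel_measurable N"
      unfolding Y_def by (intro borel_measurable_sum borel_measurable_times V borel_measurable_const)
    have limY: "AE \<omega> in N. (\<lambda>n. (\<Sum>j<n. \<phi> (\<Gamma> (Suc j) \<omega>) * p (U (Suc j) \<omega>))
        - (LBINT r:{0<..\<Gamma> n \<omega>}. (c * (\<integral>u. p u \<partial>unif)) * \<phi> r)) \<longlonglongrightarrow> Y \<omega>"
    proof -
      have "AE \<omega> in N. \<forall>k\<in>{1..d}. (\<lambda>n. (\<Sum>j<n. \<phi> (\<Gamma> (Suc j) \<omega>) * kl_profile T k (T * U (Suc j) \<omega>))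
        - kl_mean k * (LBINT r:{0<..\<Gamma> n \<omega>}. c * \<phi> r)) \<longlonglongrightarrow> V k \<omega>"
        using lim by (intro AE_finite_allI) auto
      then show ?thesis
      proof (rule AE_mp, intro AE_I2 impI)
        fix \<omega> assume l: "\<forall>k\<in>{1..d}. (\<lambda>n. (\<Sum>j<n. \<phi> (\<Gamma> (Suc j) \<omega>) * kl_profile T k (T * U (Suc j) \<omega>))
          - kl_mean k * (LBINT r:{0<..\<Gamma> n \<omega>}. c * \<phi> r)) \<longlonglongrightarrow> V k \<omega>"
        have "(\<lambda>n. \<Sum>k\<in>{1..d}. \<theta> k * ((\<Sum>j<n. \<phi> (\<Gamma> (Suc j) \<omega>) * kl_profile T k (T * U (Suc j) \<omega>))
          - kl_mean k * (LBINT r:{0<..\<Gamma> n \<omega>}. c * \<phi> r))) \<longlonglongrightarrow> Y \<omega>"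
          unfolding Y_def using l by (intro tendsto_sum tendsto_mult tendsto_const) auto
        moreover have "(\<Sum>k\<in>{1..d}. \<theta> k * ((\<Sum>j<n. \<phi> (\<Gamma> (Suc j) \<omega>) * kl_profile T k (T * U (Suc j) \<omega>))
          - kl_mean k * (LBINT r:{0<..\<Gamma> n \<omega>}. c * \<phi> r))) =
          (\<Sum>j<n. \<phi> (\<Gamma> (Suc j) \<omega>) * p (U (Suc j) \<omega>)) - (LBINT r:{0<..\<Gamma> n \<omega>}. (c * (\<integral>u. p u \<partial>unif)) * \<phi> r)" for n
        proof -
          have "(\<Sum>k\<in>{1..d}. \<theta> k * (\<Sum>j<n. \<phi> (\<Gamma> (Suc j) \<omega>) * kl_profile T k (T * U (Suc j) \<omega>))) =
            (\<Sum>j<n. \<phi> (\<Gamma> (Suc j) \<omega>) * p (U (Suc j) \<omega>))"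
            unfolding p_def W_def sum_distrib_left by (subst sum.swap) (simp add: mult_ac)
          moreover have "(\<Sum>k\<in>{1..d}. \<theta> k * (kl_mean k * (LBINT r:{0<..\<Gamma> n \<omega>}. c * \<phi> r))) =
            (LBINT r:{0<..\<Gamma> n \<omega>}. (c * (\<integral>u. p u \<partial>unif)) * \<phi> r)"
          proof -
            have "(LBINT r:{0<..\<Gamma> n \<omega>}. (c * (\<integral>u. p u \<partial>unif)) * \<phi> r) = (c * (\<integral>u. p u \<partial>unif)) * (LBINT r:{0<..\<Gamma> n \<omega>}. \<phi> r)"
              by (rule set_integral_mult_right)
            moreover have "(LBINT r:{0<..\<Gamma> n \<omega>}. c * \<phi> r) = c * (LBINT r:{0<..\<Gamma> n \<omega>}. \<phi> r)"
              by (rule set_integral_mult_right)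
            ultimately show ?thesis
              unfolding qbar by (simp only: sum_distrib_left sum_distrib_right) (simp add: mult_ac)
          qed
          ultimately show ?thesis by (simp add: right_diff_distrib sum_subtractf)
        qed
        ultimately show "(\<lambda>n. (\<Sum>j<n. \<phi> (\<Gamma> (Suc j) \<omega>) * p (U (Suc j) \<omega>))
          - (LBINT r:{0<..\<Gamma> n \<omega>}. (c * (\<integral>u. p u \<partial>unif)) * \<phi> r)) \<longlonglongrightarrow> Y \<omega>" by simp
      qed
    qed
    have int2': "set_integrable lborel {0<..s} (\<lambda>r. (c * (\<integral>u. p u \<partial>unif)) * \<phi> r)" for s
      using set_integrable_mult_right[OF int2[of s], of "\<integral>u. p u \<partial>unif"] by (simp add: mult_ac)
    have "(CLINT \<omega>|N. iexp (Y \<omega>)) = exp (T *\<^sub>R (CLINT u|unif. comp_int c (p u)))"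
      using char_of_compensated_limit[OF jump_measurable jump_isCont _ jump_integral_comp_exp(1)[OF c dom _ p_le] int2' limY Y]
        jump_integral_comp_exp(2)[OF c dom _ p_le] by simp
    then have "(CLINT \<omega>|N. iexp (\<Sum>k\<in>{1..d}. \<theta> k * (drift_coeff T a k + V k \<omega>))) =
      exp (\<i> * of_real (\<Sum>k\<in>{1..d}. \<theta> k * drift_coeff T a k)) * exp (T *\<^sub>R (CLINT u|unif. comp_int c (p u)))"
      unfolding Y_def by (simp add: distrib_left sum.distrib exp_add)
    then show "(CLINT \<omega>|completion M. iexp (\<Sum>k\<in>{1..d}. \<theta> k * kl_coeff T X k \<omega>)) =
      (CLINT \<omega>|N. iexp (\<Sum>k\<in>{1..d}. \<theta> k * (drift_coeff T a k + V k \<omega>)))"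
      unfolding left exp_add by simp
  qed (use Z_meas V in auto)
  show ?thesis
    unfolding kl_coeffs_distr_def eq_in_distr_def
    using law Z_meas V by (auto intro!: measurable_restrict)
qed

lemma min_one_square_integrable: "integrable \<nu> (\<lambda>x. min 1 (x\<^sup>2))"
  using nu_min by (intro integrableI_nonneg) auto

lemma comp_dom_integrable:
  assumes c: "c = 0 \<or> c = 1" and int: "integrable \<nu> (comp_exp c)"
  shows "integrable \<nu> (comp_dom c)"
proof (rule Bochner_Integration.integrable_bound)
  show "integrable \<nu> (\<lambda>x. norm (comp_exp c x) + 2 * min 1 (x\<^sup>2))"
    using int min_one_square_integrable by auto
  show "AE x in \<nu>. norm (comp_dom c x) \<le> norm (norm (comp_exp c x) + 2 * min 1 (x\<^sup>2))"
    using comp_dom_le[OF c] by (intro AE_I2) (auto intro: order_trans[OF _ abs_ge_self])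
qed simp

lemma kl_decreasing_shot_noise:
  "decreasing_shot_noise N U E \<phi> (\<lambda>u. kl_profile T k (T * u)) \<bar>sqrt (2 * T) / pi / (real k - 1/2)\<bar>"
proof
  show "\<phi> s \<le> \<phi> r" if "0 < r" "r \<le> s" for r s by (rule jump_antimono[OF that])
  show "isCont \<phi> r" if "0 < r" for r by (rule jump_isCont[OF that])
  show "\<bar>kl_profile T k (T * u)\<bar> \<le> \<bar>sqrt (2 * T) / pi / (real k - 1/2)\<bar>" for u by (rule kl_profile_bounded)
qed (use jump_nonneg in simp_all)

text \<open>Transfers integrability of \<open>min 1 |x|\<close> or \<open>min 1 x\<^sup>2\<close> under the Levy measure to the frozen jump sizes.\<close>

lemma truncated_jump_le:
  assumes "r > 0"
  shows "\<phi> (max r 1) \<le> max 1 (\<phi> 1) * min 1 (\<phi> r)"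
proof -
  have a: "\<phi> (max r 1) \<le> \<phi> r" "\<phi> (max r 1) \<le> \<phi> 1" using assms by (auto intro!: jump_antimono)
  show ?thesis
  proof (cases "\<phi> r \<le> 1")
    case True
    have "1 * \<phi> r \<le> max 1 (\<phi> 1) * \<phi> r" by (rule mult_right_mono) (auto simp: jump_nonneg)
    then show ?thesis using a True by simp
  next
    case False
    then show ?thesis using a by simp
  qed
qed

lemma truncated_jump_integrable:
  assumes "integrable \<nu> (\<lambda>x. min 1 \<bar>x\<bar>)"
  shows "set_integrable lborel {0<..} (\<lambda>r. \<phi> (max r 1))"
  unfolding set_integrable_def
proof (rule Bochner_Integration.integrable_bound)
  have "integrable lborel (\<lambda>r. indicator {0<..} r *\<^sub>R min 1 \<bar>\<phi> r\<bar>)"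
    by (subst integrable_jump[where f="\<lambda>x. min 1 \<bar>x\<bar>"]) (use assms in auto)
  then show "integrable lborel (\<lambda>r. max 1 (\<phi> 1) * (indicator {0<..} r *\<^sub>R min 1 \<bar>\<phi> r\<bar>))"
    by (rule integrable_mult_right)
  show "AE r in lborel. norm (indicator {0<..} r *\<^sub>R \<phi> (max r 1)) \<le> norm (max 1 (\<phi> 1) * (indicator {0<..} r *\<^sub>R min 1 \<bar>\<phi> r\<bar>))"
    using truncated_jump_le by (intro AE_I2) (auto simp: jump_nonneg abs_mult split: split_indicator)
qed simp

lemma truncated_jump_square_integrable: "set_integrable lborel {0<..} (\<lambda>r. (\<phi> (max r 1))\<^sup>2)"
  unfolding set_integrable_def
proof (rule Bochner_Integration.integrable_bound)
  have "integrable lborel (\<lambda>r. indicator {0<..} r *\<^sub>R min 1 ((\<phi> r)\<^sup>2))"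
    by (subst integrable_jump[where f="\<lambda>x. min 1 (x\<^sup>2)"]) (use min_one_square_integrable in auto)
  then show "integrable lborel (\<lambda>r. (max 1 (\<phi> 1))\<^sup>2 * (indicator {0<..} r *\<^sub>R min 1 ((\<phi> r)\<^sup>2)))"
    by (rule integrable_mult_right)
  have "(\<phi> (max r 1))\<^sup>2 \<le> (max 1 (\<phi> 1))\<^sup>2 * min 1 ((\<phi> r)\<^sup>2)" if "r > 0" for r
  proof -
    have "(\<phi> (max r 1))\<^sup>2 \<le> (max 1 (\<phi> 1) * min 1 (\<phi> r))\<^sup>2"
      by (intro power_mono truncated_jump_le that jump_nonneg)
    also have "(min 1 (\<phi> r))\<^sup>2 = min 1 ((\<phi> r)\<^sup>2)"
      using jump_nonneg[of r] abs_square_le_1[of "\<phi> r"] by (auto simp: min_def)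
    then have "(max 1 (\<phi> 1) * min 1 (\<phi> r))\<^sup>2 = (max 1 (\<phi> 1))\<^sup>2 * min 1 ((\<phi> r)\<^sup>2)"
      by (simp add: power_mult_distrib)
    finally show ?thesis .
  qed
  then show "AE r in lborel. norm (indicator {0<..} r *\<^sub>R (\<phi> (max r 1))\<^sup>2) \<le> norm ((max 1 (\<phi> 1))\<^sup>2 * (indicator {0<..} r *\<^sub>R min 1 ((\<phi> r)\<^sup>2)))"
    by (intro AE_I2) (auto simp: abs_mult split: split_indicator)
qed simp

lemma jump_integrable:
  assumes dom: "integrable \<nu> (comp_dom 1)"
  shows "set_integrable lborel {0<..s} \<phi>"
  unfolding set_integrable_def
proof (rule Bochner_Integration.integrable_bound)
  have "integrable lborel (\<lambda>r. indicator {0<..} r *\<^sub>R comp_dom 1 (\<phi> r))"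
    by (subst integrable_jump) (use dom in auto)
  moreover have "emeasure lborel {0<..s} < \<infinity>" by (cases "0 \<le> s") auto
  then have "integrable lborel (\<lambda>r. indicator {0<..s} r :: real)" by (intro integrable_real_indicator) auto
  ultimately show "integrable lborel (\<lambda>r. indicator {0<..} r *\<^sub>R comp_dom 1 (\<phi> r) + indicator {0<..s} r)"
    by (rule Bochner_Integration.integrable_add)
  have "y \<le> comp_dom 1 y + 1" if "0 \<le> y" for y :: real
  proof (cases "y \<le> 1")
    case True
    then show ?thesis using comp_dom_simps(2)[of 1 y] by linarith
  next
    case False
    then have "y \<le> y\<^sup>2" by (simp add: power2_eq_square)
    then show ?thesis using that by (simp add: comp_dom_def)
  qed
  from this[OF jump_nonneg] show "AE r in lborel. norm (indicator {0<..s} r *\<^sub>R \<phi> r) \<le> norm (indicator {0<..} r *\<^sub>R comp_dom 1 (\<phi> r) + indicator {0<..s} r)"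
    by (intro AE_I2) (auto simp: jump_nonneg split: split_indicator intro: order_trans[OF _ abs_ge_self])
qed simp

lemma shot_measurable [measurable]:
  "(\<lambda>\<omega>. shot_H T \<pi> k (\<Gamma> (Suc i) \<omega>) (U (Suc i) \<omega>)) \<in> borel_measurable N"
proof -
  have [measurable]: "U (Suc i) \<in> borel_measurable N" by (auto intro: U_measurable[unfolded One_nat_def])
  show ?thesis unfolding shot_H_factor by measurable
qed

text \<open>The cut-off \<open>0\<close> is admissible only if small jumps are summable, so the series converges absolutely and
  nothing is compensated.\<close>

theorem shot_noise_bounded_variation:
  fixes M :: "'a measure" and X :: "real \<Rightarrow> 'a \<Rightarrow> real"
  assumes X: "levy_process M X" and gt: "generating_triple M X a 0 \<nu> (\<lambda>_. 0)"
  shows "AE \<omega> in N. \<forall>k\<in>{1..d}. summable (\<lambda>i. shot_H T \<pi> k (\<Gamma> (Suc i) \<omega>) (U (Suc i) \<omega>))"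
    and "kl_coeffs_distr d T M X N (\<lambda>k \<omega>. drift_coeff T a k + (\<Sum>i. shot_H T \<pi> k (\<Gamma> (Suc i) \<omega>) (U (Suc i) \<omega>)))"
proof -
  have ce: "comp_exp 0 (z * x) = exp (\<i> * of_real (z * x)) - 1 - \<i> * of_real (z * x * 0)" for z x
    by (simp add: comp_exp_def)
  have "integrable \<nu> (\<lambda>x. comp_exp 0 (1 * x))"
    using gt unfolding generating_triple_def ce by blast
  then have dom: "integrable \<nu> (comp_dom 0)" by (intro comp_dom_integrable) auto
  have h1: "set_integrable lborel {0<..} (\<lambda>r. \<phi> (max r 1))"
    using dom by (intro truncated_jump_integrable) (simp add: comp_dom_def[abs_def])
  have sm: "AE \<omega> in N. summable (\<lambda>i. shot_H T \<pi> k (\<Gamma> (Suc i) \<omega>) (U (Suc i) \<omega>))" for k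
  proof -
    interpret S: decreasing_shot_noise N U E \<phi> "\<lambda>u. kl_profile T k (T * u)" "\<bar>sqrt (2 * T) / pi / (real k - 1/2)\<bar>"
      by (rule kl_decreasing_shot_noise)
    show ?thesis using S.AE_summable h1 unfolding S.h_def[abs_def] shot_H_factor by blast
  qed
  then show "AE \<omega> in N. \<forall>k\<in>{1..d}. summable (\<lambda>i. shot_H T \<pi> k (\<Gamma> (Suc i) \<omega>) (U (Suc i) \<omega>))"
    by (intro AE_finite_allI) auto
  show "kl_coeffs_distr d T M X N (\<lambda>k \<omega>. drift_coeff T a k + (\<Sum>i. shot_H T \<pi> k (\<Gamma> (Suc i) \<omega>) (U (Suc i) \<omega>)))"
  proof (rule kl_coeffs_law[OF _ dom X])
    show "char (distr M borel (X t)) z = exp (- of_real t * (- \<i> * of_real (a * z) - comp_int 0 z))" if "t \<ge> 0" for t z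
      using gt that unfolding generating_triple_def levy_exponent_def comp_int_def ce by simp
    show "AE \<omega> in N. (\<lambda>n. (\<Sum>j<n. \<phi> (\<Gamma> (Suc j) \<omega>) * kl_profile T k (T * U (Suc j) \<omega>)) -
        kl_mean k * (LBINT r:{0<..\<Gamma> n \<omega>}. 0 * \<phi> r)) \<longlonglongrightarrow> (\<Sum>i. shot_H T \<pi> k (\<Gamma> (Suc i) \<omega>) (U (Suc i) \<omega>))" for k
      using sm[of k] by eventually_elim (use summable_LIMSEQ in \<open>auto simp: shot_H_factor\<close>)
  qed (auto simp: set_integrable_def)
qed

lemma shot_C_eq: "shot_C T \<pi> k s = kl_mean k * (LBINT r:{0<..s}. \<phi> r)"
proof -
  have "(LBINT v:{0..1}. shot_H T \<pi> k r v) = kl_mean k * \<phi> r" for r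
    unfolding shot_H_factor kl_mean_def by (subst integral_unif) (simp_all add: mult.commute)
  then show ?thesis unfolding shot_C_def by simp
qed

text \<open>The jumps are compensated by their mean; since the cut-off \<open>1\<close> is admissible, the compensator of the large jumps
  is finite and no drift remains.\<close>

theorem shot_noise_centred:
  fixes M :: "'a measure" and X :: "real \<Rightarrow> 'a \<Rightarrow> real"
  assumes X: "levy_process M X" and gt: "generating_triple M X 0 0 \<nu> (\<lambda>_. 1)"
  defines "S \<equiv> \<lambda>k \<omega> n. (\<Sum>i=1..n. shot_H T \<pi> k (\<Gamma> i \<omega>) (U i \<omega>)) - shot_C T \<pi> k (real n)"
  shows "AE \<omega> in N. \<forall>k\<in>{1..d}. convergent (S k \<omega>)"
    and "kl_coeffs_distr d T M X N (\<lambda>k \<omega>. lim (S k \<omega>))"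
proof -
  have ce: "comp_exp 1 (z * x) = exp (\<i> * of_real (z * x)) - 1 - \<i> * of_real (z * x * 1)" for z x
    by (simp add: comp_exp_def)
  have "integrable \<nu> (\<lambda>x. comp_exp 1 (1 * x))"
    using gt unfolding generating_triple_def ce by blast
  then have dom: "integrable \<nu> (comp_dom 1)" by (intro comp_dom_integrable) auto
  note int = jump_integrable[OF dom]
  have S: "S k \<omega> n = (\<Sum>i<n. \<phi> (\<Gamma> (Suc i) \<omega>) * kl_profile T k (T * U (Suc i) \<omega>)) - kl_mean k * (LBINT r:{0<..real n}. \<phi> r)" for k \<omega> n
    unfolding S_def shot_C_eq shot_H_factor by (simp add: sum.atLeast1_atMost_eq)
  have conv: "AE \<omega> in N. convergent (S k \<omega>) \<and> (\<lambda>n. (LBINT r:{0<..\<Gamma> n \<omega>}. \<phi> r) - (LBINT r:{0<..real n}. \<phi> r)) \<longlonglongrightarrow> 0" for k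
  proof -
    interpret D: decreasing_shot_noise N U E \<phi> "\<lambda>u. kl_profile T k (T * u)" "\<bar>sqrt (2 * T) / pi / (real k - 1/2)\<bar>"
      by (rule kl_decreasing_shot_noise)
    have "kl_mean k = D.qbar" unfolding kl_mean_def D.qbar_def ..
    then show ?thesis
      using D.AE_convergent_compensated[OF int] truncated_jump_square_integrable unfolding D.h_def[abs_def] S[abs_def] by simp
  qed
  have "AE \<omega> in N. convergent (S k \<omega>)" for k using conv[of k] by eventually_elim simp
  then show "AE \<omega> in N. \<forall>k\<in>{1..d}. convergent (S k \<omega>)"
    by (intro AE_finite_allI) auto
  have "kl_coeffs_distr d T M X N (\<lambda>k \<omega>. drift_coeff T 0 k + lim (S k \<omega>))"
  proof (rule kl_coeffs_law[OF _ dom X])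
    show "char (distr M borel (X t)) z = exp (- of_real t * (- \<i> * of_real (0 * z) - comp_int 1 z))" if "t \<ge> 0" for t z
      using gt that unfolding generating_triple_def levy_exponent_def comp_int_def ce by simp
    show "set_integrable lborel {0<..s} (\<lambda>r. 1 * \<phi> r)" for s using int by simp
    show "(\<lambda>\<omega>. lim (S k \<omega>)) \<in> borel_measurable N" for k
    proof -
      have [measurable]: "U (Suc i) \<in> borel_measurable N" for i by (auto intro: U_measurable[unfolded One_nat_def])
      have [measurable]: "(\<lambda>\<omega>. S k \<omega> n) \<in> borel_measurable N" for n unfolding S by measurable
      show ?thesis by measurable
    qed
    show "AE \<omega> in N. (\<lambda>n. (\<Sum>j<n. \<phi> (\<Gamma> (Suc j) \<omega>) * kl_profile T k (T * U (Suc j) \<omega>)) -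
        kl_mean k * (LBINT r:{0<..\<Gamma> n \<omega>}. 1 * \<phi> r)) \<longlonglongrightarrow> lim (S k \<omega>)" for k
      using conv[of k]
    proof eventually_elim
      case (elim \<omega>)
      then have "S k \<omega> \<longlonglongrightarrow> lim (S k \<omega>)" by (simp add: convergent_LIMSEQ_iff)
      from tendsto_diff[OF this tendsto_mult[OF tendsto_const[of "kl_mean k"] conjunct2[OF elim]]]
      show ?case by (simp add: S algebra_simps)
    qed
  qed simp
  then show "kl_coeffs_distr d T M X N (\<lambda>k \<omega>. lim (S k \<omega>))" by (simp add: drift_coeff_def)
qed

end

theorem theorem4:
  fixes T :: real and d :: nat and \<pi> :: "real \<Rightarrow> real"
    and N :: "'b measure" and U E :: "nat \<Rightarrow> 'b \<Rightarrow> real"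
    and M :: "'a measure" and X :: "real \<Rightarrow> 'a \<Rightarrow> real" and a :: real
  assumes "T > 0"
    and "levy_density \<pi>"
    and "\<And>x. x > 0 \<Longrightarrow> \<pi> x > 0"
    and "\<And>x. x \<le> 0 \<Longrightarrow> \<pi> x = 0"
    and "prob_space N"
    and "prob_space.indep_vars N (\<lambda>_. borel) U {1..}"
    and "\<And>i. i \<ge> 1 \<Longrightarrow> distr N borel (U i) = uniform_measure lborel {0..1}"
    and "prob_space.indep_vars N (\<lambda>_. borel) E {1..}"
    and "\<And>i. i \<ge> 1 \<Longrightarrow> distributed N lborel (E i) (exponential_density 1)"
    and "prob_space.indep_var N
           (PiM {1..} (\<lambda>_. borel)) (\<lambda>\<omega>. \<lambda>i\<in>{1..}. U i \<omega>)
           (PiM {1..} (\<lambda>_. borel)) (\<lambda>\<omega>. \<lambda>i\<in>{1..}. arrival E i \<omega>)"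
  shows "(X \<in> class_KB M \<and> generating_triple M X a 0 (density_measure \<pi>) (\<lambda>_. 0) \<longrightarrow>
            (AE \<omega> in N. \<forall>k\<in>{1..d}.
               summable (\<lambda>i. shot_H T \<pi> k (arrival E (Suc i) \<omega>) (U (Suc i) \<omega>))) \<and>
            kl_coeffs_distr d T M X N
              (\<lambda>k \<omega>. drift_coeff T a k
                 + (\<Sum>i. shot_H T \<pi> k (arrival E (Suc i) \<omega>) (U (Suc i) \<omega>)))) \<and>
         (X \<in> class_K M \<and> generating_triple M X 0 0 (density_measure \<pi>) (\<lambda>_. 1) \<longrightarrow>
            (AE \<omega> in N. \<forall>k\<in>{1..d}.
               convergent (\<lambda>n. (\<Sum>i=1..n. shot_H T \<pi> k (arrival E i \<omega>) (U i \<omega>))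
                               - shot_C T \<pi> k (real n))) \<and>
            kl_coeffs_distr d T M X N
              (\<lambda>k \<omega>. lim (\<lambda>n. (\<Sum>i=1..n. shot_H T \<pi> k (arrival E i \<omega>) (U i \<omega>))
                               - shot_C T \<pi> k (real n))))"
proof -
  interpret kl_shot_noise \<pi> T N U E
  proof -
    interpret prob_space N by fact
    show "kl_shot_noise \<pi> T N U E"
      by unfold_locales (use assms in auto)
  qed
  show ?thesis
  proof (intro conjI impI; elim conjE)
    assume "X \<in> class_KB M" and gt: "generating_triple M X a 0 (density_measure \<pi>) (\<lambda>_. 0)"
    then have X: "levy_process M X" by (simp add: class_KB_def class_K_def)
    show "AE \<omega> in N. \<forall>k\<in>{1..d}. summable (\<lambda>i. shot_H T \<pi> k (arrival E (Suc i) \<omega>) (U (Suc i) \<omega>))"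
      by (rule shot_noise_bounded_variation(1)[OF X gt])
    show "kl_coeffs_distr d T M X N
        (\<lambda>k \<omega>. drift_coeff T a k + (\<Sum>i. shot_H T \<pi> k (arrival E (Suc i) \<omega>) (U (Suc i) \<omega>)))"
      by (rule shot_noise_bounded_variation(2)[OF X gt])
  next
    assume "X \<in> class_K M" and gt: "generating_triple M X 0 0 (density_measure \<pi>) (\<lambda>_. 1)"
    then have X: "levy_process M X" by (simp add: class_K_def)
    show "AE \<omega> in N. \<forall>k\<in>{1..d}. convergent (\<lambda>n. (\<Sum>i=1..n. shot_H T \<pi> k (arrival E i \<omega>) (U i \<omega>)) - shot_C T \<pi> k (real n))"
      by (rule shot_noise_centred(1)[OF X gt])
    show "kl_coeffs_distr d T M X N
        (\<lambda>k \<omega>. lim (\<lambda>n. (\<Sum>i=1..n. shot_H T \<pi> k (arrival E i \<omega>) (U i \<omega>)) - shot_C T \<pi> k (real n)))"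
      by (rule shot_noise_centred(2)[OF X gt])
  qed
qed

end
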